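(* Let $\mathcal S$ be a triangulated category with a good metric $\{\mathcal M_i,\ i\in\mathbb N\}$. Let $\mathfrak S(\mathcal S)$ be the triangulated category constructed from this metric, and let $\{\mathcal N_i\subset\mathfrak S(\mathcal S),\ i\in\mathbb N\}$ be the full subcategories $\mathcal N_i=\mathcal L_i\cap\mathfrak S(\mathcal S)$ (all defined in the context). Then $\{\mathcal N_i,\ i\in\mathbb N\}$ is a good metric on the triangulated category $\mathfrak S(\mathcal S)$.
   Context: Conventions: subcategories are full; $\Sigma$ is the shift; for classes of objects $\mathcal A,\mathcal B$ in a triangulated category, $\mathcal A*\mathcal B$ is the class of objects $b$ for which there is a distinguished triangle $a\to b\to c\to\Sigma a$ with $a\in\mathcal A$, $c\in\mathcal B$; $\mathcal A^\perp=\{b:\mathrm{Hom}(a,b)=0\ \forall a\in\mathcal A\}$. A good metric on a triangulated category $\mathcal S$ is a sequence of full subcategories $\{\mathcal M_i,\ i\in\mathbb N\}$ with (i) $0\in\mathcal M_i$ and $\Sigma^{-1}\mathcal M_{i+1}\cup\mathcal M_{i+1}\cup\Sigma\mathcal M_{i+1}\subset\mathcal M_i$ and (ii) $\mathcal M_i*\mathcal M_i\subset\mathcal M_i$, for all $i$. A sequence $E_1\to E_2\to E_3\to\cdots$ in $\mathcal S$ is Cauchy if for every $i$ there is $N$ such that for all $k>j\ge N$ the cone of $E_j\to E_k$ lies in $\mathcal M_i$. A Cauchy sequence of triangles is a sequence $a_*\to b_*\to c_*\to\Sigma a_*$ of distinguished triangles and maps of triangles, with $a_*,b_*,c_*$ Cauchy.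 $\mathrm{Mod}\text{-}\mathcal S$ is the abelian category of additive functors $\mathcal S^{op}\to\mathrm{Ab}$, $Y:\mathcal S\to\mathrm{Mod}\text{-}\mathcal S$ is the Yoneda embedding, and $\Sigma$ extends to $\mathrm{Mod}\text{-}\mathcal S$ so that $Y\Sigma=\Sigma Y$. $\mathfrak L(\mathcal S)\subset\mathrm{Mod}\text{-}\mathcal S$ is the full subcategory of objects isomorphic to $\mathrm{colim}\,Y(E_* )$ with $E_*$ a Cauchy sequence in $\mathcal S$, and $\mathfrak S(\mathcal S)=\mathfrak L(\mathcal S)\cap\bigcup_{i}Y(\mathcal M_i)^\perp$. A strong triangle in $\mathfrak L(\mathcal S)$ is a sequence $A\to B\to C\to\Sigma A$ isomorphic to the colimit of the image under $Y$ of a Cauchy sequence of triangles. It is known (earlier work) that $\mathfrak S(\mathcal S)$ is a triangulated category whose distinguished triangles are the strong triangles with all objects in $\mathfrak S(\mathcal S)$ (and if two of the three objects of a strong triangle lie in $\mathfrak S(\mathcal S)$, so does the third). $\mathcal L_i\subset\mathfrak L(\mathcal S)$ is the full subcategory of objects isomorphic to $\mathrm{colim}\,Y(E_* )$ with $E_*$ a Cauchy sequence in $\mathcal S$ all of whose terms lie in $\mathcal M_i$. *)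

theory Defs
  imports "HOL-Algebra.Weak_Morphisms"
begin

text \<open>
  Abelian groups are commutative groups in the sense of HOL-Algebra, hence written
  multiplicatively: in a hom group, \<open>\<otimes>\<close> is the sum of morphisms and \<open>\<one>\<close> is the zero morphism.
\<close>

section \<open>Additive and triangulated categories\<close>

record ('o, 'm) cat =
  Obj :: "'o set"
  Dom :: "'m \<Rightarrow> 'o"
  Cod :: "'m \<Rightarrow> 'o"
  Hom :: "'o \<Rightarrow> 'o \<Rightarrow> 'm monoid"
  Cmp :: "'m \<Rightarrow> 'm \<Rightarrow> 'm"  (infixl "\<cdot>\<index>" 70)
  Idn :: "'o \<Rightarrow> 'm"

record ('o, 'm) scat = "('o, 'm) cat" +
  Sob :: "'o \<Rightarrow> 'o"
  Smor :: "'m \<Rightarrow> 'm"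

text \<open>
  A triangle \<open>A \<rightarrow> B \<rightarrow> C \<rightarrow> \<Sigma>A\<close> is given by its three morphisms \<open>(u, v, w)\<close>, which know their
  domains and codomains. \<open>Tri\<close> is the set of distinguished triangles.
\<close>

record ('o, 'm) tcat = "('o, 'm) scat" +
  Tri :: "('m \<times> 'm \<times> 'm) set"

definition Arr :: "('o, 'm, 'z) cat_scheme \<Rightarrow> 'm set" where
  "Arr C = (\<Union>A\<in>Obj C. \<Union>B\<in>Obj C. carrier (Hom C A B))"

locale category =
  fixes C :: "('o, 'm, 'z) cat_scheme" (structure)
  assumes dom_cod: "\<lbrakk>A \<in> Obj C; B \<in> Obj C; f \<in> carrier (Hom C A B)\<rbrakk> \<Longrightarrow> Dom C f = A \<and> Cod C f = B"
    and idn_hom: "A \<in> Obj C \<Longrightarrow> Idn C A \<in> carrier (Hom C A A)"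
    and cmp_hom: "\<lbrakk>A \<in> Obj C; B \<in> Obj C; D \<in> Obj C; f \<in> carrier (Hom C A B); g \<in> carrier (Hom C B D)\<rbrakk>
      \<Longrightarrow> g \<cdot> f \<in> carrier (Hom C A D)"
    and idn_left: "\<lbrakk>A \<in> Obj C; B \<in> Obj C; f \<in> carrier (Hom C A B)\<rbrakk> \<Longrightarrow> Idn C B \<cdot> f = f"
    and idn_right: "\<lbrakk>A \<in> Obj C; B \<in> Obj C; f \<in> carrier (Hom C A B)\<rbrakk> \<Longrightarrow> f \<cdot> Idn C A = f"
    and cmp_assoc: "\<lbrakk>A \<in> Obj C; B \<in> Obj C; D \<in> Obj C; E \<in> Obj C;
        f \<in> carrier (Hom C A B); g \<in> carrier (Hom C B D); h \<in> carrier (Hom C D E)\<rbrakk>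
      \<Longrightarrow> h \<cdot> (g \<cdot> f) = (h \<cdot> g) \<cdot> f"

definition isomorphism :: "('o, 'm, 'z) cat_scheme \<Rightarrow> 'o \<Rightarrow> 'o \<Rightarrow> 'm \<Rightarrow> bool" where
  "isomorphism C A B f \<longleftrightarrow> f \<in> carrier (Hom C A B) \<and>
     (\<exists>g\<in>carrier (Hom C B A). g \<cdot>\<^bsub>C\<^esub> f = Idn C A \<and> f \<cdot>\<^bsub>C\<^esub> g = Idn C B)"

definition zero_object :: "('o, 'm, 'z) cat_scheme \<Rightarrow> 'o \<Rightarrow> bool" where
  "zero_object C Z \<longleftrightarrow> Z \<in> Obj C \<and>
     (\<forall>A\<in>Obj C. carrier (Hom C A Z) = {\<one>\<^bsub>Hom C A Z\<^esub>} \<and> carrier (Hom C Z A) = {\<one>\<^bsub>Hom C Z A\<^esub>})"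

locale additive_category = category +
  assumes hom_group: "\<lbrakk>A \<in> Obj C; B \<in> Obj C\<rbrakk> \<Longrightarrow> comm_group (Hom C A B)"
    and cmp_add_left: "\<lbrakk>A \<in> Obj C; B \<in> Obj C; D \<in> Obj C;
        f \<in> carrier (Hom C A B); g \<in> carrier (Hom C B D); g' \<in> carrier (Hom C B D)\<rbrakk>
      \<Longrightarrow> (g \<otimes>\<^bsub>Hom C B D\<^esub> g') \<cdot> f = (g \<cdot> f) \<otimes>\<^bsub>Hom C A D\<^esub> (g' \<cdot> f)"
    and cmp_add_right: "\<lbrakk>A \<in> Obj C; B \<in> Obj C; D \<in> Obj C;
        f \<in> carrier (Hom C A B); f' \<in> carrier (Hom C A B); g \<in> carrier (Hom C B D)\<rbrakk>
      \<Longrightarrow> g \<cdot> (f \<otimes>\<^bsub>Hom C A B\<^esub> f') = (g \<cdot> f) \<otimes>\<^bsub>Hom C A D\<^esub> (g \<cdot> f')"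
    and zero_exists: "\<exists>Z. zero_object C Z"
    and biproduct_exists: "\<lbrakk>A \<in> Obj C; B \<in> Obj C\<rbrakk> \<Longrightarrow>
      \<exists>P\<in>Obj C. \<exists>i\<in>carrier (Hom C A P). \<exists>j\<in>carrier (Hom C B P).
        \<exists>p\<in>carrier (Hom C P A). \<exists>q\<in>carrier (Hom C P B).
          p \<cdot> i = Idn C A \<and> q \<cdot> j = Idn C B \<and>
          p \<cdot> j = \<one>\<^bsub>Hom C B A\<^esub> \<and> q \<cdot> i = \<one>\<^bsub>Hom C A B\<^esub> \<and>
          (i \<cdot> p) \<otimes>\<^bsub>Hom C P P\<^esub> (j \<cdot> q) = Idn C P"

text \<open>The shift is an additive automorphism, i.e. strictly invertible, so that \<open>\<Sigma>\<inverse>\<close> makes sense.\<close>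

locale shift_category = additive_category C
  for C :: "('o, 'm, 'z) scat_scheme" (structure) +
  assumes Sob_bij: "bij_betw (Sob C) (Obj C) (Obj C)"
    and Smor_iso: "\<lbrakk>A \<in> Obj C; B \<in> Obj C\<rbrakk> \<Longrightarrow> Smor C \<in> iso (Hom C A B) (Hom C (Sob C A) (Sob C B))"
    and Smor_idn: "A \<in> Obj C \<Longrightarrow> Smor C (Idn C A) = Idn C (Sob C A)"
    and Smor_cmp: "\<lbrakk>A \<in> Obj C; B \<in> Obj C; D \<in> Obj C;
        f \<in> carrier (Hom C A B); g \<in> carrier (Hom C B D)\<rbrakk>
      \<Longrightarrow> Smor C (g \<cdot> f) = Smor C g \<cdot> Smor C f"

definition Sob_inv :: "('o, 'm, 'z) scat_scheme \<Rightarrow> 'o \<Rightarrow> 'o" where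
  "Sob_inv C = inv_into (Obj C) (Sob C)"

definition Smor_inv :: "('o, 'm, 'z) scat_scheme \<Rightarrow> 'm \<Rightarrow> 'm" where
  "Smor_inv C f = inv_into (carrier (Hom C (Sob_inv C (Dom C f)) (Sob_inv C (Cod C f)))) (Smor C) f"

definition triangle :: "('o, 'm, 'z) scat_scheme \<Rightarrow> 'o \<Rightarrow> 'o \<Rightarrow> 'o \<Rightarrow> 'm \<times> 'm \<times> 'm \<Rightarrow> bool" where
  "triangle C X Y Z = (\<lambda>(u, v, w). X \<in> Obj C \<and> Y \<in> Obj C \<and> Z \<in> Obj C \<and>
     u \<in> carrier (Hom C X Y) \<and> v \<in> carrier (Hom C Y Z) \<and> w \<in> carrier (Hom C Z (Sob C X)))"

definition dist_triangle :: "('o, 'm, 'z) tcat_scheme \<Rightarrow> 'o \<Rightarrow> 'o \<Rightarrow> 'o \<Rightarrow> 'm \<times> 'm \<times> 'm \<Rightarrow> bool" where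
  "dist_triangle C X Y Z t \<longleftrightarrow> t \<in> Tri C \<and> triangle C X Y Z t"

definition triangle_map ::
  "('o, 'm, 'z) scat_scheme \<Rightarrow> 'm \<times> 'm \<times> 'm \<Rightarrow> 'm \<times> 'm \<times> 'm \<Rightarrow> 'm \<Rightarrow> 'm \<Rightarrow> 'm \<Rightarrow> bool" where
  "triangle_map C = (\<lambda>(u, v, w) (u', v', w') f g h.
     g \<cdot>\<^bsub>C\<^esub> u = u' \<cdot>\<^bsub>C\<^esub> f \<and> h \<cdot>\<^bsub>C\<^esub> v = v' \<cdot>\<^bsub>C\<^esub> g \<and> Smor C f \<cdot>\<^bsub>C\<^esub> w = w' \<cdot>\<^bsub>C\<^esub> h)"

locale triangulated_category = shift_category C
  for C :: "('o, 'm, 'z) tcat_scheme" (structure) +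
  assumes Tri_triangle: "t \<in> Tri C \<Longrightarrow> \<exists>X Y Z. triangle C X Y Z t"
    and Tri_iso: "\<lbrakk>dist_triangle C X Y Z t; triangle C X' Y' Z' t'; triangle_map C t t' f g h;
        isomorphism C X X' f; isomorphism C Y Y' g; isomorphism C Z Z' h\<rbrakk> \<Longrightarrow> t' \<in> Tri C"
    and Tri_idn: "\<lbrakk>X \<in> Obj C; zero_object C Z\<rbrakk>
      \<Longrightarrow> (Idn C X, \<one>\<^bsub>Hom C X Z\<^esub>, \<one>\<^bsub>Hom C Z (Sob C X)\<^esub>) \<in> Tri C"
    and Tri_complete: "\<lbrakk>X \<in> Obj C; Y \<in> Obj C; u \<in> carrier (Hom C X Y)\<rbrakk>
      \<Longrightarrow> \<exists>Z v w. dist_triangle C X Y Z (u, v, w)"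
    and Tri_rotate: "triangle C X Y Z (u, v, w) \<Longrightarrow>
      (u, v, w) \<in> Tri C \<longleftrightarrow> (v, w, m_inv (Hom C (Sob C X) (Sob C Y)) (Smor C u)) \<in> Tri C"
    and Tri_map: "\<lbrakk>dist_triangle C X Y Z (u, v, w); dist_triangle C X' Y' Z' (u', v', w');
        f \<in> carrier (Hom C X X'); g \<in> carrier (Hom C Y Y'); g \<cdot> u = u' \<cdot> f\<rbrakk>
      \<Longrightarrow> \<exists>h\<in>carrier (Hom C Z Z'). triangle_map C (u, v, w) (u', v', w') f g h"
    and octahedral: "\<lbrakk>dist_triangle C X Y Z' (f, f\<^sub>1, f\<^sub>2); dist_triangle C Y Z X' (g, g\<^sub>1, g\<^sub>2);
        dist_triangle C X Z Y' (g \<cdot> f, h\<^sub>1, h\<^sub>2)\<rbrakk>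
      \<Longrightarrow> \<exists>p q. dist_triangle C Z' Y' X' (p, q, Smor C f\<^sub>1 \<cdot> g\<^sub>2) \<and>
            p \<cdot> f\<^sub>1 = h\<^sub>1 \<cdot> g \<and> h\<^sub>2 \<cdot> p = f\<^sub>2 \<and> q \<cdot> h\<^sub>1 = g\<^sub>1 \<and> g\<^sub>2 \<cdot> q = Smor C f \<cdot> h\<^sub>2"

section \<open>Good metrics and Cauchy sequences\<close>

text \<open>Full subcategories are given by their sets of objects.\<close>

definition star :: "('o, 'm, 'z) tcat_scheme \<Rightarrow> 'o set \<Rightarrow> 'o set \<Rightarrow> 'o set" where
  "star C \<A> \<B> = {b. \<exists>a\<in>\<A>. \<exists>c\<in>\<B>. \<exists>t. dist_triangle C a b c t}"

definition right_orth :: "('o, 'm, 'z) cat_scheme \<Rightarrow> 'o set \<Rightarrow> 'o set" where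
  "right_orth C \<A> = {b \<in> Obj C. \<forall>a\<in>\<A>. carrier (Hom C a b) = {\<one>\<^bsub>Hom C a b\<^esub>}}"

definition good_metric :: "('o, 'm, 'z) tcat_scheme \<Rightarrow> (nat \<Rightarrow> 'o set) \<Rightarrow> bool" where
  "good_metric C \<M> \<longleftrightarrow> (\<forall>i.
     \<M> i \<subseteq> Obj C \<and>
     (\<exists>Z\<in>\<M> i. zero_object C Z) \<and>
     Sob_inv C ` \<M> (Suc i) \<union> \<M> (Suc i) \<union> Sob C ` \<M> (Suc i) \<subseteq> \<M> i \<and>
     star C (\<M> i) (\<M> i) \<subseteq> \<M> i)"

definition seq_in :: "('o, 'm, 'z) cat_scheme \<Rightarrow> (nat \<Rightarrow> 'o) \<Rightarrow> (nat \<Rightarrow> 'm) \<Rightarrow> bool" where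
  "seq_in C E e \<longleftrightarrow> (\<forall>n. E n \<in> Obj C \<and> e n \<in> carrier (Hom C (E n) (E (Suc n))))"

text \<open>\<open>seq_map C E e j d\<close> is the composite \<open>E j \<rightarrow> E (j + d)\<close>.\<close>

primrec seq_map :: "('o, 'm, 'z) cat_scheme \<Rightarrow> (nat \<Rightarrow> 'o) \<Rightarrow> (nat \<Rightarrow> 'm) \<Rightarrow> nat \<Rightarrow> nat \<Rightarrow> 'm" where
  "seq_map C E e j 0 = Idn C (E j)"
| "seq_map C E e j (Suc d) = e (j + d) \<cdot>\<^bsub>C\<^esub> seq_map C E e j d"

text \<open>
  Cones are only defined up to isomorphism, but the members of a good metric are closed under
  isomorphism, so it does not matter which cone is tested for membership.
\<close>

definition is_cone :: "('o, 'm, 'z) tcat_scheme \<Rightarrow> 'm \<Rightarrow> 'o \<Rightarrow> bool" where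
  "is_cone C u Z \<longleftrightarrow> (\<exists>v w. dist_triangle C (Dom C u) (Cod C u) Z (u, v, w))"

definition cauchy ::
  "('o, 'm, 'z) tcat_scheme \<Rightarrow> (nat \<Rightarrow> 'o set) \<Rightarrow> (nat \<Rightarrow> 'o) \<Rightarrow> (nat \<Rightarrow> 'm) \<Rightarrow> bool" where
  "cauchy C \<M> E e \<longleftrightarrow> seq_in C E e \<and>
     (\<forall>i. \<exists>N. \<forall>j k. N \<le> j \<and> j < k \<longrightarrow> (\<exists>Z\<in>\<M> i. is_cone C (seq_map C E e j (k - j)) Z))"

definition cauchy_triangles ::
  "('o, 'm, 'z) tcat_scheme \<Rightarrow> (nat \<Rightarrow> 'o set) \<Rightarrow>
   (nat \<Rightarrow> 'o) \<Rightarrow> (nat \<Rightarrow> 'm) \<Rightarrow> (nat \<Rightarrow> 'o) \<Rightarrow> (nat \<Rightarrow> 'm) \<Rightarrow> (nat \<Rightarrow> 'o) \<Rightarrow> (nat \<Rightarrow> 'm) \<Rightarrow>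
   (nat \<Rightarrow> 'm \<times> 'm \<times> 'm) \<Rightarrow> bool" where
  "cauchy_triangles C \<M> a a' b b' c c' t \<longleftrightarrow>
     cauchy C \<M> a a' \<and> cauchy C \<M> b b' \<and> cauchy C \<M> c c' \<and>
     (\<forall>n. dist_triangle C (a n) (b n) (c n) (t n) \<and>
          triangle_map C (t n) (t (Suc n)) (a' n) (b' n) (c' n))"

definition is_colim ::
  "('o, 'm, 'z) cat_scheme \<Rightarrow> (nat \<Rightarrow> 'o) \<Rightarrow> (nat \<Rightarrow> 'm) \<Rightarrow> 'o \<Rightarrow> (nat \<Rightarrow> 'm) \<Rightarrow> bool" where
  "is_colim C E e L l \<longleftrightarrow> L \<in> Obj C \<and>
     (\<forall>n. l n \<in> carrier (Hom C (E n) L) \<and> l (Suc n) \<cdot>\<^bsub>C\<^esub> e n = l n) \<and>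
     (\<forall>Z\<in>Obj C. \<forall>m. (\<forall>n. m n \<in> carrier (Hom C (E n) Z) \<and> m (Suc n) \<cdot>\<^bsub>C\<^esub> e n = m n) \<longrightarrow>
        (\<exists>!h. h \<in> carrier (Hom C L Z) \<and> (\<forall>n. h \<cdot>\<^bsub>C\<^esub> l n = m n)))"

section \<open>The category of additive functors to abelian groups\<close>

text \<open>
  Abelian groups are taken with carriers in a type \<open>'g\<close>, which plays the role of the universe.
  If \<open>'g\<close> is infinite, sequential colimits of such groups can again be realised on \<open>'g\<close>.
  Functors and natural transformations are made extensional (undefined outside their domain),
  so that equality is equality of functors and of natural transformations, respectively.
\<close>

record ('o, 'm, 'g) psh =
  Pob :: "'o \<Rightarrow> 'g monoid"
  Pmor :: "'m \<Rightarrow> 'g \<Rightarrow> 'g"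

definition additive_psh :: "('o, 'm, 'z) cat_scheme \<Rightarrow> ('o, 'm, 'g) psh \<Rightarrow> bool" where
  "additive_psh S F \<longleftrightarrow>
     Pob F \<in> extensional (Obj S) \<and> Pmor F \<in> extensional (Arr S) \<and>
     (\<forall>s\<in>Obj S. comm_group (Pob F s)) \<and>
     (\<forall>s\<in>Obj S. \<forall>t\<in>Obj S. \<forall>f\<in>carrier (Hom S s t).
        Pmor F f \<in> hom (Pob F t) (Pob F s) \<inter> extensional (carrier (Pob F t))) \<and>
     (\<forall>s\<in>Obj S. Pmor F (Idn S s) = (\<lambda>x\<in>carrier (Pob F s). x)) \<and>
     (\<forall>s\<in>Obj S. \<forall>t\<in>Obj S. \<forall>r\<in>Obj S. \<forall>f\<in>carrier (Hom S s t). \<forall>g\<in>carrier (Hom S t r).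
        Pmor F (g \<cdot>\<^bsub>S\<^esub> f) = compose (carrier (Pob F r)) (Pmor F f) (Pmor F g)) \<and>
     (\<forall>s\<in>Obj S. \<forall>t\<in>Obj S. \<forall>f\<in>carrier (Hom S s t). \<forall>g\<in>carrier (Hom S s t).
        Pmor F (f \<otimes>\<^bsub>Hom S s t\<^esub> g) = (\<lambda>x\<in>carrier (Pob F t). Pmor F f x \<otimes>\<^bsub>Pob F s\<^esub> Pmor F g x))"

text \<open>A morphism \<open>F \<rightarrow> G\<close> is a triple \<open>(F, G, \<eta>)\<close> with \<open>\<eta>\<close> the family of components.\<close>

type_synonym ('o, 'm, 'g) nt = "('o, 'm, 'g) psh \<times> ('o, 'm, 'g) psh \<times> ('o \<Rightarrow> 'g \<Rightarrow> 'g)"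

definition nat_trans ::
  "('o, 'm, 'z) cat_scheme \<Rightarrow> ('o, 'm, 'g) psh \<Rightarrow> ('o, 'm, 'g) psh \<Rightarrow> ('o \<Rightarrow> 'g \<Rightarrow> 'g) set" where
  "nat_trans S F G = {\<eta> \<in> extensional (Obj S).
     (\<forall>s\<in>Obj S. \<eta> s \<in> hom (Pob F s) (Pob G s) \<inter> extensional (carrier (Pob F s))) \<and>
     (\<forall>s\<in>Obj S. \<forall>t\<in>Obj S. \<forall>f\<in>carrier (Hom S s t). \<forall>x\<in>carrier (Pob F t).
        \<eta> s (Pmor F f x) = Pmor G f (\<eta> t x))}"

definition nt_group ::
  "('o, 'm, 'z) cat_scheme \<Rightarrow> ('o, 'm, 'g) psh \<Rightarrow> ('o, 'm, 'g) psh \<Rightarrow> ('o, 'm, 'g) nt monoid" where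
  "nt_group S F G = \<lparr>
     carrier = {(F, G, \<eta>) |\<eta>. \<eta> \<in> nat_trans S F G},
     mult = (\<lambda>(_, _, \<eta>) (_, _, \<theta>). (F, G, \<lambda>s\<in>Obj S. \<lambda>x\<in>carrier (Pob F s). \<eta> s x \<otimes>\<^bsub>Pob G s\<^esub> \<theta> s x)),
     one = (F, G, \<lambda>s\<in>Obj S. \<lambda>x\<in>carrier (Pob F s). \<one>\<^bsub>Pob G s\<^esub>)\<rparr>"

definition nt_comp ::
  "('o, 'm, 'z) cat_scheme \<Rightarrow> ('o, 'm, 'g) nt \<Rightarrow> ('o, 'm, 'g) nt \<Rightarrow> ('o, 'm, 'g) nt" where
  "nt_comp S = (\<lambda>(G, H, \<theta>) (F, G', \<eta>). (F, H, \<lambda>s\<in>Obj S. compose (carrier (Pob F s)) (\<theta> s) (\<eta> s)))"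

definition psh_shift :: "('o, 'm, 'z) scat_scheme \<Rightarrow> ('o, 'm, 'g) psh \<Rightarrow> ('o, 'm, 'g) psh" where
  "psh_shift S F = \<lparr>Pob = (\<lambda>s\<in>Obj S. Pob F (Sob_inv S s)), Pmor = (\<lambda>f\<in>Arr S. Pmor F (Smor_inv S f))\<rparr>"

definition nt_shift :: "('o, 'm, 'z) scat_scheme \<Rightarrow> ('o, 'm, 'g) nt \<Rightarrow> ('o, 'm, 'g) nt" where
  "nt_shift S = (\<lambda>(F, G, \<eta>). (psh_shift S F, psh_shift S G, \<lambda>s\<in>Obj S. \<eta> (Sob_inv S s)))"

definition ModCat :: "('o, 'm, 'z) scat_scheme \<Rightarrow> (('o, 'm, 'g) psh, ('o, 'm, 'g) nt) scat" where
  "ModCat S = \<lparr>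
     Obj = {F. additive_psh S F},
     Dom = (\<lambda>(F, G, \<eta>). F),
     Cod = (\<lambda>(F, G, \<eta>). G),
     Hom = nt_group S,
     Cmp = nt_comp S,
     Idn = (\<lambda>F. (F, F, \<lambda>s\<in>Obj S. \<lambda>x\<in>carrier (Pob F s). x)),
     Sob = psh_shift S,
     Smor = nt_shift S\<rparr>"

text \<open>
  The representable functors have values in groups with carriers in \<open>'m\<close>; an injection
  \<open>\<iota> :: 'm \<Rightarrow> 'g\<close> is used to move these groups into the universe \<open>'g\<close>.
\<close>

definition Yob :: "('m \<Rightarrow> 'g) \<Rightarrow> ('o, 'm, 'z) cat_scheme \<Rightarrow> 'o \<Rightarrow> ('o, 'm, 'g) psh" where
  "Yob \<iota> S a = \<lparr>
     Pob = (\<lambda>s\<in>Obj S. image_group \<iota> (Hom S s a)),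
     Pmor = (\<lambda>f\<in>Arr S. \<lambda>x\<in>\<iota> ` carrier (Hom S (Cod S f) a). \<iota> (the_inv \<iota> x \<cdot>\<^bsub>S\<^esub> f))\<rparr>"

definition Ymor :: "('m \<Rightarrow> 'g) \<Rightarrow> ('o, 'm, 'z) cat_scheme \<Rightarrow> 'm \<Rightarrow> ('o, 'm, 'g) nt" where
  "Ymor \<iota> S f = (Yob \<iota> S (Dom S f), Yob \<iota> S (Cod S f),
     \<lambda>s\<in>Obj S. \<lambda>x\<in>\<iota> ` carrier (Hom S s (Dom S f)). \<iota> (f \<cdot>\<^bsub>S\<^esub> the_inv \<iota> x))"

text \<open>
  The canonical isomorphism \<open>Y(\<Sigma>a) \<rightarrow> \<Sigma>Y(a)\<close>, given by \<open>\<Sigma>\<inverse> : Hom(s, \<Sigma>a) \<rightarrow> Hom(\<Sigma>\<inverse>s, a)\<close>,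
  along which \<open>Y \<circ> \<Sigma>\<close> and \<open>\<Sigma> \<circ> Y\<close> are identified.
\<close>

definition Yshift :: "('m \<Rightarrow> 'g) \<Rightarrow> ('o, 'm, 'z) scat_scheme \<Rightarrow> 'o \<Rightarrow> ('o, 'm, 'g) nt" where
  "Yshift \<iota> S a = (Yob \<iota> S (Sob S a), psh_shift S (Yob \<iota> S a),
     \<lambda>s\<in>Obj S. \<lambda>x\<in>\<iota> ` carrier (Hom S s (Sob S a)). \<iota> (Smor_inv S (the_inv \<iota> x)))"

section \<open>The completion\<close>

text \<open>
  Colimits are defined by their universal property, hence only up to isomorphism. So the objects
  isomorphic to a given colimit are precisely those which are a colimit for some cocone.
\<close>

definition L_objs ::
  "('m \<Rightarrow> 'g) \<Rightarrow> ('o, 'm, 'z) tcat_scheme \<Rightarrow> (nat \<Rightarrow> 'o set) \<Rightarrow> ('o, 'm, 'g) psh set" where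
  "L_objs \<iota> S \<M> = {F. \<exists>E e l. cauchy S \<M> E e \<and>
     is_colim (ModCat S) (\<lambda>n. Yob \<iota> S (E n)) (\<lambda>n. Ymor \<iota> S (e n)) F l}"

definition L_metric ::
  "('m \<Rightarrow> 'g) \<Rightarrow> ('o, 'm, 'z) tcat_scheme \<Rightarrow> (nat \<Rightarrow> 'o set) \<Rightarrow> nat \<Rightarrow> ('o, 'm, 'g) psh set" where
  "L_metric \<iota> S \<M> i = {F. \<exists>E e l. cauchy S \<M> E e \<and> (\<forall>n. E n \<in> \<M> i) \<and>
     is_colim (ModCat S) (\<lambda>n. Yob \<iota> S (E n)) (\<lambda>n. Ymor \<iota> S (e n)) F l}"

definition S_objs ::
  "('m \<Rightarrow> 'g) \<Rightarrow> ('o, 'm, 'z) tcat_scheme \<Rightarrow> (nat \<Rightarrow> 'o set) \<Rightarrow> ('o, 'm, 'g) psh set" where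
  "S_objs \<iota> S \<M> = L_objs \<iota> S \<M> \<inter> (\<Union>i. right_orth (ModCat S) (Yob \<iota> S ` \<M> i))"

text \<open>
  A strong triangle: a triangle together with colimit cocones \<open>\<alpha>\<close>, \<open>\<beta>\<close>, \<open>\<gamma>\<close> exhibiting it as the
  colimit of the image under \<open>Y\<close> of a Cauchy sequence of triangles.
\<close>

definition strong_triangle ::
  "('m \<Rightarrow> 'g) \<Rightarrow> ('o, 'm, 'z) tcat_scheme \<Rightarrow> (nat \<Rightarrow> 'o set) \<Rightarrow>
   ('o, 'm, 'g) psh \<Rightarrow> ('o, 'm, 'g) psh \<Rightarrow> ('o, 'm, 'g) psh \<Rightarrow>
   ('o, 'm, 'g) nt \<times> ('o, 'm, 'g) nt \<times> ('o, 'm, 'g) nt \<Rightarrow> bool" where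
  "strong_triangle \<iota> S \<M> A B C = (\<lambda>(u, v, w). triangle (ModCat S) A B C (u, v, w) \<and>
     (\<exists>a a' b b' c c' f g h \<alpha> \<beta> \<gamma>.
        cauchy_triangles S \<M> a a' b b' c c' (\<lambda>n. (f n, g n, h n)) \<and>
        is_colim (ModCat S) (\<lambda>n. Yob \<iota> S (a n)) (\<lambda>n. Ymor \<iota> S (a' n)) A \<alpha> \<and>
        is_colim (ModCat S) (\<lambda>n. Yob \<iota> S (b n)) (\<lambda>n. Ymor \<iota> S (b' n)) B \<beta> \<and>
        is_colim (ModCat S) (\<lambda>n. Yob \<iota> S (c n)) (\<lambda>n. Ymor \<iota> S (c' n)) C \<gamma> \<and>
        (\<forall>n. u \<cdot>\<^bsub>ModCat S\<^esub> \<alpha> n = \<beta> n \<cdot>\<^bsub>ModCat S\<^esub> Ymor \<iota> S (f n) \<and>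
             v \<cdot>\<^bsub>ModCat S\<^esub> \<beta> n = \<gamma> n \<cdot>\<^bsub>ModCat S\<^esub> Ymor \<iota> S (g n) \<and>
             w \<cdot>\<^bsub>ModCat S\<^esub> \<gamma> n =
               Smor (ModCat S) (\<alpha> n) \<cdot>\<^bsub>ModCat S\<^esub> (Yshift \<iota> S (a n) \<cdot>\<^bsub>ModCat S\<^esub> Ymor \<iota> S (h n)))))"

definition S_cat ::
  "('m \<Rightarrow> 'g) \<Rightarrow> ('o, 'm, 'z) tcat_scheme \<Rightarrow> (nat \<Rightarrow> 'o set) \<Rightarrow>
   (('o, 'm, 'g) psh, ('o, 'm, 'g) nt) tcat" where
  "S_cat \<iota> S \<M> = \<lparr>
     Obj = S_objs \<iota> S \<M>,
     Dom = Dom (ModCat S),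
     Cod = Cod (ModCat S),
     Hom = Hom (ModCat S),
     Cmp = Cmp (ModCat S),
     Idn = Idn (ModCat S),
     Sob = Sob (ModCat S),
     Smor = Smor (ModCat S),
     Tri = {t. \<exists>A\<in>S_objs \<iota> S \<M>. \<exists>B\<in>S_objs \<iota> S \<M>. \<exists>C\<in>S_objs \<iota> S \<M>. strong_triangle \<iota> S \<M> A B C t}\<rparr>"

definition N_metric ::
  "('m \<Rightarrow> 'g) \<Rightarrow> ('o, 'm, 'z) tcat_scheme \<Rightarrow> (nat \<Rightarrow> 'o set) \<Rightarrow> nat \<Rightarrow> ('o, 'm, 'g) psh set" where
  "N_metric \<iota> S \<M> i = L_metric \<iota> S \<M> i \<inter> S_objs \<iota> S \<M>"

end

theory Submission
  imports Defs
begin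

text \<open>
  By Yoneda, a colimit of a sequence of representables is computed pointwise, so everything can be
  phrased in terms of sections. Only closure under extensions is not formal. Let \<open>A \<rightarrow> B \<rightarrow> D \<rightarrow> \<Sigma>A\<close> be a
  strong triangle with \<open>A\<close>, \<open>D\<close> colimits of Cauchy sequences \<open>x\<close>, \<open>z\<close> in \<open>\<M>\<^sub>i\<close>. After passing to
  subsequences, \<open>D \<rightarrow> \<Sigma>A\<close> comes from compatible maps \<open>z\<^sub>n \<rightarrow> \<Sigma>x\<^sub>n\<close>. Complete these to triangles
  \<open>x\<^sub>n \<rightarrow> y\<^sub>n \<rightarrow> z\<^sub>n\<close>, so that \<open>y\<^sub>n \<in> \<M>\<^sub>i * \<M>\<^sub>i\<close>, and choose the maps \<open>y\<^sub>n \<rightarrow> y\<^sub>n\<^sub>+\<^sub>1\<close> such that their cones are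
  extensions of the cones for \<open>x\<close> and \<open>z\<close>; then \<open>y\<close> is Cauchy. The axiom on maps of triangles gives a
  section of \<open>B\<close> over \<open>y\<^sub>0\<close>, and it extends uniquely along \<open>y\<close>, since \<open>B\<close> vanishes on some \<open>\<M>\<^sub>k\<close> and
  hence inverts maps with small cones. The five lemma shows that \<open>B\<close> is the colimit of \<open>y\<close>.
\<close>

section \<open>Morphisms in additive categories\<close>

text \<open>The terms of the given presentation of the strong triangle need not lie in
  \<open>\<M> i\<close>: the sequences witnessing that \<open>A\<close> and \<open>D\<close> belong
  to the \<open>i\<close>-th member are unrelated to it. Its middle terms are therefore useless as a
  presentation of \<open>B\<close>. The given presentation serves only to show that
  \<open>A \<rightarrow> B \<rightarrow> D \<rightarrow> \<Sigma>A\<close> is exact on sections and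
  to produce the section of \<open>B\<close> over the first new term.

  If \<open>B\<close> vanishes on \<open>\<M> k\<close>, the steps must have cones in
  \<open>\<M> (k + 1)\<close>: uniqueness of an extended section needs \<open>B\<close> to vanish on
  the cone, existence needs it on the desuspended cone, and desuspension costs one index.

  Colimits are given only by their universal property. Reading them pointwise requires some
  pointwise colimit whose groups live on \<open>'g\<close>; this is where the infinite universe
  enters.\<close>

context category
begin

text \<open>Hom sets are unconstrained away from objects, so membership of both endpoints travels
  with the morphism.\<close>

definition mor :: "'m \<Rightarrow> 'o \<Rightarrow> 'o \<Rightarrow> bool" where
  "mor f A B \<longleftrightarrow> A \<in> Obj C \<and> B \<in> Obj C \<and> f \<in> carrier (Hom C A B)"

lemma mor_obj: "mor f A B \<Longrightarrow> A \<in> Obj C" "mor f A B \<Longrightarrow> B \<in> Obj C"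
  and mor_carrier: "mor f A B \<Longrightarrow> f \<in> carrier (Hom C A B)"
  and mor_Arr: "mor f A B \<Longrightarrow> f \<in> Arr C"
  and mor_dom: "mor f A B \<Longrightarrow> Dom C f = A"
  and mor_cod: "mor f A B \<Longrightarrow> Cod C f = B"
  using dom_cod by (auto simp: mor_def Arr_def)

lemma Arr_iff_mor: "f \<in> Arr C \<longleftrightarrow> mor f (Dom C f) (Cod C f)"
  using dom_cod by (auto simp: mor_def Arr_def)

lemma mor_idn: "A \<in> Obj C \<Longrightarrow> mor (Idn C A) A A"
  by (simp add: mor_def idn_hom)

lemma mor_cmp: "mor f A B \<Longrightarrow> mor g B D \<Longrightarrow> mor (g \<cdot> f) A D"
  by (auto simp: mor_def intro: cmp_hom)

lemma cmp_mor_assoc: "mor f A B \<Longrightarrow> mor g B D \<Longrightarrow> mor h D E \<Longrightarrow> (h \<cdot> g) \<cdot> f = h \<cdot> (g \<cdot> f)"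
  unfolding mor_def using cmp_assoc[of A B D E f g h] by simp

lemma idn_cmp: "mor f A B \<Longrightarrow> Idn C B \<cdot> f = f"
  and cmp_idn: "mor f A B \<Longrightarrow> f \<cdot> Idn C A = f"
  by (auto simp: mor_def idn_left idn_right)

lemma seq_in_mor: "seq_in C E e \<Longrightarrow> mor (e n) (E n) (E (Suc n))"
  by (simp add: seq_in_def mor_def)

lemma seq_inI: "(\<And>n. mor (e n) (E n) (E (Suc n))) \<Longrightarrow> seq_in C E e"
  by (simp add: seq_in_def mor_def)

lemma seq_in_obj: "seq_in C E e \<Longrightarrow> E n \<in> Obj C"
  by (simp add: seq_in_def)

lemma seq_map_mor: "seq_in C E e \<Longrightarrow> mor (seq_map C E e j d) (E j) (E (j + d))"
proof (induction d)
  case (Suc d)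
  then show ?case using mor_cmp seq_in_mor by fastforce
qed (simp add: mor_idn seq_in_obj)

lemma seq_map_add:
  assumes "seq_in C E e"
  shows "seq_map C E e j (d + d') = seq_map C E e (j + d) d' \<cdot> seq_map C E e j d"
proof (induction d')
  case 0
  show ?case by (simp add: idn_cmp[OF seq_map_mor[OF assms]])
next
  case (Suc d')
  show ?case
    using Suc cmp_mor_assoc[OF seq_map_mor[OF assms, of j d] seq_map_mor[OF assms, of "j + d" d'],
        of "e (j + d + d')"] seq_in_mor[OF assms, of "j + d + d'"]
    by (simp add: add.assoc)
qed

text \<open>Indexed by both endpoints instead of a length, so that composites and subsequences need
  no arithmetic on differences. Meaningful for \<open>n \<le> m\<close> only; otherwise truncated
  subtraction yields an identity.\<close>

definition tr :: "(nat \<Rightarrow> 'o) \<Rightarrow> (nat \<Rightarrow> 'm) \<Rightarrow> nat \<Rightarrow> nat \<Rightarrow> 'm" where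
  "tr E e n m = seq_map C E e n (m - n)"

lemma tr_mor: "seq_in C E e \<Longrightarrow> n \<le> m \<Longrightarrow> mor (tr E e n m) (E n) (E m)"
  unfolding tr_def using seq_map_mor[of E e n "m - n"] by simp

lemma tr_tr: "seq_in C E e \<Longrightarrow> n \<le> m \<Longrightarrow> m \<le> p \<Longrightarrow> tr E e m p \<cdot> tr E e n m = tr E e n p"
  unfolding tr_def using seq_map_add[of E e n "m - n" "p - m"] by simp

lemma tr_cmp:
  assumes "seq_in C E e" "n \<le> m" "m \<le> p" "mor f s (E n)"
  shows "tr E e m p \<cdot> (tr E e n m \<cdot> f) = tr E e n p \<cdot> f"
  using cmp_mor_assoc[OF assms(4) tr_mor[OF assms(1,2)] tr_mor[OF assms(1,3)]] tr_tr[OF assms(1-3)]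
  by simp

lemma tr_refl [simp]: "tr E e n n = Idn C (E n)"
  by (simp add: tr_def)

lemma tr_Suc: "seq_in C E e \<Longrightarrow> tr E e n (Suc n) = e n"
  by (simp add: tr_def cmp_idn[OF seq_in_mor])

lemma tr_natural:
  assumes E: "seq_in C E e" and E': "seq_in C E' e'" and g: "\<And>n. mor (g n) (E n) (E' n)"
    and sq: "\<And>n. g (Suc n) \<cdot> e n = e' n \<cdot> g n" and "n \<le> m"
  shows "g m \<cdot> tr E e n m = tr E' e' n m \<cdot> g n"
  using assms(5)
proof (induction m rule: dec_induct)
  case base
  show ?case using idn_cmp[OF g] cmp_idn[OF g] by simp
next
  case (step m)
  note t = tr_mor[OF E step.hyps(1)] and t' = tr_mor[OF E' step.hyps(1)]
  have "tr E e n (Suc m) = e m \<cdot> tr E e n m" "tr E' e' n (Suc m) = e' m \<cdot> tr E' e' n m"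
    using tr_tr[OF E, of n m "Suc m"] tr_tr[OF E', of n m "Suc m"] tr_Suc[OF E] tr_Suc[OF E'] step.hyps(1) by simp_all
  then show ?case
    using cmp_mor_assoc[OF t seq_in_mor[OF E] g] cmp_mor_assoc[OF t g seq_in_mor[OF E']]
      cmp_mor_assoc[OF g t' seq_in_mor[OF E']] sq step.IH by simp
qed

lemma tr_natural_cmp:
  assumes E: "seq_in C E e" and E': "seq_in C E' e'" and g: "\<And>n. mor (g n) (E n) (E' n)"
    and sq: "\<And>n. g (Suc n) \<cdot> e n = e' n \<cdot> g n" and nm: "n \<le> m" and q: "mor q s (E n)"
  shows "g m \<cdot> (tr E e n m \<cdot> q) = tr E' e' n m \<cdot> (g n \<cdot> q)"
  using tr_natural[OF E E' g sq nm] cmp_mor_assoc[OF q tr_mor[OF E nm] g] cmp_mor_assoc[OF q g tr_mor[OF E' nm]]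
  by simp

end

section \<open>Zero morphisms and signs in additive categories\<close>

context additive_category
begin

abbreviation zr :: "'a \<Rightarrow> 'a \<Rightarrow> 'b" where
  "zr A B \<equiv> \<one>\<^bsub>Hom C A B\<^esub>"

abbreviation ng :: "'a \<Rightarrow> 'a \<Rightarrow> 'b \<Rightarrow> 'b" where
  "ng A B f \<equiv> m_inv (Hom C A B) f"

lemma hom_is_group: "A \<in> Obj C \<Longrightarrow> B \<in> Obj C \<Longrightarrow> group (Hom C A B)"
  by (rule comm_group.axioms(2)[OF hom_group])

lemma mor_zr: "A \<in> Obj C \<Longrightarrow> B \<in> Obj C \<Longrightarrow> mor (zr A B) A B"
  using hom_is_group[of A B] by (simp add: mor_def group.is_monoid monoid.one_closed)

lemma mor_ng: "mor f A B \<Longrightarrow> mor (ng A B f) A B"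
  using hom_is_group[of A B] by (simp add: mor_def)

lemma mor_add: "mor f A B \<Longrightarrow> mor g A B \<Longrightarrow> mor (f \<otimes>\<^bsub>Hom C A B\<^esub> g) A B"
  using hom_is_group[of A B] by (simp add: mor_def group.is_monoid monoid.m_closed)

lemma ng_ng: "mor f A B \<Longrightarrow> ng A B (ng A B f) = f"
  using hom_is_group[of A B] by (simp add: mor_def)

lemma ng_zr: "A \<in> Obj C \<Longrightarrow> B \<in> Obj C \<Longrightarrow> ng A B (zr A B) = zr A B"
  using hom_is_group[of A B] by (simp add: group.inv_equality[of _ "zr A B" "zr A B"] group.is_monoid)

lemma cmp_hom_right: "mor g B D \<Longrightarrow> A \<in> Obj C \<Longrightarrow> (\<lambda>f. g \<cdot> f) \<in> hom (Hom C A B) (Hom C A D)"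
  by (auto simp: hom_def mor_def cmp_hom cmp_add_right)

lemma cmp_hom_left: "mor f A B \<Longrightarrow> D \<in> Obj C \<Longrightarrow> (\<lambda>g. g \<cdot> f) \<in> hom (Hom C B D) (Hom C A D)"
  by (auto simp: hom_def mor_def cmp_hom cmp_add_left)

lemma cmp_zr: "mor g B D \<Longrightarrow> A \<in> Obj C \<Longrightarrow> g \<cdot> zr A B = zr A D"
  using hom_one[OF cmp_hom_right] hom_is_group mor_obj by blast

lemma zr_cmp: "mor f A B \<Longrightarrow> D \<in> Obj C \<Longrightarrow> zr B D \<cdot> f = zr A D"
  using hom_one[OF cmp_hom_left] hom_is_group mor_obj by blast

lemma cmp_ng: "mor f A B \<Longrightarrow> mor g B D \<Longrightarrow> g \<cdot> ng A B f = ng A D (g \<cdot> f)"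
  using group_hom.hom_inv[of "Hom C A B" "Hom C A D" "\<lambda>f. g \<cdot> f" f] cmp_hom_right[of g B D A]
    hom_is_group mor_obj mor_carrier
  by (simp add: group_hom_def group_hom_axioms_def)

lemma ng_cmp: "mor f A B \<Longrightarrow> mor g B D \<Longrightarrow> ng B D g \<cdot> f = ng A D (g \<cdot> f)"
  using group_hom.hom_inv[of "Hom C B D" "Hom C A D" "\<lambda>g. g \<cdot> f" g] cmp_hom_left[of f A B D]
    hom_is_group mor_obj mor_carrier
  by (simp add: group_hom_def group_hom_axioms_def)

lemma ng_eq_zr: "mor f A B \<Longrightarrow> ng A B f = zr A B \<Longrightarrow> f = zr A B"
  using ng_ng ng_zr mor_obj by metis

lemma ng_ng_cmp: "mor f A B \<Longrightarrow> mor g B D \<Longrightarrow> ng B D g \<cdot> ng A B f = g \<cdot> f"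
  using cmp_ng[OF _ mor_ng, of f A B g D] ng_cmp[of f A B g D] ng_ng[OF mor_cmp, of f A B g D] by simp

lemma mor_into_zero: "zero_object C Z \<Longrightarrow> mor f A Z \<Longrightarrow> f = zr A Z"
  by (auto simp: zero_object_def mor_def)

lemma isoI: "mor f A B \<Longrightarrow> mor g B A \<Longrightarrow> g \<cdot> f = Idn C A \<Longrightarrow> f \<cdot> g = Idn C B \<Longrightarrow> isomorphism C A B f"
  by (auto simp: isomorphism_def mor_def)

lemma iso_idn: "A \<in> Obj C \<Longrightarrow> isomorphism C A A (Idn C A)"
  using mor_idn idn_cmp[OF mor_idn] by (intro isoI[of _ _ _ "Idn C A"]) auto

lemma iso_ng_idn:
  assumes "A \<in> Obj C"
  shows "isomorphism C A A (ng A A (Idn C A))"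
  using assms mor_ng[OF mor_idn] ng_ng_cmp[OF mor_idn mor_idn] idn_cmp[OF mor_idn]
  by (intro isoI[of _ _ _ "ng A A (Idn C A)"]) auto

end

section \<open>The strictly invertible shift\<close>

context shift_category
begin

lemma Sob_obj: "A \<in> Obj C \<Longrightarrow> Sob C A \<in> Obj C"
  using Sob_bij by (auto simp: bij_betw_def)

lemma Sob_inv_obj: "A \<in> Obj C \<Longrightarrow> Sob_inv C A \<in> Obj C"
  unfolding Sob_inv_def using Sob_bij by (metis bij_betw_def inv_into_into)

lemma Sob_Sob_inv: "A \<in> Obj C \<Longrightarrow> Sob C (Sob_inv C A) = A"
  unfolding Sob_inv_def using Sob_bij by (metis bij_betw_inv_into_right)

lemma Sob_inv_Sob: "A \<in> Obj C \<Longrightarrow> Sob_inv C (Sob C A) = A"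
  unfolding Sob_inv_def using Sob_bij by (metis bij_betw_inv_into_left)

lemma mor_Smor: "mor f A B \<Longrightarrow> mor (Smor C f) (Sob C A) (Sob C B)"
  using Smor_iso[of A B] by (auto simp: mor_def Sob_obj iso_def hom_def)

lemma Smor_inj: "mor f A B \<Longrightarrow> mor g A B \<Longrightarrow> Smor C f = Smor C g \<Longrightarrow> f = g"
  using Smor_iso[of A B] by (auto simp: mor_def iso_def bij_betw_def inj_on_def)

lemma Smor_surj:
  assumes "A \<in> Obj C" "B \<in> Obj C" "mor g (Sob C A) (Sob C B)"
  obtains f where "mor f A B" "g = Smor C f"
  using assms Smor_iso[of A B] by (auto simp: mor_def iso_def bij_betw_def)

lemma Smor_cmp_mor: "mor f A B \<Longrightarrow> mor g B D \<Longrightarrow> Smor C (g \<cdot> f) = Smor C g \<cdot> Smor C f"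
  using Smor_cmp by (auto simp: mor_def)

lemma Smor_group_hom: "A \<in> Obj C \<Longrightarrow> B \<in> Obj C \<Longrightarrow>
    group_hom (Hom C A B) (Hom C (Sob C A) (Sob C B)) (Smor C)"
  using Smor_iso[of A B] hom_is_group Sob_obj
  by (auto simp: group_hom_def group_hom_axioms_def iso_def)

lemma Smor_zr: "A \<in> Obj C \<Longrightarrow> B \<in> Obj C \<Longrightarrow> Smor C (zr A B) = zr (Sob C A) (Sob C B)"
  using group_hom.hom_one[OF Smor_group_hom] .

lemma Smor_add: "mor f A B \<Longrightarrow> mor g A B \<Longrightarrow>
    Smor C (f \<otimes>\<^bsub>Hom C A B\<^esub> g) = Smor C f \<otimes>\<^bsub>Hom C (Sob C A) (Sob C B)\<^esub> Smor C g"
  using Smor_iso[of A B] by (auto simp: mor_def iso_def hom_def)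

lemma Smor_inv_Smor: "mor f A B \<Longrightarrow> Smor_inv C (Smor C f) = f"
  unfolding Smor_inv_def using mor_dom[OF mor_Smor] mor_cod[OF mor_Smor] Smor_iso[of A B]
  by (auto simp: mor_obj Sob_inv_Sob iso_def bij_betw_def mor_carrier)

lemma mor_Smor_inv: "mor f A B \<Longrightarrow> mor (Smor_inv C f) (Sob_inv C A) (Sob_inv C B)"
  by (metis Smor_inv_Smor Smor_surj Sob_Sob_inv Sob_inv_obj mor_obj)

lemma Smor_Smor_inv: "mor f A B \<Longrightarrow> Smor C (Smor_inv C f) = f"
  by (metis Smor_inv_Smor Smor_surj Sob_Sob_inv Sob_inv_obj mor_obj)

text \<open>An object is zero as soon as its identity is the zero morphism, and the shift preserves
  identities and zero morphisms.\<close>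

lemma zero_object_Sob:
  assumes "zero_object C Z"
  shows "zero_object C (Sob C Z)"
proof -
  have Z: "Z \<in> Obj C" using assms by (simp add: zero_object_def)
  have "Idn C Z = zr Z Z" using mor_into_zero[OF assms] mor_idn[OF Z] by blast
  then have id: "Idn C (Sob C Z) = zr (Sob C Z) (Sob C Z)"
    using Smor_idn[OF Z] Smor_zr[OF Z Z] by simp
  have "f = zr A (Sob C Z)" if "mor f A (Sob C Z)" for f A
    using id that idn_cmp zr_cmp mor_obj by metis
  moreover have "f = zr (Sob C Z) A" if "mor f (Sob C Z) A" for f A
    using id that cmp_idn cmp_zr mor_obj by metis
  ultimately show ?thesis using Sob_obj[OF Z] mor_zr by (auto simp: zero_object_def mor_def)
qed

lemma triangle_iff:
  "triangle C X Y Z (u, v, w) \<longleftrightarrow> mor u X Y \<and> mor v Y Z \<and> mor w Z (Sob C X)"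
  using Sob_obj by (auto simp: triangle_def mor_def)

end

section \<open>Triangulated categories\<close>

context triangulated_category
begin

lemma dist_iff: "dist_triangle C X Y Z (u, v, w) \<longleftrightarrow>
    (u, v, w) \<in> Tri C \<and> mor u X Y \<and> mor v Y Z \<and> mor w Z (Sob C X)"
  by (simp add: dist_triangle_def triangle_iff)

lemma dist_mor:
  assumes "dist_triangle C X Y Z (u, v, w)"
  shows "mor u X Y" "mor v Y Z" "mor w Z (Sob C X)" "X \<in> Obj C" "Y \<in> Obj C" "Z \<in> Obj C"
  using assms mor_obj by (auto simp: dist_iff)

lemma dist_rotate: "dist_triangle C X Y Z (u, v, w) \<Longrightarrow>
    dist_triangle C Y Z (Sob C X) (v, w, ng (Sob C X) (Sob C Y) (Smor C u))"
  using Tri_rotate[of X Y Z u v w] by (auto simp: dist_triangle_def triangle_iff mor_Smor mor_ng)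

lemma dist_unrotate: "dist_triangle C Y Z (Sob C X) (v, w, ng (Sob C X) (Sob C Y) (Smor C u)) \<Longrightarrow>
    mor u X Y \<Longrightarrow> dist_triangle C X Y Z (u, v, w)"
  using Tri_rotate[of X Y Z u v w] by (auto simp: dist_triangle_def triangle_iff)

lemma dist_idn:
  "X \<in> Obj C \<Longrightarrow> zero_object C Z \<Longrightarrow> dist_triangle C X X Z (Idn C X, zr X Z, zr Z (Sob C X))"
  using Tri_idn[of X Z] by (auto simp: dist_iff mor_idn mor_zr Sob_obj zero_object_def)

text \<open>The triangle \<open>X \<rightarrow> X \<rightarrow> 0\<close> maps to the given one by
  the identity and \<open>u\<close>, so the composite factors through a zero object.\<close>

lemma dist_cmp_zero:
  assumes "dist_triangle C X Y Z (u, v, w)"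
  shows "v \<cdot> u = zr X Z"
proof -
  obtain W where W: "zero_object C W" using zero_exists by blast
  note m = dist_mor[OF assms]
  obtain h where h: "mor h W Z" "triangle_map C (Idn C X, zr X W, zr W (Sob C X)) (u, v, w) (Idn C X) u h"
    using Tri_map[OF dist_idn[OF m(4) W] assms, of "Idn C X" u] m W
    by (auto simp: mor_def idn_hom zero_object_def)
  then show ?thesis using cmp_zr[OF h(1) m(4)] by (simp add: triangle_map_def)
qed

lemma dist_cmp_zero': "dist_triangle C X Y Z (u, v, w) \<Longrightarrow> w \<cdot> v = zr Y (Sob C X)"
  using dist_cmp_zero[OF dist_rotate] .

lemma dist_cmp_zero'':
  assumes "dist_triangle C X Y Z (u, v, w)"
  shows "Smor C u \<cdot> w = zr Z (Sob C Y)"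
proof -
  note m = dist_mor[OF assms]
  have "ng (Sob C X) (Sob C Y) (Smor C u) \<cdot> w = zr Z (Sob C Y)"
    using dist_cmp_zero[OF dist_rotate[OF dist_rotate[OF assms]]] .
  then show ?thesis
    using ng_eq_zr[OF mor_cmp[OF m(3) mor_Smor[OF m(1)]]] ng_cmp[OF m(3) mor_Smor[OF m(1)]] by simp
qed

text \<open>\<open>Tri_map\<close> fills only the third place. After one rotation the wanted map
  sits there, as a map from \<open>\<Sigma>T\<close> to \<open>\<Sigma>X\<close> out of the rotated
  triangle \<open>T \<rightarrow> 0 \<rightarrow> \<Sigma>T\<close>; the two rotation signs cancel
  and the shift is faithful.\<close>

lemma hom_exact:
  assumes t: "dist_triangle C X Y Z (u, v, w)" and p: "mor p T Y" and 0: "v \<cdot> p = zr T Z"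
  obtains q where "mor q T X" "p = u \<cdot> q"
proof -
  obtain W where W: "zero_object C W" using zero_exists by blast
  note m = dist_mor[OF t]
  have T: "T \<in> Obj C" and W': "W \<in> Obj C" using p W by (auto simp: mor_obj zero_object_def)
  have "zr W Z \<cdot> zr T W = v \<cdot> p" using zr_cmp[OF mor_zr[OF T W']] m 0 by simp
  then obtain h where h: "mor h (Sob C T) (Sob C X)"
     "Smor C p \<cdot> ng (Sob C T) (Sob C T) (Smor C (Idn C T)) = ng (Sob C X) (Sob C Y) (Smor C u) \<cdot> h"
    using Tri_map[OF dist_rotate[OF dist_idn[OF T W]] dist_rotate[OF t], of p "zr W Z"] p m W'
      mor_zr[OF W' m(6)] T Sob_obj
    by (auto simp: triangle_map_def mor_def)
  obtain q where q: "mor q T X" "h = Smor C q" using Smor_surj[OF T m(4) h(1)] by blast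
  have "ng (Sob C T) (Sob C Y) (Smor C p) = ng (Sob C T) (Sob C Y) (Smor C (u \<cdot> q))"
    using h(2) cmp_ng[OF mor_idn[OF Sob_obj[OF T]] mor_Smor[OF p]] cmp_idn[OF mor_Smor[OF p]]
      ng_cmp[OF h(1) mor_Smor[OF m(1)]] Smor_cmp_mor[OF q(1) m(1)] q(2) Smor_idn[OF T] by simp
  then have "Smor C p = Smor C (u \<cdot> q)"
    using ng_ng mor_Smor[OF p] mor_Smor[OF mor_cmp[OF q(1) m(1)]] by metis
  then have "p = u \<cdot> q" using Smor_inj[OF p mor_cmp[OF q(1) m(1)]] by simp
  then show ?thesis using that q(1) by blast
qed

lemma hom_exact':
  "dist_triangle C X Y Z (u, v, w) \<Longrightarrow> mor p T Z \<Longrightarrow> w \<cdot> p = zr T (Sob C X) \<Longrightarrow>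
    (\<And>q. mor q T Y \<Longrightarrow> p = v \<cdot> q \<Longrightarrow> thesis) \<Longrightarrow> thesis"
  using hom_exact[OF dist_rotate] .

lemma hom_exact'':
  assumes "dist_triangle C X Y Z (u, v, w)" "mor p T (Sob C X)" "Smor C u \<cdot> p = zr T (Sob C Y)"
  obtains q where "mor q T Z" "p = w \<cdot> q"
proof -
  note m = dist_mor[OF assms(1)]
  have "ng (Sob C X) (Sob C Y) (Smor C u) \<cdot> p = zr T (Sob C Y)"
    using ng_cmp[OF assms(2) mor_Smor[OF m(1)]] assms(3) ng_zr Sob_obj[OF m(5)] mor_obj[OF assms(2)]
    by simp
  then show ?thesis using hom_exact[OF dist_rotate[OF dist_rotate[OF assms(1)]] assms(2)] that by blast
qed

lemma dist_zero_idn: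
  assumes T: "T \<in> Obj C" and W: "zero_object C W"
  shows "dist_triangle C W T T (zr W T, Idn C T, zr T (Sob C W))"
proof (rule dist_unrotate)
  have W': "W \<in> Obj C" using W by (simp add: zero_object_def)
  have "ng (Sob C W) (Sob C T) (Smor C (zr W T)) = zr (Sob C W) (Sob C T)"
    using Smor_zr[OF W' T] ng_zr[OF Sob_obj[OF W'] Sob_obj[OF T]] by simp
  then show "dist_triangle C T T (Sob C W) (Idn C T, zr T (Sob C W), ng (Sob C W) (Sob C T) (Smor C (zr W T)))"
    using dist_idn[OF T zero_object_Sob[OF W]] by simp
  show "mor (zr W T) W T" using mor_zr[OF W' T] .
qed

text \<open>Here the comparison triangle is \<open>0 \<rightarrow> T \<rightarrow> T\<close>, whose
  third place already holds the wanted factorisation.\<close>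

lemma hom_coexact:
  assumes t: "dist_triangle C X Y Z (u, v, w)" and p: "mor p Y T" and 0: "p \<cdot> u = zr X T"
  obtains q where "mor q Z T" "p = q \<cdot> v"
proof -
  obtain W where W: "zero_object C W" using zero_exists by blast
  note m = dist_mor[OF t]
  have T: "T \<in> Obj C" and W': "W \<in> Obj C" using p W by (auto simp: mor_obj zero_object_def)
  have "p \<cdot> u = zr W T \<cdot> zr X W" using zr_cmp[OF mor_zr[OF m(4) W']] T 0 by simp
  then obtain h where h: "mor h Z T" "h \<cdot> v = Idn C T \<cdot> p"
    using Tri_map[OF t dist_zero_idn[OF T W], of "zr X W" p] p m W'
      mor_zr[OF m(4) W'] T by (auto simp: triangle_map_def mor_def)
  then show ?thesis using that idn_cmp[OF p] by simp
qed

text \<open>Three rotations give the shifted triangle with all three signs negative. The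
  automorphism \<open>-1\<close> of the middle object removes the first two signs and leaves the
  third.\<close>

lemma dist_shift:
  assumes t: "triangle C X Y Z (u, v, w)"
  shows "(u, v, w) \<in> Tri C \<longleftrightarrow>
    (Smor C u, Smor C v, ng (Sob C Z) (Sob C (Sob C X)) (Smor C w)) \<in> Tri C"
proof -
  let ?X = "Sob C X" and ?Y = "Sob C Y" and ?Z = "Sob C Z"
  let ?nu = "ng ?X ?Y (Smor C u)" and ?nv = "ng ?Y ?Z (Smor C v)"
    and ?nw = "ng ?Z (Sob C ?X) (Smor C w)"
  have m: "mor u X Y" "mor v Y Z" "mor w Z ?X" using t by (auto simp: triangle_iff)
  note s = mor_Smor[OF m(1)] mor_Smor[OF m(2)] mor_Smor[OF m(3)]
  note n = mor_ng[OF s(1)] mor_ng[OF s(2)] mor_ng[OF s(3)]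
  note o = mor_obj[OF s(1)] mor_obj(2)[OF s(2)] mor_obj(2)[OF s(3)]
  have "(u, v, w) \<in> Tri C \<longleftrightarrow> (v, w, ?nu) \<in> Tri C"
    using Tri_rotate[OF t] .
  also have "\<dots> \<longleftrightarrow> (w, ?nu, ?nv) \<in> Tri C"
    using Tri_rotate[of Y Z ?X v w ?nu] m n by (simp add: triangle_iff)
  also have "\<dots> \<longleftrightarrow> (?nu, ?nv, ?nw) \<in> Tri C"
    using Tri_rotate[of Z ?X ?Y w ?nu ?nv] m n by (simp add: triangle_iff)
  finally have 1: "(u, v, w) \<in> Tri C \<longleftrightarrow> (?nu, ?nv, ?nw) \<in> Tri C" .
  have T: "triangle C ?X ?Y ?Z (?nu, ?nv, ?nw)" "triangle C ?X ?Y ?Z (Smor C u, Smor C v, ?nw)"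
    using s n by (auto simp: triangle_iff)
  note i = mor_idn[OF o(1)] mor_idn[OF o(2)] mor_idn[OF o(3)]
  note ii = iso_idn[OF o(1)] iso_ng_idn[OF o(2)] iso_idn[OF o(3)]
  have "triangle_map C (?nu, ?nv, ?nw) (Smor C u, Smor C v, ?nw) (Idn C ?X) (ng ?Y ?Y (Idn C ?Y)) (Idn C ?Z)"
    unfolding triangle_map_def
    using ng_ng_cmp[OF s(1) i(2)] idn_cmp[OF s(1)] cmp_idn[OF s(1)] idn_cmp[OF n(2)]
      cmp_ng[OF i(2) s(2)] cmp_idn[OF s(2)] cmp_idn[OF n(3)] idn_cmp[OF n(3)] Smor_idn[OF o(1)]
    by simp
  then have 2: "(?nu, ?nv, ?nw) \<in> Tri C \<Longrightarrow> (Smor C u, Smor C v, ?nw) \<in> Tri C"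
    using Tri_iso[of ?X ?Y ?Z "(?nu, ?nv, ?nw)", OF _ T(2) _ ii] T(1) by (simp add: dist_triangle_def)
  have "triangle_map C (Smor C u, Smor C v, ?nw) (?nu, ?nv, ?nw) (Idn C ?X) (ng ?Y ?Y (Idn C ?Y)) (Idn C ?Z)"
    unfolding triangle_map_def
    using ng_cmp[OF s(1) i(2)] idn_cmp[OF s(1)] cmp_idn[OF n(1)] idn_cmp[OF s(2)]
      ng_ng_cmp[OF i(2) s(2)] cmp_idn[OF s(2)] cmp_idn[OF n(3)] idn_cmp[OF n(3)] Smor_idn[OF o(1)]
    by simp
  then have "(Smor C u, Smor C v, ?nw) \<in> Tri C \<Longrightarrow> (?nu, ?nv, ?nw) \<in> Tri C"
    using Tri_iso[of ?X ?Y ?Z "(Smor C u, Smor C v, ?nw)", OF _ T(1) _ ii] T(2) by (simp add: dist_triangle_def)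
  with 1 2 show ?thesis by blast
qed

text \<open>Inverse rotation: \<open>d\<close> is the desuspension of \<open>-w\<close>, so that the
  sign introduced by rotating forward restores \<open>w\<close>.\<close>

lemma dist_back:
  assumes t: "dist_triangle C X Y Z (u, v, w)"
  obtains d where "dist_triangle C (Sob_inv C Z) X Y (d, u, v)" "Smor C d = ng Z (Sob C X) w"
proof -
  note m = dist_mor[OF t]
  let ?Z = "Sob_inv C Z"
  have Z: "?Z \<in> Obj C" "Sob C ?Z = Z" using m by (auto simp: Sob_inv_obj Sob_Sob_inv)
  obtain d where d: "mor d ?Z X" "ng Z (Sob C X) w = Smor C d"
    using Smor_surj[OF Z(1) m(4), of "ng Z (Sob C X) w"] mor_ng[OF m(3)] Z by auto
  have "ng Z (Sob C X) (Smor C d) = w" using d(2) ng_ng[OF m(3)] by simp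
  then have "dist_triangle C ?Z X Y (d, u, v)"
    using dist_unrotate[of X Y ?Z u v d] t d(1) Z by simp
  then show ?thesis using that d(2) by simp
qed

text \<open>Complete the desuspension of \<open>-w\<close> to a triangle and rotate once.\<close>

lemma dist_complete_third:
  assumes w: "mor w Z (Sob C X)" and X: "X \<in> Obj C"
  obtains Y u v where "dist_triangle C X Y Z (u, v, w)"
proof -
  let ?Z = "Sob_inv C Z"
  have Z: "?Z \<in> Obj C" "Sob C ?Z = Z" using mor_obj[OF w] by (auto simp: Sob_inv_obj Sob_Sob_inv)
  obtain d where d: "mor d ?Z X" "ng Z (Sob C X) w = Smor C d"
    using Smor_surj[OF Z(1) X, of "ng Z (Sob C X) w"] mor_ng[OF w] Z by auto
  have w': "ng Z (Sob C X) (Smor C d) = w" using d(2) ng_ng[OF w] by simp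
  obtain Y u v where "dist_triangle C ?Z X Y (d, u, v)"
    using Tri_complete[OF Z(1) X mor_carrier[OF d(1)]] by blast
  then have "dist_triangle C X Y Z (u, v, w)" using dist_rotate w' Z by fastforce
  then show ?thesis using that by blast
qed

text \<open>Rotating both triangles back moves the middle object to the third place, where
  \<open>Tri_map\<close> applies; the compatibility \<open>sq\<close> becomes the square on the new
  first maps after desuspension.\<close>

lemma dist_fill_middle:
  assumes t: "dist_triangle C a b c (f, g, w)" and t': "dist_triangle C a' b' c' (f', g', w')"
    and phi: "mor \<phi> a a'" and h: "mor h c c'" and sq: "Smor C \<phi> \<cdot> w = w' \<cdot> h"
  obtains e where "mor e b b'" "e \<cdot> f = f' \<cdot> \<phi>" "h \<cdot> g = g' \<cdot> e"
proof -
  obtain d where d: "dist_triangle C (Sob_inv C c) a b (d, f, g)" "Smor C d = ng c (Sob C a) w"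
    using dist_back[OF t] .
  obtain d' where d': "dist_triangle C (Sob_inv C c') a' b' (d', f', g')" "Smor C d' = ng c' (Sob C a') w'"
    using dist_back[OF t'] .
  note m = dist_mor[OF d(1)] and m' = dist_mor[OF d'(1)] and h' = mor_Smor_inv[OF h]
  have "Smor C (\<phi> \<cdot> d) = Smor C (d' \<cdot> Smor_inv C h)"
    using Smor_cmp_mor[OF m(1) phi] Smor_cmp_mor[OF h' m'(1)] Smor_Smor_inv[OF h] d(2) d'(2) sq
      cmp_ng[OF dist_mor(3)[OF t] mor_Smor[OF phi]] ng_cmp[OF h dist_mor(3)[OF t']] by simp
  then have "\<phi> \<cdot> d = d' \<cdot> Smor_inv C h"
    using Smor_inj[OF mor_cmp[OF m(1) phi] mor_cmp[OF h' m'(1)]] by simp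
  then obtain e where "e \<in> carrier (Hom C b b')" "triangle_map C (d, f, g) (d', f', g') (Smor_inv C h) \<phi> e"
    using Tri_map[OF d(1) d'(1) mor_carrier[OF h'] mor_carrier[OF phi]] by blast
  then show ?thesis
    using that[of e] m(6) m'(6) Smor_Smor_inv[OF h] by (simp add: triangle_map_def mor_def)
qed

section \<open>Cones of composites and of shifted morphisms\<close>

lemma is_cone_iff: "mor u X Y \<Longrightarrow> is_cone C u Z \<longleftrightarrow> (\<exists>v w. dist_triangle C X Y Z (u, v, w))"
  by (simp add: is_cone_def mor_dom mor_cod)

text \<open>This is the octahedral axiom. It makes morphisms with cones in an extension-closed class
  closed under composition.\<close>

lemma is_cone_cmp:
  assumes f: "mor f X Y" "is_cone C f F" and g: "mor g Y Z" "is_cone C g G"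
  obtains H where "is_cone C (g \<cdot> f) H" "H \<in> star C {F} {G}"
proof -
  obtain f1 f2 where F: "dist_triangle C X Y F (f, f1, f2)" using f is_cone_iff by blast
  obtain g1 g2 where G: "dist_triangle C Y Z G (g, g1, g2)" using g is_cone_iff by blast
  note gf = mor_cmp[OF f(1) g(1)]
  obtain H h1 h2 where H: "dist_triangle C X Z H (g \<cdot> f, h1, h2)"
    using Tri_complete[OF mor_obj(1)[OF gf] mor_obj(2)[OF gf] mor_carrier[OF gf]] by blast
  show ?thesis
    using octahedral[OF F G H] H that[of H] is_cone_iff[OF gf] unfolding star_def by blast
qed

lemma is_cone_shift:
  assumes "mor u X Y"
  shows "is_cone C u Z \<Longrightarrow> is_cone C (Smor C u) (Sob C Z)"
    and "is_cone C (Smor C u) Z \<Longrightarrow> is_cone C u (Sob_inv C Z)"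
proof -
  assume "is_cone C u Z"
  then obtain v w where t: "dist_triangle C X Y Z (u, v, w)" using is_cone_iff[OF assms] by blast
  note m = dist_mor[OF t]
  have "dist_triangle C (Sob C X) (Sob C Y) (Sob C Z)
      (Smor C u, Smor C v, ng (Sob C Z) (Sob C (Sob C X)) (Smor C w))"
    using dist_shift[of X Y Z u v w] t m
    by (auto simp: dist_triangle_def triangle_iff mor_Smor mor_ng)
  then show "is_cone C (Smor C u) (Sob C Z)" using is_cone_iff[OF mor_Smor[OF assms]] by blast
next
  assume "is_cone C (Smor C u) Z"
  then obtain v' w' where t: "dist_triangle C (Sob C X) (Sob C Y) Z (Smor C u, v', w')"
    using is_cone_iff[OF mor_Smor[OF assms]] by blast
  let ?Z = "Sob_inv C Z"
  note m = dist_mor[OF t] and o = mor_obj[OF assms]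
  have Z: "?Z \<in> Obj C" "Sob C ?Z = Z" using m by (auto simp: Sob_inv_obj Sob_Sob_inv)
  obtain v where v: "mor v Y ?Z" "v' = Smor C v" using Smor_surj[OF o(2) Z(1), of v'] m Z by auto
  obtain w where w: "mor w ?Z (Sob C X)" "ng Z (Sob C (Sob C X)) w' = Smor C w"
    using Smor_surj[OF Z(1) Sob_obj[OF o(1)], of "ng Z (Sob C (Sob C X)) w'"] m Z mor_ng by auto
  have "w' = ng Z (Sob C (Sob C X)) (Smor C w)" using w(2) ng_ng[OF m(3)] by simp
  then have "dist_triangle C X Y ?Z (u, v, w)"
    using t dist_shift[of X Y ?Z u v w] assms v w Z by (simp add: dist_triangle_def triangle_iff)
  then show "is_cone C u ?Z" using is_cone_iff[OF assms] by blast
qed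

text \<open>
  An axiom-based filler has no control on its cone. Factoring it through the pushout of the
  first triangle along \<open>\<phi>\<close>, which is also the pullback of the second one along \<open>h\<close>,
  two octahedra give a filler whose cone is an extension of the cones of \<open>\<phi>\<close> and \<open>h\<close>.
\<close>

lemma good_filler:
  assumes t: "dist_triangle C a b c (f, g, w)"
    and w': "mor w' c' (Sob C a')" and a': "a' \<in> Obj C"
    and phi: "mor \<phi> a a'" "is_cone C \<phi> F" and h: "mor h c c'" "is_cone C h H"
    and sq: "Smor C \<phi> \<cdot> w = w' \<cdot> h"
  obtains b' f' g' e G where "dist_triangle C a' b' c' (f', g', w')"
    "mor e b b'" "e \<cdot> f = f' \<cdot> \<phi>" "h \<cdot> g = g' \<cdot> e" "is_cone C e G" "G \<in> star C {F} {H}"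
proof -
  note m = dist_mor[OF t]
  let ?x = "Sob_inv C c" and ?x' = "Sob_inv C c'" and ?X = "Sob_inv C H"
  have c': "c' \<in> Obj C" using mor_obj(1)[OF w'] .
  have x: "?x \<in> Obj C" "Sob C ?x = c" using m by (auto simp: Sob_inv_obj Sob_Sob_inv)
  have x': "?x' \<in> Obj C" "Sob C ?x' = c'" using c' by (auto simp: Sob_inv_obj Sob_Sob_inv)
  obtain r where r: "mor r ?x a" "ng c (Sob C a) w = Smor C r"
    using Smor_surj[OF x(1) m(4), of "ng c (Sob C a) w"] mor_ng[OF m(3)] x by auto
  have wr: "ng c (Sob C a) (Smor C r) = w" using r(2) ng_ng[OF m(3)] by simp
  obtain r' where r': "mor r' ?x' a'" "ng c' (Sob C a') w' = Smor C r'"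
    using Smor_surj[OF x'(1) a', of "ng c' (Sob C a') w'"] mor_ng[OF w'] x' by auto
  have wr': "ng c' (Sob C a') (Smor C r') = w'" using r'(2) ng_ng[OF w'] by simp
  obtain k where k: "mor k ?x ?x'" "h = Smor C k"
    using Smor_surj[OF x(1) x'(1), of h] h x x' by auto
  have "Smor C (\<phi> \<cdot> r) = Smor C (r' \<cdot> k)"
    using Smor_cmp_mor[OF r(1) phi(1)] Smor_cmp_mor[OF k(1) r'(1)] k(2) r(2) r'(2) sq
      cmp_ng[OF m(3) mor_Smor[OF phi(1)]] ng_cmp[OF h(1) w'] by simp
  then have sq': "\<phi> \<cdot> r = r' \<cdot> k"
    using Smor_inj mor_cmp[OF r(1) phi(1)] mor_cmp[OF k(1) r'(1)] by blast
  have T1: "dist_triangle C ?x a b (r, f, g)"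
    using dist_unrotate[of a b ?x f g r] t wr x r by simp
  obtain \<phi>1 \<phi>2 where T2: "dist_triangle C a a' F (\<phi>, \<phi>1, \<phi>2)" using phi is_cone_iff by blast
  \<comment> \<open>The cone \<open>b''\<close> of this composite is the intermediate object of both
    factorisations. The first octahedron gives \<open>p\<close> from \<open>b\<close> to
    \<open>b''\<close> with the same cone as \<open>\<phi>\<close>.\<close>
  note pr = mor_cmp[OF r(1) phi(1)]
  obtain b'' f'' g'' where T3: "dist_triangle C ?x a' b'' (\<phi> \<cdot> r, f'', g'')"
    using Tri_complete[OF mor_obj(1)[OF pr] mor_obj(2)[OF pr] mor_carrier[OF pr]] by blast
  obtain p q where O1: "dist_triangle C b b'' F (p, q, Smor C f \<cdot> \<phi>2)" "p \<cdot> f = f'' \<cdot> \<phi>" "g'' \<cdot> p = g"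
    using octahedral[OF T1 T2 T3] by blast
  obtain k1 k2 where T4: "dist_triangle C ?x ?x' ?X (k, k1, k2)"
    using is_cone_shift(2)[OF k(1)] h k is_cone_iff[OF k(1)] by blast
  obtain b' f' g' where T5: "dist_triangle C ?x' a' b' (r', f', g')"
    using Tri_complete[OF mor_obj(1)[OF r'(1)] mor_obj(2)[OF r'(1)] mor_carrier[OF r'(1)]] by blast
  \<comment> \<open>By \<open>sq'\<close> the triangle \<open>T3\<close> also lies over the
    composite of \<open>k\<close> and \<open>r'\<close>. The second octahedron therefore places
    \<open>q'\<close> after a map from the desuspension of \<open>H\<close>, so that the cone of
    \<open>q'\<close> is \<open>H\<close>.\<close>
  obtain p' q' where O2: "dist_triangle C ?X b'' b' (p', q', Smor C k1 \<cdot> g')"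
     "q' \<cdot> f'' = f'" "g' \<cdot> q' = Smor C k \<cdot> g''"
    using octahedral[OF T4 T5] T3 sq' by metis
  have H: "Sob C ?X = H"
    using h is_cone_iff[OF h(1)] dist_mor(6) Sob_Sob_inv by blast
  have p: "mor p b b''" and q': "mor q' b'' b'" using dist_mor O1 O2 by blast+
  have "is_cone C p F" using O1(1) is_cone_iff[OF p] by blast
  moreover have "is_cone C q' H" using dist_rotate[OF O2(1)] H is_cone_iff[OF q'] by auto
  ultimately obtain G where G: "is_cone C (q' \<cdot> p) G" "G \<in> star C {F} {H}"
    using is_cone_cmp[OF p _ q'] by blast
  have "dist_triangle C a' b' c' (f', g', w')"
    using dist_rotate[OF T5] wr' x' by simp
  moreover have "(q' \<cdot> p) \<cdot> f = f' \<cdot> \<phi>"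
    using cmp_mor_assoc[OF m(1) p q'] cmp_mor_assoc[OF phi(1) _ q', of f''] dist_mor(2)[OF T3] O1(2) O2(2)
    by simp
  moreover have "h \<cdot> g = g' \<cdot> (q' \<cdot> p)"
    using cmp_mor_assoc[OF p q' dist_mor(3)[OF T5]] cmp_mor_assoc[OF p dist_mor(3)[OF T3], of "Smor C k"]
      mor_Smor[OF k(1)] O1(3) O2(3) k(2) by simp
  ultimately show ?thesis using that mor_cmp[OF p q'] G by blast
qed

end

section \<open>Presheaves and the Yoneda lemma\<close>

abbreviation sec :: "('o, 'm, 'g) psh \<Rightarrow> 'o \<Rightarrow> 'g set" where
  "sec F s \<equiv> carrier (Pob F s)"

context additive_category
begin

context
  fixes F :: "('a, 'b, 'g) psh"
  assumes F: "additive_psh C F"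
begin

lemma psh_group: "s \<in> Obj C \<Longrightarrow> comm_group (Pob F s)" "s \<in> Obj C \<Longrightarrow> group (Pob F s)"
  using F by (auto simp: additive_psh_def comm_group_def)

lemma psh_hom: "mor f s t \<Longrightarrow> Pmor F f \<in> hom (Pob F t) (Pob F s)"
  and psh_ext: "mor f s t \<Longrightarrow> Pmor F f \<in> extensional (sec F t)"
  using F by (auto simp: additive_psh_def mor_def)

lemma psh_act: "mor f s t \<Longrightarrow> x \<in> sec F t \<Longrightarrow> Pmor F f x \<in> sec F s"
  using psh_hom by (auto simp: hom_def)

lemma psh_group_hom: "mor f s t \<Longrightarrow> group_hom (Pob F t) (Pob F s) (Pmor F f)"
  using psh_hom psh_group mor_obj by (auto simp: group_hom_def group_hom_axioms_def)

lemma psh_one: "mor f s t \<Longrightarrow> Pmor F f \<one>\<^bsub>Pob F t\<^esub> = \<one>\<^bsub>Pob F s\<^esub>"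
  using group_hom.hom_one[OF psh_group_hom] .

lemma psh_idn: "x \<in> sec F s \<Longrightarrow> s \<in> Obj C \<Longrightarrow> Pmor F (Idn C s) x = x"
  using F by (simp add: additive_psh_def)

lemma psh_cmp: "mor f s t \<Longrightarrow> mor g t r \<Longrightarrow> x \<in> sec F r \<Longrightarrow> Pmor F (g \<cdot> f) x = Pmor F f (Pmor F g x)"
  using F by (auto simp: additive_psh_def mor_def compose_def)

lemma psh_add: "mor f s t \<Longrightarrow> mor g s t \<Longrightarrow> x \<in> sec F t \<Longrightarrow>
    Pmor F (f \<otimes>\<^bsub>Hom C s t\<^esub> g) x = Pmor F f x \<otimes>\<^bsub>Pob F s\<^esub> Pmor F g x"
  using F by (auto simp: additive_psh_def mor_def)

lemma psh_act_hom:
  assumes "s \<in> Obj C" "t \<in> Obj C" "x \<in> sec F t"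
  shows "group_hom (Hom C s t) (Pob F s) (\<lambda>f. Pmor F f x)"
  using assms hom_is_group psh_group psh_act[of _ s t x] psh_add[of _ s t _ x]
  by (auto simp: group_hom_def group_hom_axioms_def hom_def mor_def)

lemma psh_zr: "s \<in> Obj C \<Longrightarrow> t \<in> Obj C \<Longrightarrow> x \<in> sec F t \<Longrightarrow> Pmor F (zr s t) x = \<one>\<^bsub>Pob F s\<^esub>"
  using group_hom.hom_one[OF psh_act_hom] .

lemma psh_ng: "mor f s t \<Longrightarrow> x \<in> sec F t \<Longrightarrow> Pmor F (ng s t f) x = m_inv (Pob F s) (Pmor F f x)"
  using group_hom.hom_inv[OF psh_act_hom] by (simp add: mor_def)

lemma psh_zero_object:
  assumes "zero_object C Z" "x \<in> sec F Z"
  shows "x = \<one>\<^bsub>Pob F Z\<^esub>"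
proof -
  have Z: "Z \<in> Obj C" using assms by (simp add: zero_object_def)
  then have "Idn C Z = zr Z Z" using mor_into_zero[OF assms(1) mor_idn] by blast
  then show ?thesis using psh_idn[OF assms(2) Z] psh_zr[OF Z Z assms(2)] by simp
qed

end

text \<open>Extensionality outside objects and arrows makes functors literally equal once they agree
  on groups and sections; this lets shift and unshift be mutually inverse on the nose.\<close>

lemma psh_eqI:
  assumes F: "additive_psh C F" and G: "additive_psh C G"
    and ob: "\<And>s. s \<in> Obj C \<Longrightarrow> Pob F s = Pob G s"
    and mo: "\<And>f s t x. mor f s t \<Longrightarrow> x \<in> sec F t \<Longrightarrow> Pmor F f x = Pmor G f x"
  shows "F = G"
proof -
  have "Pob F = Pob G"
    using F G ob by (intro extensionalityI[where A = "Obj C"]) (auto simp: additive_psh_def)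
  moreover have "Pmor F f = Pmor G f" if "f \<in> Arr C" for f
  proof -
    have m: "mor f (Dom C f) (Cod C f)" using that Arr_iff_mor by blast
    show ?thesis
      using psh_ext[OF F m] psh_ext[OF G m] mo[OF m] ob[OF mor_obj(2)[OF m]]
      by (intro extensionalityI[where A = "sec F (Cod C f)"]) auto
  qed
  then have "Pmor F = Pmor G"
    using F G by (intro extensionalityI[where A = "Arr C"]) (auto simp: additive_psh_def)
  ultimately show ?thesis by simp
qed

lemma additive_pshI:
  assumes "Pob F \<in> extensional (Obj C)" "Pmor F \<in> extensional (Arr C)"
    and "\<And>s. s \<in> Obj C \<Longrightarrow> comm_group (Pob F s)"
    and "\<And>f s t. mor f s t \<Longrightarrow> Pmor F f \<in> extensional (sec F t)"
    and act: "\<And>f s t x. mor f s t \<Longrightarrow> x \<in> sec F t \<Longrightarrow> Pmor F f x \<in> sec F s"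
    and "\<And>f s t x y. mor f s t \<Longrightarrow> x \<in> sec F t \<Longrightarrow> y \<in> sec F t \<Longrightarrow>
      Pmor F f (x \<otimes>\<^bsub>Pob F t\<^esub> y) = Pmor F f x \<otimes>\<^bsub>Pob F s\<^esub> Pmor F f y"
    and id: "\<And>s x. s \<in> Obj C \<Longrightarrow> x \<in> sec F s \<Longrightarrow> Pmor F (Idn C s) x = x"
    and cmp: "\<And>f g s t r x. mor f s t \<Longrightarrow> mor g t r \<Longrightarrow> x \<in> sec F r \<Longrightarrow> Pmor F (g \<cdot> f) x = Pmor F f (Pmor F g x)"
    and add: "\<And>f g s t x. mor f s t \<Longrightarrow> mor g s t \<Longrightarrow> x \<in> sec F t \<Longrightarrow>
      Pmor F (f \<otimes>\<^bsub>Hom C s t\<^esub> g) x = Pmor F f x \<otimes>\<^bsub>Pob F s\<^esub> Pmor F g x"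
  shows "additive_psh C F"
proof -
  have 1: "Pmor F (Idn C s) = (\<lambda>x\<in>sec F s. x)" if "s \<in> Obj C" for s
    by (rule extensionalityI[where A = "sec F s"]) (use assms(4)[OF mor_idn] that id in auto)
  have 2: "Pmor F (g \<cdot> f) = compose (sec F r) (Pmor F f) (Pmor F g)"
    if "mor f s t" "mor g t r" for f g s t r
    by (rule extensionalityI[where A = "sec F r"])
      (use assms(4)[OF mor_cmp[OF that]] cmp[OF that] in \<open>auto simp: compose_def\<close>)
  have 3: "Pmor F (f \<otimes>\<^bsub>Hom C s t\<^esub> g) = (\<lambda>x\<in>sec F t. Pmor F f x \<otimes>\<^bsub>Pob F s\<^esub> Pmor F g x)"
    if "mor f s t" "mor g s t" for f g s t
    by (rule extensionalityI[where A = "sec F t"])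
      (use assms(4)[OF mor_add[OF that]] add[OF that] in auto)
  show ?thesis
    unfolding additive_psh_def using assms(1-6) 1 2 3 by (auto simp: mor_def hom_def)
qed

text \<open>\<open>nat_trans\<close> does not say that its source and target are additive functors;
  this predicate carries that along.\<close>

definition ntr :: "('a \<Rightarrow> 'g \<Rightarrow> 'g) \<Rightarrow> ('a, 'b, 'g) psh \<Rightarrow> ('a, 'b, 'g) psh \<Rightarrow> bool" where
  "ntr \<eta> F G \<longleftrightarrow> additive_psh C F \<and> additive_psh C G \<and> \<eta> \<in> nat_trans C F G"

lemma nt_carrier: "(F', G', \<eta>) \<in> carrier (nt_group C F G) \<longleftrightarrow> F' = F \<and> G' = G \<and> \<eta> \<in> nat_trans C F G"
  by (auto simp: nt_group_def)

lemma nt_carrierE: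
  assumes "l \<in> carrier (nt_group C F G)"
  obtains \<eta> where "l = (F, G, \<eta>)" "\<eta> \<in> nat_trans C F G"
  using assms by (auto simp: nt_group_def)

lemma ntr_psh: "ntr \<eta> F G \<Longrightarrow> additive_psh C F" "ntr \<eta> F G \<Longrightarrow> additive_psh C G"
  by (auto simp: ntr_def)

lemma ntr_act: "ntr \<eta> F G \<Longrightarrow> s \<in> Obj C \<Longrightarrow> x \<in> sec F s \<Longrightarrow> \<eta> s x \<in> sec G s"
  by (auto simp: ntr_def nat_trans_def hom_def)

lemma ntr_mult: "ntr \<eta> F G \<Longrightarrow> s \<in> Obj C \<Longrightarrow> x \<in> sec F s \<Longrightarrow> y \<in> sec F s \<Longrightarrow>
    \<eta> s (x \<otimes>\<^bsub>Pob F s\<^esub> y) = \<eta> s x \<otimes>\<^bsub>Pob G s\<^esub> \<eta> s y"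
  by (auto simp: ntr_def nat_trans_def hom_def)

lemma ntr_natural: "ntr \<eta> F G \<Longrightarrow> mor f s t \<Longrightarrow> x \<in> sec F t \<Longrightarrow> \<eta> s (Pmor F f x) = Pmor G f (\<eta> t x)"
  by (auto simp: ntr_def nat_trans_def mor_def)

lemma ntr_group_hom: "ntr \<eta> F G \<Longrightarrow> s \<in> Obj C \<Longrightarrow> group_hom (Pob F s) (Pob G s) (\<eta> s)"
  using psh_group by (auto simp: ntr_def nat_trans_def group_hom_def group_hom_axioms_def)

lemma ntr_one: "ntr \<eta> F G \<Longrightarrow> s \<in> Obj C \<Longrightarrow> \<eta> s \<one>\<^bsub>Pob F s\<^esub> = \<one>\<^bsub>Pob G s\<^esub>"
  using group_hom.hom_one[OF ntr_group_hom] .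

lemma nat_transI:
  assumes "\<eta> \<in> extensional (Obj C)" "\<And>s. s \<in> Obj C \<Longrightarrow> \<eta> s \<in> extensional (sec F s)"
    and "\<And>s x. s \<in> Obj C \<Longrightarrow> x \<in> sec F s \<Longrightarrow> \<eta> s x \<in> sec G s"
    and "\<And>s x y. s \<in> Obj C \<Longrightarrow> x \<in> sec F s \<Longrightarrow> y \<in> sec F s \<Longrightarrow>
      \<eta> s (x \<otimes>\<^bsub>Pob F s\<^esub> y) = \<eta> s x \<otimes>\<^bsub>Pob G s\<^esub> \<eta> s y"
    and "\<And>f s t x. mor f s t \<Longrightarrow> x \<in> sec F t \<Longrightarrow> \<eta> s (Pmor F f x) = Pmor G f (\<eta> t x)"
  shows "\<eta> \<in> nat_trans C F G"
  using assms by (auto simp: nat_trans_def hom_def mor_def)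

lemma nat_trans_eqI:
  assumes "\<eta> \<in> nat_trans C F G" "\<theta> \<in> nat_trans C F G"
    and "\<And>s x. s \<in> Obj C \<Longrightarrow> x \<in> sec F s \<Longrightarrow> \<eta> s x = \<theta> s x"
  shows "\<eta> = \<theta>"
proof (rule extensionalityI[where A = "Obj C"])
  fix s assume s: "s \<in> Obj C"
  show "\<eta> s = \<theta> s"
    by (rule extensionalityI[where A = "sec F s"]) (use assms s in \<open>auto simp: nat_trans_def\<close>)
qed (use assms in \<open>auto simp: nat_trans_def\<close>)

end

locale yoneda = shift_category C
  for C :: "('o, 'm, 'z) scat_scheme" (structure) +
  fixes \<iota> :: "'m \<Rightarrow> 'g"
  assumes inj_iota: "inj \<iota>"
begin

lemma the_inv_iota [simp]: "the_inv \<iota> (\<iota> x) = x"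
  by (rule the_inv_f_f[OF inj_iota])

lemma image_group_mult:
  "f \<in> carrier G \<Longrightarrow> g \<in> carrier G \<Longrightarrow> \<iota> f \<otimes>\<^bsub>image_group \<iota> G\<^esub> \<iota> g = \<iota> (f \<otimes>\<^bsub>G\<^esub> g)"
  using inj_iota by (simp add: image_group_def inj_on_subset[of \<iota> UNIV])

lemma image_group_comm:
  assumes "comm_group G"
  shows "comm_group (image_group \<iota> G)"
proof -
  have "\<iota> \<in> iso G (image_group \<iota> G)"
    using inj_iota
    by (auto simp: iso_def hom_def image_group_mult image_group_carrier bij_betw_def inj_on_def)
  then have "comm_group ((image_group \<iota> G) \<lparr>one := \<iota> \<one>\<^bsub>G\<^esub>\<rparr>)"
    by (rule comm_group.iso_imp_img_comm_group[OF assms])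
  then show ?thesis by (simp add: image_group_def)
qed

abbreviation Y :: "'o \<Rightarrow> ('o, 'm, 'g) psh" where
  "Y a \<equiv> Yob \<iota> C a"

lemma sec_Y: "s \<in> Obj C \<Longrightarrow> sec (Y a) s = \<iota> ` carrier (Hom C s a)"
  by (simp add: Yob_def image_group_carrier)

lemma sec_Y_iff: "a \<in> Obj C \<Longrightarrow> s \<in> Obj C \<Longrightarrow> x \<in> sec (Y a) s \<longleftrightarrow> (\<exists>f. mor f s a \<and> x = \<iota> f)"
  by (auto simp: sec_Y mor_def)

lemma sec_YE:
  assumes "x \<in> sec (Y a) s" "a \<in> Obj C" "s \<in> Obj C"
  obtains f where "mor f s a" "x = \<iota> f"
  using assms by (auto simp: sec_Y mor_def)

lemma Y_mult: "mor f s a \<Longrightarrow> mor g s a \<Longrightarrow> \<iota> f \<otimes>\<^bsub>Pob (Y a) s\<^esub> \<iota> g = \<iota> (f \<otimes>\<^bsub>Hom C s a\<^esub> g)"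
  by (simp add: mor_def Yob_def image_group_mult)

lemma Y_act: "mor f s t \<Longrightarrow> mor g t a \<Longrightarrow> Pmor (Y a) f (\<iota> g) = \<iota> (g \<cdot> f)"
  using mor_Arr[of f s t] mor_cod[of f s t] by (auto simp: Yob_def mor_def)

lemma Y_one: "s \<in> Obj C \<Longrightarrow> \<one>\<^bsub>Pob (Y a) s\<^esub> = \<iota> (zr s a)"
  by (simp add: Yob_def image_group_def)

lemma Y_psh:
  assumes a: "a \<in> Obj C"
  shows "additive_psh C (Y a)"
proof (rule additive_pshI)
  show "Pob (Y a) \<in> extensional (Obj C)" "Pmor (Y a) \<in> extensional (Arr C)"
    by (simp_all add: Yob_def)
  show "comm_group (Pob (Y a) s)" if "s \<in> Obj C" for s
    using that a by (simp add: Yob_def image_group_comm hom_group)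
  fix f s t x assume f: "mor f s t"
  note o = mor_obj[OF f]
  show "Pmor (Y a) f \<in> extensional (sec (Y a) t)"
    using f mor_Arr[OF f] mor_cod[OF f] sec_Y[OF o(2)] by (simp add: Yob_def)
  assume "x \<in> sec (Y a) t"
  then obtain p where p: "mor p t a" "x = \<iota> p" using a o by (auto simp: sec_Y_iff)
  show "Pmor (Y a) f x \<in> sec (Y a) s"
    using Y_act[OF f p(1)] mor_cmp[OF f p(1)] p(2) sec_Y_iff a o by auto
  show "Pmor (Y a) (f \<otimes>\<^bsub>Hom C s t\<^esub> g) x = Pmor (Y a) f x \<otimes>\<^bsub>Pob (Y a) s\<^esub> Pmor (Y a) g x"
    if "mor g s t" for g
    using Y_act[OF f p(1)] Y_act[OF that p(1)] Y_act[OF mor_add[OF f that] p(1)] p(2)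
      Y_mult[OF mor_cmp[OF f p(1)] mor_cmp[OF that p(1)]] cmp_add_right[of s t a f g p] f that p(1)
    by (simp add: mor_def)
  show "Pmor (Y a) (f \<cdot> g) x = Pmor (Y a) g (Pmor (Y a) f x)" if "mor g r s" for g r
    using Y_act[OF that mor_cmp[OF f p(1)]] Y_act[OF f p(1)] Y_act[OF mor_cmp[OF that f] p(1)] p(2)
      cmp_mor_assoc[OF that f p(1)] by simp
  fix y assume "y \<in> sec (Y a) t"
  then obtain q where q: "mor q t a" "y = \<iota> q" using a o by (auto simp: sec_Y_iff)
  show "Pmor (Y a) f (x \<otimes>\<^bsub>Pob (Y a) t\<^esub> y) = Pmor (Y a) f x \<otimes>\<^bsub>Pob (Y a) s\<^esub> Pmor (Y a) f y"
    using Y_act[OF f p(1)] Y_act[OF f q(1)] Y_act[OF f mor_add[OF p(1) q(1)]] p(2) q(2)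
      Y_mult[OF p(1) q(1)] Y_mult[OF mor_cmp[OF f p(1)] mor_cmp[OF f q(1)]] cmp_add_left[of s t a f p q] f p(1) q(1)
    by (simp add: mor_def)
next
  fix s x assume s: "s \<in> Obj C" and x: "x \<in> sec (Y a) s"
  then obtain p where p: "mor p s a" "x = \<iota> p" using a by (auto simp: sec_Y_iff)
  show "Pmor (Y a) (Idn C s) x = x"
    using Y_act[OF mor_idn[OF s] p(1)] cmp_idn[OF p(1)] p(2) by simp
qed

text \<open>The morphism \<open>Y a \<rightarrow> F\<close> corresponding to \<open>x \<in> F a\<close> under the Yoneda lemma.\<close>

definition yo :: "('o, 'm, 'g) psh \<Rightarrow> 'o \<Rightarrow> 'g \<Rightarrow> ('o, 'm, 'g) nt" where
  "yo F a x = (Y a, F, \<lambda>s\<in>Obj C. \<lambda>y\<in>\<iota> ` carrier (Hom C s a). Pmor F (the_inv \<iota> y) x)"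

lemma yo_carrier:
  assumes F: "additive_psh C F" and a: "a \<in> Obj C" and x: "x \<in> sec F a"
  shows "yo F a x \<in> carrier (nt_group C (Y a) F)"
proof -
  let ?\<eta> = "\<lambda>s\<in>Obj C. \<lambda>y\<in>\<iota> ` carrier (Hom C s a). Pmor F (the_inv \<iota> y) x"
  have e: "?\<eta> s (\<iota> f) = Pmor F f x" if "mor f s a" for f s
    using that by (simp add: mor_def)
  have "?\<eta> \<in> nat_trans C (Y a) F"
  proof (rule nat_transI)
    fix s y assume s: "s \<in> Obj C" and "y \<in> sec (Y a) s"
    then obtain f where f: "mor f s a" "y = \<iota> f" using a by (auto simp: sec_Y_iff)
    then show "?\<eta> s y \<in> sec F s" using e psh_act[OF F] x by simp
    fix z assume "z \<in> sec (Y a) s"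
    then obtain g where g: "mor g s a" "z = \<iota> g" using a s by (auto simp: sec_Y_iff)
    show "?\<eta> s (y \<otimes>\<^bsub>Pob (Y a) s\<^esub> z) = ?\<eta> s y \<otimes>\<^bsub>Pob F s\<^esub> ?\<eta> s z"
      using Y_mult[OF f(1) g(1)] e[OF f(1)] e[OF g(1)] e[OF mor_add[OF f(1) g(1)]] f g psh_add[OF F f(1) g(1) x]
      by simp
  next
    fix f s t y assume f: "mor f s t" "y \<in> sec (Y a) t"
    then obtain g where g: "mor g t a" "y = \<iota> g" using a mor_obj by (auto simp: sec_Y_iff)
    show "?\<eta> s (Pmor (Y a) f y) = Pmor F f (?\<eta> t y)"
      using Y_act[OF f(1) g(1)] e[OF mor_cmp[OF f(1) g(1)]] e[OF g(1)] g(2) psh_cmp[OF F f(1) g(1) x] by simp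
  qed (simp_all add: sec_Y)
  then show ?thesis by (simp add: yo_def nt_carrier)
qed

lemma yo_surj:
  assumes F: "additive_psh C F" and a: "a \<in> Obj C" and l: "l \<in> carrier (nt_group C (Y a) F)"
  obtains x where "x \<in> sec F a" "l = yo F a x"
proof -
  obtain \<eta> where \<eta>: "l = (Y a, F, \<eta>)" "\<eta> \<in> nat_trans C (Y a) F" using nt_carrierE[OF l] .
  then have n: "ntr \<eta> (Y a) F" using F Y_psh[OF a] by (simp add: ntr_def)
  let ?x = "\<eta> a (\<iota> (Idn C a))"
  have i: "\<iota> (Idn C a) \<in> sec (Y a) a" using sec_Y_iff[OF a a] mor_idn[OF a] by blast
  have x: "?x \<in> sec F a" using ntr_act[OF n a i] .
  have y: "snd (snd (yo F a ?x)) \<in> nat_trans C (Y a) F"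
    using yo_carrier[OF F a x] by (auto simp: yo_def nt_carrier)
  have "\<eta> = snd (snd (yo F a ?x))"
  proof (rule nat_trans_eqI[OF \<eta>(2) y])
    fix s y assume s: "s \<in> Obj C" and "y \<in> sec (Y a) s"
    then obtain f where f: "mor f s a" "y = \<iota> f" using a by (auto simp: sec_Y_iff)
    then show "\<eta> s y = snd (snd (yo F a ?x)) s y"
      using ntr_natural[OF n f(1) i] Y_act[OF f(1) mor_idn[OF a]] idn_cmp[OF f(1)]
      by (simp add: yo_def mor_def)
  qed
  then have "l = yo F a ?x" using \<eta>(1) by (simp add: yo_def)
  then show ?thesis using that x by blast
qed

lemma yo_eval: "mor f s a \<Longrightarrow> snd (snd (yo F a x)) s (\<iota> f) = Pmor F f x"
  by (simp add: yo_def mor_def)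

lemma yo_inj:
  assumes F: "additive_psh C F" and a: "a \<in> Obj C" and x: "x \<in> sec F a" "y \<in> sec F a"
    and e: "yo F a x = yo F a y"
  shows "x = y"
proof -
  have "Pmor F (Idn C a) x = Pmor F (Idn C a) y"
    using yo_eval[OF mor_idn[OF a]] e by metis
  then show ?thesis using psh_idn[OF F] a x by simp
qed

text \<open>Naturality of the Yoneda correspondence. Together with \<open>yo_inj\<close> it turns
  equations between composites of transformations out of representables into equations between
  sections.\<close>

lemma nt_comp_yo:
  assumes n: "ntr \<eta> F G" and a: "a \<in> Obj C" and x: "x \<in> sec F a"
  shows "nt_comp C (F, G, \<eta>) (yo F a x) = yo G a (\<eta> a x)"
proof -
  have "compose (sec (Y a) s) (\<eta> s) (\<lambda>y\<in>\<iota> ` carrier (Hom C s a). Pmor F (the_inv \<iota> y) x) =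
      (\<lambda>y\<in>\<iota> ` carrier (Hom C s a). Pmor G (the_inv \<iota> y) (\<eta> a x))" if s: "s \<in> Obj C" for s
    using s a ntr_natural[OF n _ x] by (auto simp: compose_def sec_Y[OF s] fun_eq_iff mor_def)
  then show ?thesis by (auto simp: nt_comp_def yo_def fun_eq_iff)
qed

lemma nt_comp_yo_yo:
  assumes F: "additive_psh C F" and b: "b \<in> Obj C" and x: "x \<in> sec F b" and f: "mor f a b"
  shows "nt_comp C (yo F b x) (yo (Y b) a (\<iota> f)) = yo F a (Pmor F f x)"
proof -
  obtain \<eta> where \<eta>: "yo F b x = (Y b, F, \<eta>)" "\<eta> \<in> nat_trans C (Y b) F"
    using nt_carrierE[OF yo_carrier[OF F b x]] .
  then have n: "ntr \<eta> (Y b) F" using F Y_psh[OF b] by (simp add: ntr_def)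
  have "\<iota> f \<in> sec (Y b) a" using f mor_obj[OF f] sec_Y_iff by blast
  then show ?thesis
    using nt_comp_yo[OF n mor_obj(1)[OF f], of "\<iota> f"] \<eta>(1) yo_eval[OF f, of F x] by simp
qed

text \<open>A morphism between representables is itself classified by a section, so composing with
  it becomes restriction along \<open>f\<close>.\<close>

lemma Ymor_yo: "mor f a b \<Longrightarrow> Ymor \<iota> C f = yo (Y b) a (\<iota> f)"
  using mor_dom[of f a b] mor_cod[of f a b] Y_act[of _ _ a f b]
  by (auto simp: Ymor_def yo_def fun_eq_iff mor_def)

lemma nt_comp_Ymor:
  assumes "additive_psh C F" "x \<in> sec F b" "mor f a b"
  shows "nt_comp C (yo F b x) (Ymor \<iota> C f) = yo F a (Pmor F f x)"
  using nt_comp_yo_yo[OF assms(1) mor_obj(2)[OF assms(3)] assms(2,3)] Ymor_yo[OF assms(3)] by simp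

lemma nt_comp_carrier:
  assumes n: "ntr \<eta> F G" "ntr \<theta> G H"
  obtains \<zeta> where "nt_comp C (G, H, \<theta>) (F, G, \<eta>) = (F, H, \<zeta>)" "ntr \<zeta> F H"
    "\<And>s x. s \<in> Obj C \<Longrightarrow> x \<in> sec F s \<Longrightarrow> \<zeta> s x = \<theta> s (\<eta> s x)"
proof
  let ?\<zeta> = "\<lambda>s\<in>Obj C. compose (sec F s) (\<theta> s) (\<eta> s)"
  show "nt_comp C (G, H, \<theta>) (F, G, \<eta>) = (F, H, ?\<zeta>)" by (simp add: nt_comp_def)
  show e: "?\<zeta> s x = \<theta> s (\<eta> s x)" if "s \<in> Obj C" "x \<in> sec F s" for s x
    using that by (simp add: compose_def)
  have "?\<zeta> \<in> nat_trans C F H"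
  proof (rule nat_transI)
    fix s x assume s: "s \<in> Obj C" and x: "x \<in> sec F s"
    show "?\<zeta> s x \<in> sec H s" using e[OF s x] ntr_act[OF n(2) s ntr_act[OF n(1) s x]] by simp
    fix y assume y: "y \<in> sec F s"
    have "x \<otimes>\<^bsub>Pob F s\<^esub> y \<in> sec F s"
      using group.is_monoid[OF psh_group(2)[OF ntr_psh(1)[OF n(1)] s]] x y by (simp add: monoid.m_closed)
    then show "?\<zeta> s (x \<otimes>\<^bsub>Pob F s\<^esub> y) = ?\<zeta> s x \<otimes>\<^bsub>Pob H s\<^esub> ?\<zeta> s y"
      using e[OF s] x y ntr_mult[OF n(1) s x y] ntr_mult[OF n(2) s] ntr_act[OF n(1) s] by simp
  next
    fix f s t x assume f: "mor f s t" and x: "x \<in> sec F t"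
    show "?\<zeta> s (Pmor F f x) = Pmor H f (?\<zeta> t x)"
      using e[OF mor_obj(1)[OF f] psh_act[OF ntr_psh(1)[OF n(1)] f x]] e[OF mor_obj(2)[OF f] x]
        ntr_natural[OF n(1) f x] ntr_natural[OF n(2) f ntr_act[OF n(1) mor_obj(2)[OF f] x]] by simp
  qed simp_all
  then show "ntr ?\<zeta> F H" using n by (simp add: ntr_def)
qed

end

section \<open>Pointwise colimits\<close>

context additive_category
begin

lemma compat_tr:
  assumes E: "seq_in C E e" and G: "additive_psh C G"
    and z: "\<And>n. z n \<in> sec G (E n)" "\<And>n. Pmor G (e n) (z (Suc n)) = z n" and "n \<le> m"
  shows "Pmor G (tr E e n m) (z m) = z n"
  using assms(5)
proof (induction m rule: dec_induct)
  case base
  show ?case using psh_idn[OF G z(1) seq_in_obj[OF E]] by simp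
next
  case (step m)
  have "tr E e n (Suc m) = e m \<cdot> tr E e n m"
    using tr_tr[OF E, of n m "Suc m"] tr_Suc[OF E] step by simp
  then show ?case
    using psh_cmp[OF G tr_mor[OF E] seq_in_mor[OF E] z(1)] step z(2) by simp
qed

lemma compat_push:
  assumes "seq_in C E e" "additive_psh C G"
    and "\<And>n. z n \<in> sec G (E n)" "\<And>n. Pmor G (e n) (z (Suc n)) = z n" "mor f s (E n)" "n \<le> m"
  shows "Pmor G (tr E e n m \<cdot> f) (z m) = Pmor G f (z n)"
  using psh_cmp[OF assms(2,5) tr_mor[OF assms(1,6)] assms(3)] compat_tr[OF assms(1-4,6)] by simp

text \<open>
  By Yoneda, a cocone \<open>Y (E n) \<rightarrow> F\<close> is a compatible family \<open>x n \<in> F (E n)\<close>. It is a colimit iff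
  \<open>F s\<close> is the filtered colimit of the groups \<open>Hom s (E n)\<close> for every \<open>s\<close>.
\<close>

definition ptw :: "(nat \<Rightarrow> 'a) \<Rightarrow> (nat \<Rightarrow> 'b) \<Rightarrow> ('a, 'b, 'g) psh \<Rightarrow> (nat \<Rightarrow> 'g) \<Rightarrow> bool" where
  "ptw E e F x \<longleftrightarrow> seq_in C E e \<and> additive_psh C F \<and>
     (\<forall>n. x n \<in> sec F (E n) \<and> Pmor F (e n) (x (Suc n)) = x n) \<and>
     (\<forall>s\<in>Obj C. \<forall>y\<in>sec F s. \<exists>n f. mor f s (E n) \<and> y = Pmor F f (x n)) \<and>
     (\<forall>n s f. mor f s (E n) \<and> Pmor F f (x n) = \<one>\<^bsub>Pob F s\<^esub> \<longrightarrow>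
        (\<exists>m\<ge>n. tr E e n m \<cdot> f = zr s (E m)))"

context
  fixes E :: "nat \<Rightarrow> 'a" and e :: "nat \<Rightarrow> 'b" and F :: "('a, 'b, 'g) psh" and x :: "nat \<Rightarrow> 'g"
  assumes P: "ptw E e F x"
begin

lemma ptw_seq: "seq_in C E e"
  and ptw_psh: "additive_psh C F"
  and ptw_sec: "x n \<in> sec F (E n)"
  and ptw_compat: "Pmor F (e n) (x (Suc n)) = x n"
  using P by (auto simp: ptw_def)

lemma ptw_push: "mor f s (E n) \<Longrightarrow> n \<le> m \<Longrightarrow> Pmor F (tr E e n m \<cdot> f) (x m) = Pmor F f (x n)"
  using compat_push[OF ptw_seq ptw_psh ptw_sec ptw_compat] .

lemma ptw_repr:
  assumes "s \<in> Obj C" "y \<in> sec F s"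
  obtains n f where "N \<le> n" "mor f s (E n)" "y = Pmor F f (x n)"
proof -
  obtain n f where f: "mor f s (E n)" "y = Pmor F f (x n)"
    using P assms unfolding ptw_def by blast
  then show ?thesis
    using that[of "max n N" "tr E e n (max n N) \<cdot> f"] ptw_push[OF f(1)]
      mor_cmp[OF f(1) tr_mor[OF ptw_seq]] by simp
qed

lemma ptw_kernel:
  assumes "mor f s (E n)" "Pmor F f (x n) = \<one>\<^bsub>Pob F s\<^esub>"
  obtains m where "n \<le> m" "tr E e n m \<cdot> f = zr s (E m)"
  using P assms unfolding ptw_def by blast

text \<open>Push both representatives to a common stage; their difference represents the zero
  section, and the kernel clause kills it at a later stage.\<close>

lemma ptw_eq:
  assumes f: "mor f s (E n)" and g: "mor g s (E m)" and eq: "Pmor F f (x n) = Pmor F g (x m)"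
  obtains p where "n \<le> p" "m \<le> p" "tr E e n p \<cdot> f = tr E e m p \<cdot> g"
proof -
  define k where "k = max n m"
  let ?f = "tr E e n k \<cdot> f" and ?g = "tr E e m k \<cdot> g"
  have k: "n \<le> k" "m \<le> k" by (auto simp: k_def)
  have f': "mor ?f s (E k)" and g': "mor ?g s (E k)"
    using mor_cmp[OF f tr_mor[OF ptw_seq k(1)]] mor_cmp[OF g tr_mor[OF ptw_seq k(2)]] .
  note s = mor_obj(1)[OF f] and Ek = mor_obj(2)[OF f']
  interpret G: comm_group "Hom C s (E k)" using hom_group[OF s Ek] .
  let ?d = "?f \<otimes>\<^bsub>Hom C s (E k)\<^esub> ng s (E k) ?g"
  have d: "mor ?d s (E k)" using mor_add[OF f' mor_ng[OF g']] .
  have "Pmor F ?d (x k) = Pmor F f (x n) \<otimes>\<^bsub>Pob F s\<^esub> m_inv (Pob F s) (Pmor F g (x m))"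
    using psh_add[OF ptw_psh f' mor_ng[OF g'] ptw_sec] psh_ng[OF ptw_psh g' ptw_sec]
      ptw_push[OF f k(1)] ptw_push[OF g k(2)] by simp
  then have "Pmor F ?d (x k) = \<one>\<^bsub>Pob F s\<^esub>"
    using eq psh_act[OF ptw_psh g ptw_sec] psh_group(2)[OF ptw_psh s] by (simp add: group.r_inv)
  then obtain p where p: "k \<le> p" "tr E e k p \<cdot> ?d = zr s (E p)" using ptw_kernel[OF d] by blast
  let ?t = "tr E e k p"
  have t: "mor ?t (E k) (E p)" using tr_mor[OF ptw_seq p(1)] .
  interpret H: comm_group "Hom C s (E p)" using hom_group[OF s mor_obj(2)[OF t]] .
  have tf: "mor (?t \<cdot> ?f) s (E p)" "mor (?t \<cdot> ?g) s (E p)" using mor_cmp[OF f' t] mor_cmp[OF g' t] .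
  have "?t \<cdot> ?d = (?t \<cdot> ?f) \<otimes>\<^bsub>Hom C s (E p)\<^esub> ng s (E p) (?t \<cdot> ?g)"
    using cmp_add_right[of s "E k" "E p" ?f "ng s (E k) ?g" ?t] cmp_ng[OF g' t] f' mor_ng[OF g'] t
    by (simp add: mor_def)
  then have "?t \<cdot> ?f = ?t \<cdot> ?g"
    using p(2) tf H.inv_equality[of "?t \<cdot> ?f" "ng s (E p) (?t \<cdot> ?g)"]
    by (simp add: mor_def)
  then show ?thesis
    using that[of p] k p(1) tr_cmp[OF ptw_seq k(1) p(1) f] tr_cmp[OF ptw_seq k(2) p(1) g] by simp
qed

lemma ptw_unique:
  assumes \<eta>: "ntr \<eta> F G" and \<theta>: "ntr \<theta> F G" and eq: "\<And>n. \<eta> (E n) (x n) = \<theta> (E n) (x n)"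
  shows "\<eta> = \<theta>"
proof (rule nat_trans_eqI)
  fix s y assume s: "s \<in> Obj C" and y: "y \<in> sec F s"
  obtain n f where f: "mor f s (E n)" "y = Pmor F f (x n)" using ptw_repr[OF s y, of 0] by blast
  then show "\<eta> s y = \<theta> s y"
    using ntr_natural[OF \<eta> f(1) ptw_sec] ntr_natural[OF \<theta> f(1) ptw_sec] eq by simp
qed (use \<eta> \<theta> in \<open>auto simp: ntr_def\<close>)

lemma ptw_induced:
  assumes G: "additive_psh C G"
    and z: "\<And>n. z n \<in> sec G (E n)" "\<And>n. Pmor G (e n) (z (Suc n)) = z n"
  obtains \<eta> where "ntr \<eta> F G" "\<And>n. \<eta> (E n) (x n) = z n"
proof -
  note zpush = compat_push[OF ptw_seq G z]
  have wd: "Pmor G f (z n) = Pmor G g (z m)"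
    if fg: "mor f s (E n)" "mor g s (E m)" "Pmor F f (x n) = Pmor F g (x m)" for f g s n m
  proof -
    obtain p where "n \<le> p" "m \<le> p" "tr E e n p \<cdot> f = tr E e m p \<cdot> g" using ptw_eq[OF fg] .
    then show ?thesis using zpush[OF fg(1)] zpush[OF fg(2)] by metis
  qed
  \<comment> \<open>The value is read off an arbitrary representative; \<open>wd\<close> makes it
    independent of the choice, and \<open>ev\<close> is the resulting evaluation rule.\<close>
  define \<eta> where "\<eta> = (\<lambda>s\<in>Obj C. \<lambda>y\<in>sec F s.
     SOME w. \<exists>n f. mor f s (E n) \<and> y = Pmor F f (x n) \<and> w = Pmor G f (z n))"
  have ev: "\<eta> s (Pmor F f (x n)) = Pmor G f (z n)" if f: "mor f s (E n)" for f s n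
  proof -
    have "\<exists>m g. mor g s (E m) \<and> Pmor F f (x n) = Pmor F g (x m) \<and> \<eta> s (Pmor F f (x n)) = Pmor G g (z m)"
      using someI[of "\<lambda>w. \<exists>m g. mor g s (E m) \<and> Pmor F f (x n) = Pmor F g (x m) \<and> w = Pmor G g (z m)"]
        mor_obj(1)[OF f] psh_act[OF ptw_psh f ptw_sec] f by (simp add: \<eta>_def) blast
    then show ?thesis using wd[OF f] by metis
  qed
  have "\<eta> \<in> nat_trans C F G"
  proof (rule nat_transI)
    show "\<eta> \<in> extensional (Obj C)" by (simp add: \<eta>_def)
    fix s assume s: "s \<in> Obj C"
    show "\<eta> s \<in> extensional (sec F s)" using s by (simp add: \<eta>_def)
    fix y assume y: "y \<in> sec F s"
    obtain n f where f: "mor f s (E n)" "y = Pmor F f (x n)" using ptw_repr[OF s y, of 0] by blast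
    show "\<eta> s y \<in> sec G s" using f ev[OF f(1)] psh_act[OF G f(1) z(1)] by simp
    fix y' assume y': "y' \<in> sec F s"
    obtain m g where g: "n \<le> m" "mor g s (E m)" "y' = Pmor F g (x m)" using ptw_repr[OF s y', of n] by blast
    let ?f = "tr E e n m \<cdot> f"
    have f': "mor ?f s (E m)" "y = Pmor F ?f (x m)"
      using mor_cmp[OF f(1) tr_mor[OF ptw_seq g(1)]] ptw_push[OF f(1) g(1)] f(2) by auto
    have "y \<otimes>\<^bsub>Pob F s\<^esub> y' = Pmor F (?f \<otimes>\<^bsub>Hom C s (E m)\<^esub> g) (x m)"
      using psh_add[OF ptw_psh f'(1) g(2) ptw_sec] f'(2) g(3) by simp
    then show "\<eta> s (y \<otimes>\<^bsub>Pob F s\<^esub> y') = \<eta> s y \<otimes>\<^bsub>Pob G s\<^esub> \<eta> s y'"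
      using ev[OF mor_add[OF f'(1) g(2)]] ev[OF f'(1)] ev[OF g(2)] psh_add[OF G f'(1) g(2) z(1)] f'(2) g(3)
      by simp
  next
    fix f s t y assume f: "mor f s t" and y: "y \<in> sec F t"
    obtain n g where g: "mor g t (E n)" "y = Pmor F g (x n)" using ptw_repr[OF mor_obj(2)[OF f] y, of 0] by blast
    show "\<eta> s (Pmor F f y) = Pmor G f (\<eta> t y)"
      using ev[OF mor_cmp[OF f g(1)]] ev[OF g(1)] g(2) psh_cmp[OF ptw_psh f g(1) ptw_sec] psh_cmp[OF G f g(1) z(1)]
      by simp
  qed
  then have n: "ntr \<eta> F G" using G ptw_psh by (simp add: ntr_def)
  moreover have "\<eta> (E n) (x n) = z n" for n
    using ev[OF mor_idn] psh_idn[OF ptw_psh ptw_sec] psh_idn[OF G z(1)] seq_in_obj[OF ptw_seq] by metis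
  ultimately show ?thesis using that by blast
qed

end

text \<open>The filtered colimit of the hom groups is realised on \<open>'g\<close> itself: a class
  of pairs (stage, morphism) under eventual equality is coded by \<open>\<kappa>\<close> of a chosen
  member. This supplies a concrete colimit against which an abstract one can be compared.\<close>

lemma ptw_exists:
  fixes \<kappa> :: "nat \<times> 'b \<Rightarrow> 'g"
  assumes \<kappa>: "inj \<kappa>" and E: "seq_in C E e"
  obtains F :: "('a, 'b, 'g) psh" and x where "ptw E e F x"
proof -
  define rel where "rel s p q \<longleftrightarrow> mor (snd p) s (E (fst p)) \<and> mor (snd q) s (E (fst q)) \<and>
     (\<exists>k\<ge>fst p. fst q \<le> k \<and> tr E e (fst p) k \<cdot> snd p = tr E e (fst q) k \<cdot> snd q)" for s p q
  define val where "val s n f = \<kappa> (SOME q. rel s (n, f) q)" for s n f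
  have refl: "rel s (n, f) (n, f)" if "mor f s (E n)" for s n f
    using that by (auto simp: rel_def)
  have sym: "rel s p q \<Longrightarrow> rel s q p" for s p q
    by (auto simp: rel_def)
  have trans: "rel s p q \<Longrightarrow> rel s q r \<Longrightarrow> rel s p r" for s p q r
  proof -
    assume a: "rel s p q" and b: "rel s q r"
    obtain k where k: "fst p \<le> k" "fst q \<le> k" "tr E e (fst p) k \<cdot> snd p = tr E e (fst q) k \<cdot> snd q"
      using a by (auto simp: rel_def)
    obtain l where l: "fst q \<le> l" "fst r \<le> l" "tr E e (fst q) l \<cdot> snd q = tr E e (fst r) l \<cdot> snd r"
      using b by (auto simp: rel_def)
    have m: "mor (snd p) s (E (fst p))" "mor (snd q) s (E (fst q))" "mor (snd r) s (E (fst r))"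
      using a b by (auto simp: rel_def)
    let ?m = "max k l"
    have "tr E e (fst p) ?m \<cdot> snd p = tr E e k ?m \<cdot> (tr E e (fst p) k \<cdot> snd p)"
      using tr_cmp[OF E k(1) _ m(1), of ?m] by simp
    also have "\<dots> = tr E e (fst q) ?m \<cdot> snd q"
      using tr_cmp[OF E k(2) _ m(2), of ?m] k(3) by simp
    also have "\<dots> = tr E e l ?m \<cdot> (tr E e (fst q) l \<cdot> snd q)"
      using tr_cmp[OF E l(1) _ m(2), of ?m] by simp
    also have "\<dots> = tr E e (fst r) ?m \<cdot> snd r"
      using tr_cmp[OF E l(2) _ m(3), of ?m] l(3) by simp
    finally show ?thesis using m k l unfolding rel_def by (metis max.coboundedI1 max.coboundedI2)
  qed
  have val_eq: "val s n f = val s m g \<longleftrightarrow> rel s (n, f) (m, g)"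
    if fg: "mor f s (E n)" "mor g s (E m)" for s n f m g
  proof
    assume "val s n f = val s m g"
    then have eq: "(SOME q. rel s (n, f) q) = (SOME q. rel s (m, g) q)"
      using \<kappa> by (simp add: val_def inj_eq)
    have "rel s (n, f) (SOME q. rel s (n, f) q)" "rel s (m, g) (SOME q. rel s (m, g) q)"
      using refl fg by (auto intro: someI)
    then show "rel s (n, f) (m, g)" using eq sym trans by metis
  next
    assume "rel s (n, f) (m, g)"
    \<comment> \<open>Related pairs have the same class as a predicate, so the choice operator picks
      the same member.\<close>
    then have "rel s (n, f) = rel s (m, g)" using sym trans by blast
    then show "val s n f = val s m g" by (simp add: val_def)
  qed
  have val_tr: "val s k (tr E e n k \<cdot> f) = val s n f" if "mor f s (E n)" "n \<le> k" for s n k f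
    using that val_eq[of "tr E e n k \<cdot> f" s k f n] mor_cmp[OF that(1) tr_mor[OF E that(2)]]
      idn_cmp[OF mor_cmp[OF that(1) tr_mor[OF E that(2)]]]
    by (auto simp: rel_def intro!: exI[of _ k])
  let ?S = "\<lambda>s. {val s n f |n f. mor f s (E n)}"
  have common: "\<exists>n f g. mor f s (E n) \<and> mor g s (E n) \<and> y = val s n f \<and> z = val s n g"
    if yz: "y \<in> ?S s" "z \<in> ?S s" for s y z
  proof -
    obtain n f where f: "mor f s (E n)" "y = val s n f" using yz by blast
    obtain m g where g: "mor g s (E m)" "z = val s m g" using yz by blast
    let ?k = "max n m"
    have "mor (tr E e n ?k \<cdot> f) s (E ?k)" "mor (tr E e m ?k \<cdot> g) s (E ?k)"
      using mor_cmp[OF f(1) tr_mor[OF E]] mor_cmp[OF g(1) tr_mor[OF E]] by auto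
    then show ?thesis
      using val_tr[OF f(1), of ?k] val_tr[OF g(1), of ?k] f(2) g(2) by (metis max.cobounded1 max.cobounded2)
  qed
  \<comment> \<open>Addition chooses representatives of both summands at one stage, so both
    comparisons must hold at one later stage.\<close>
  have common_eq: "\<exists>k\<ge>n. m \<le> k \<and> tr E e n k \<cdot> f = tr E e m k \<cdot> f' \<and> tr E e n k \<cdot> g = tr E e m k \<cdot> g'"
    if m: "mor f s (E n)" "mor g s (E n)" "mor f' s (E m)" "mor g' s (E m)"
      and eq: "val s n f = val s m f'" "val s n g = val s m g'" for s f f' g g' n m
  proof -
    obtain k where k: "n \<le> k" "m \<le> k" "tr E e n k \<cdot> f = tr E e m k \<cdot> f'"
      using val_eq[OF m(1,3)] eq(1) by (auto simp: rel_def)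
    obtain l where l: "n \<le> l" "m \<le> l" "tr E e n l \<cdot> g = tr E e m l \<cdot> g'"
      using val_eq[OF m(2,4)] eq(2) by (auto simp: rel_def)
    let ?p = "max k l"
    have "tr E e n ?p \<cdot> f = tr E e m ?p \<cdot> f'"
      using tr_cmp[OF E k(1) _ m(1), of ?p] tr_cmp[OF E k(2) _ m(3), of ?p] k(3) by simp
    moreover have "tr E e n ?p \<cdot> g = tr E e m ?p \<cdot> g'"
      using tr_cmp[OF E l(1) _ m(2), of ?p] tr_cmp[OF E l(2) _ m(4), of ?p] l(3) by simp
    ultimately show ?thesis using k l by (metis max.coboundedI1)
  qed
  \<comment> \<open>The sum is formed on chosen representatives at a common stage;
    \<open>G_mult\<close> shows that the choice does not matter.\<close>
  define G where "G s = \<lparr>carrier = ?S s,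
     mult = (\<lambda>y z. SOME w. \<exists>n f g. mor f s (E n) \<and> mor g s (E n) \<and> y = val s n f \<and> z = val s n g \<and>
        w = val s n (f \<otimes>\<^bsub>Hom C s (E n)\<^esub> g)),
     one = val s 0 (zr s (E 0))\<rparr>" for s
  have G_carrier: "carrier (G s) = ?S s" and G_one: "\<one>\<^bsub>G s\<^esub> = val s 0 (zr s (E 0))" for s
    by (simp_all add: G_def)
  have tr_add: "tr E e n k \<cdot> (f \<otimes>\<^bsub>Hom C s (E n)\<^esub> g) = (tr E e n k \<cdot> f) \<otimes>\<^bsub>Hom C s (E k)\<^esub> (tr E e n k \<cdot> g)"
    if "mor f s (E n)" "mor g s (E n)" "n \<le> k" for f g s n k
    using cmp_add_right[of s "E n" "E k" f g "tr E e n k"] tr_mor[OF E that(3)] that by (simp add: mor_def)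
  have G_mult: "val s n f \<otimes>\<^bsub>G s\<^esub> val s n g = val s n (f \<otimes>\<^bsub>Hom C s (E n)\<^esub> g)"
    if fg: "mor f s (E n)" "mor g s (E n)" for s n f g
  proof -
    have "\<exists>m f' g'. mor f' s (E m) \<and> mor g' s (E m) \<and> val s n f = val s m f' \<and> val s n g = val s m g' \<and>
        val s n f \<otimes>\<^bsub>G s\<^esub> val s n g = val s m (f' \<otimes>\<^bsub>Hom C s (E m)\<^esub> g')"
      unfolding G_def monoid.simps by (rule someI_ex) (use fg in blast)
    then obtain m f' g' where m: "mor f' s (E m)" "mor g' s (E m)" "val s n f = val s m f'" "val s n g = val s m g'"
      "val s n f \<otimes>\<^bsub>G s\<^esub> val s n g = val s m (f' \<otimes>\<^bsub>Hom C s (E m)\<^esub> g')" by blast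
    obtain k where k: "n \<le> k" "m \<le> k" "tr E e n k \<cdot> f = tr E e m k \<cdot> f'" "tr E e n k \<cdot> g = tr E e m k \<cdot> g'"
      using common_eq[OF fg m(1-4)] by blast
    show ?thesis
      using m(5) tr_add[OF fg k(1)] tr_add[OF m(1,2) k(2)] k(3,4)
        val_tr[OF mor_add[OF fg] k(1)] val_tr[OF mor_add[OF m(1,2)] k(2)] by simp
  qed
  have zero_val: "val s n (zr s (E n)) = \<one>\<^bsub>G s\<^esub>" if "s \<in> Obj C" for s n
    using val_tr[OF mor_zr[OF that seq_in_obj[OF E, of 0]], of n] cmp_zr[OF tr_mor[OF E, of 0 n] that]
    by (simp add: G_one)
  have G_group: "comm_group (G s)" if s: "s \<in> Obj C" for s
  proof (rule comm_groupI)
    note hg = hom_group[OF s seq_in_obj[OF E]]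
    show "\<one>\<^bsub>G s\<^esub> \<in> carrier (G s)"
      using mor_zr[OF s seq_in_obj[OF E]] by (auto simp: G_carrier G_one)
    fix y assume "y \<in> carrier (G s)"
    then have y: "y \<in> ?S s" by (simp add: G_carrier)
    then obtain n f where f: "mor f s (E n)" "y = val s n f" by blast
    interpret H: comm_group "Hom C s (E n)" using hg .
    show "\<one>\<^bsub>G s\<^esub> \<otimes>\<^bsub>G s\<^esub> y = y"
      using G_mult[OF mor_zr[OF s seq_in_obj[OF E]] f(1)] f zero_val[OF s, of n] by (simp add: mor_def)
    have "val s n (ng s (E n) f) \<otimes>\<^bsub>G s\<^esub> y = \<one>\<^bsub>G s\<^esub>"
      using G_mult[OF mor_ng[OF f(1)] f(1)] f zero_val[OF s, of n] by (simp add: mor_def)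
    then show "\<exists>z\<in>carrier (G s). z \<otimes>\<^bsub>G s\<^esub> y = \<one>\<^bsub>G s\<^esub>"
      using mor_ng[OF f(1)] by (auto simp: G_carrier)
    fix z assume "z \<in> carrier (G s)"
    then have z: "z \<in> ?S s" by (simp add: G_carrier)
    obtain m g h where gh: "mor g s (E m)" "mor h s (E m)" "y = val s m g" "z = val s m h"
      using common[OF y z] by blast
    show yz: "y \<otimes>\<^bsub>G s\<^esub> z \<in> carrier (G s)"
      using G_mult[OF gh(1,2)] gh(3,4) mor_add[OF gh(1,2)] by (auto simp: G_carrier)
    show "y \<otimes>\<^bsub>G s\<^esub> z = z \<otimes>\<^bsub>G s\<^esub> y"
      using G_mult[OF gh(1,2)] G_mult[OF gh(2,1)] gh comm_monoid.m_comm[OF comm_group.axioms(1)[OF hg[of m]]]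
      by (simp add: mor_def)
    fix w assume "w \<in> carrier (G s)"
    then obtain k i where i: "mor i s (E k)" "w = val s k i" by (auto simp: G_carrier)
    let ?p = "max m k"
    let ?g = "tr E e m ?p \<cdot> g" and ?h = "tr E e m ?p \<cdot> h" and ?i = "tr E e k ?p \<cdot> i"
    have p: "mor ?g s (E ?p)" "mor ?h s (E ?p)" "mor ?i s (E ?p)"
      using mor_cmp[OF gh(1) tr_mor[OF E]] mor_cmp[OF gh(2) tr_mor[OF E]] mor_cmp[OF i(1) tr_mor[OF E]] by auto
    have v: "y = val s ?p ?g" "z = val s ?p ?h" "w = val s ?p ?i"
      using val_tr[OF gh(1), of ?p] val_tr[OF gh(2), of ?p] val_tr[OF i(1), of ?p] gh i by auto
    interpret K: comm_group "Hom C s (E ?p)" using hg .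
    show "y \<otimes>\<^bsub>G s\<^esub> z \<otimes>\<^bsub>G s\<^esub> w = y \<otimes>\<^bsub>G s\<^esub> (z \<otimes>\<^bsub>G s\<^esub> w)"
      unfolding v using p
      by (simp add: G_mult mor_add K.m_assoc mor_carrier)
  qed
  define F where "F = \<lparr>Pob = (\<lambda>s\<in>Obj C. G s), Pmor = (\<lambda>f\<in>Arr C. \<lambda>y\<in>?S (Cod C f).
     SOME w. \<exists>n g. mor g (Cod C f) (E n) \<and> y = val (Cod C f) n g \<and> w = val (Dom C f) n (g \<cdot> f))\<rparr>"
  have F_sec: "sec F s = ?S s" and F_G: "Pob F s = G s" if "s \<in> Obj C" for s
    using that by (simp_all add: F_def G_carrier)
  have F_act: "Pmor F f (val t n g) = val s n (g \<cdot> f)" if f: "mor f s t" and g: "mor g t (E n)" for f s t n g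
  proof -
    have "\<exists>m h. mor h t (E m) \<and> val t n g = val t m h \<and> Pmor F f (val t n g) = val s m (h \<cdot> f)"
      using someI[of "\<lambda>w. \<exists>m h. mor h t (E m) \<and> val t n g = val t m h \<and> w = val s m (h \<cdot> f)"] f g
      by (simp add: F_def mor_Arr[OF f] mor_dom[OF f] mor_cod[OF f]) blast
    then obtain m h where h: "mor h t (E m)" "val t n g = val t m h" "Pmor F f (val t n g) = val s m (h \<cdot> f)"
      by blast
    obtain k where k: "n \<le> k" "m \<le> k" "tr E e n k \<cdot> g = tr E e m k \<cdot> h"
      using val_eq[OF g h(1)] h(2) by (auto simp: rel_def)
    have "tr E e n k \<cdot> (g \<cdot> f) = tr E e m k \<cdot> (h \<cdot> f)"
      using cmp_mor_assoc[OF f g tr_mor[OF E k(1)]] cmp_mor_assoc[OF f h(1) tr_mor[OF E k(2)]] k(3) by simp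
    then have "val s n (g \<cdot> f) = val s m (h \<cdot> f)"
      using val_tr[OF mor_cmp[OF f g] k(1)] val_tr[OF mor_cmp[OF f h(1)] k(2)] by simp
    then show ?thesis using h(3) by simp
  qed
  have F: "additive_psh C F"
  proof (rule additive_pshI)
    show "Pob F \<in> extensional (Obj C)" "Pmor F \<in> extensional (Arr C)" by (simp_all add: F_def)
    show "comm_group (Pob F s)" if "s \<in> Obj C" for s using G_group[OF that] F_G[OF that] by simp
    show "Pmor F (Idn C s) y = y" if "s \<in> Obj C" "y \<in> sec F s" for s y
      using that F_act[OF mor_idn[OF that(1)]] cmp_idn by (auto simp: F_sec)
    fix f s t assume f: "mor f s t"
    note o = mor_obj[OF f]
    show "Pmor F f \<in> extensional (sec F t)"
      using o mor_Arr[OF f] mor_cod[OF f] F_sec[OF o(2)] by (simp add: F_def)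
    fix y assume "y \<in> sec F t"
    then have y: "y \<in> ?S t" using F_sec[OF o(2)] by simp
    then obtain n p where p: "mor p t (E n)" "y = val t n p" by blast
    show "Pmor F f y \<in> sec F s" using F_act[OF f p(1)] p(2) F_sec[OF o(1)] mor_cmp[OF f p(1)] by auto
    show "Pmor F (f \<cdot> g) y = Pmor F g (Pmor F f y)" if "mor g r s" for g r
      using F_act[OF f p(1)] F_act[OF mor_cmp[OF that f] p(1)] F_act[OF that mor_cmp[OF f p(1)]] p(2)
        cmp_mor_assoc[OF that f p(1)] by simp
    show "Pmor F (f \<otimes>\<^bsub>Hom C s t\<^esub> g) y = Pmor F f y \<otimes>\<^bsub>Pob F s\<^esub> Pmor F g y" if "mor g s t" for g
      using F_act[OF f p(1)] F_act[OF that p(1)] F_act[OF mor_add[OF f that] p(1)] p(2) F_G[OF o(1)]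
        G_mult[OF mor_cmp[OF f p(1)] mor_cmp[OF that p(1)]] cmp_add_right[of s t "E n" f g p] f that p(1)
      by (simp add: mor_def)
    fix z assume "z \<in> sec F t"
    then have z: "z \<in> ?S t" using F_sec[OF o(2)] by simp
    obtain m q r where qr: "mor q t (E m)" "mor r t (E m)" "y = val t m q" "z = val t m r"
      using common[OF y z] by blast
    show "Pmor F f (y \<otimes>\<^bsub>Pob F t\<^esub> z) = Pmor F f y \<otimes>\<^bsub>Pob F s\<^esub> Pmor F f z"
      using F_act[OF f qr(1)] F_act[OF f qr(2)] F_act[OF f mor_add[OF qr(1,2)]] qr(3,4) F_G[OF o(1)] F_G[OF o(2)]
        G_mult[OF qr(1,2)] G_mult[OF mor_cmp[OF f qr(1)] mor_cmp[OF f qr(2)]]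
        cmp_add_left[of s t "E m" f q r] f qr(1,2)
      by (simp add: mor_def)
  qed
  have act_id: "Pmor F f (val (E n) n (Idn C (E n))) = val s n f" if "mor f s (E n)" for f s n
    using F_act[OF that mor_idn[OF seq_in_obj[OF E]]] idn_cmp[OF that] by simp
  \<comment> \<open>The universal sections are the classes of the identities of the
    \<open>E n\<close>; restricting one along \<open>f\<close> gives the class of
    \<open>f\<close>.\<close>
  have "ptw E e F (\<lambda>n. val (E n) n (Idn C (E n)))"
    unfolding ptw_def
  proof (intro conjI allI ballI impI E F)
    fix n
    note m = mor_idn[OF seq_in_obj[OF E, of n]] and en = seq_in_mor[OF E, of n]
    show "val (E n) n (Idn C (E n)) \<in> sec F (E n)" using m F_sec[OF seq_in_obj[OF E]] by blast
    have "val (E n) (Suc n) (tr E e n (Suc n) \<cdot> Idn C (E n)) = val (E n) n (Idn C (E n))"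
      using val_tr[OF m, of "Suc n"] by simp
    then show "Pmor F (e n) (val (E (Suc n)) (Suc n) (Idn C (E (Suc n)))) = val (E n) n (Idn C (E n))"
      using act_id[OF en] tr_Suc[OF E] cmp_idn[OF en] by simp
  next
    fix s y assume s: "s \<in> Obj C" and "y \<in> sec F s"
    then show "\<exists>n f. mor f s (E n) \<and> y = Pmor F f (val (E n) n (Idn C (E n)))"
      using act_id F_sec[OF s] by force
  next
    fix n s f assume "mor f s (E n) \<and> Pmor F f (val (E n) n (Idn C (E n))) = \<one>\<^bsub>Pob F s\<^esub>"
    then have f: "mor f s (E n)" and eq: "val s n f = \<one>\<^bsub>G s\<^esub>"
      using act_id F_G mor_obj(1) by auto
    have s: "s \<in> Obj C" using mor_obj(1)[OF f] .
    have "rel s (n, f) (n, zr s (E n))"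
      using val_eq[OF f mor_zr[OF s seq_in_obj[OF E]]] eq zero_val[OF s] by simp
    then show "\<exists>m\<ge>n. tr E e n m \<cdot> f = zr s (E m)"
      using cmp_zr[OF tr_mor[OF E] s] by (auto simp: rel_def)
  qed
  then show ?thesis using that by blast
qed

end

text \<open>An infinite \<open>'g\<close> contains a copy of the naturals and is in bijection with
  its own square.\<close>

lemma inj_nat_times:
  fixes \<iota> :: "'m \<Rightarrow> 'g"
  assumes "inj \<iota>" "infinite (UNIV :: 'g set)"
  obtains \<kappa> :: "nat \<times> 'm \<Rightarrow> 'g" where "inj \<kappa>"
proof -
  obtain \<nu> :: "nat \<Rightarrow> 'g" where \<nu>: "inj \<nu>" using infinite_countable_subset[OF assms(2)] by blast
  obtain \<pi> :: "'g \<times> 'g \<Rightarrow> 'g" where "bij_betw \<pi> (UNIV \<times> UNIV) UNIV"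
    using card_of_ordIso[THEN iffD2, OF card_of_Times_same_infinite[OF assms(2)]] by blast
  then have \<pi>: "inj \<pi>" by (simp add: bij_betw_def)
  have "inj (\<lambda>p. \<pi> (\<nu> (fst p), \<iota> (snd p)))"
    by (rule injI) (use \<pi> \<nu> assms(1) in \<open>simp add: inj_eq prod_eq_iff\<close>)
  then show ?thesis using that by blast
qed

context yoneda
begin

lemma ModCat_simps [simp]:
  "Obj (ModCat C) = {F. additive_psh C F}" "Hom (ModCat C) = nt_group C" "Cmp (ModCat C) = nt_comp C"
  "Sob (ModCat C) = psh_shift C" "Smor (ModCat C) = nt_shift C"
  by (simp_all add: ModCat_def)

text \<open>Under Yoneda a cocone is a compatible family of sections, so \<open>ptw_induced\<close>
  and \<open>ptw_unique\<close> are existence and uniqueness in the universal property.\<close>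

lemma colim_of_ptw:
  assumes P: "ptw E e F x"
  shows "is_colim (ModCat C) (\<lambda>n. Y (E n)) (\<lambda>n. Ymor \<iota> C (e n)) F (\<lambda>n. yo F (E n) (x n))"
proof -
  note E = ptw_seq[OF P] and F = ptw_psh[OF P]
  have o: "E n \<in> Obj C" for n using seq_in_obj[OF E] .
  have "\<exists>!h. h \<in> carrier (nt_group C F Z) \<and> (\<forall>n. nt_comp C h (yo F (E n) (x n)) = m n)"
    if Z: "additive_psh C Z" and m: "\<And>n. m n \<in> carrier (nt_group C (Y (E n)) Z)"
      "\<And>n. nt_comp C (m (Suc n)) (Ymor \<iota> C (e n)) = m n" for Z m
  proof -
    have "\<forall>n. \<exists>z. z \<in> sec Z (E n) \<and> m n = yo Z (E n) z" using yo_surj[OF Z o m(1)] by metis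
    then obtain z where z: "\<And>n. z n \<in> sec Z (E n)" "\<And>n. m n = yo Z (E n) (z n)" by metis
    have c: "Pmor Z (e n) (z (Suc n)) = z n" for n
    proof (rule yo_inj[OF Z o[of n]])
      show "Pmor Z (e n) (z (Suc n)) \<in> sec Z (E n)" using psh_act[OF Z seq_in_mor[OF E] z(1)] .
      show "yo Z (E n) (Pmor Z (e n) (z (Suc n))) = yo Z (E n) (z n)"
        using nt_comp_Ymor[OF Z z(1) seq_in_mor[OF E]] m(2) z(2) by metis
    qed (rule z(1))
    obtain \<eta> where \<eta>: "ntr \<eta> F Z" "\<And>n. \<eta> (E n) (x n) = z n"
      using ptw_induced[OF P Z z(1) c] by blast
    show ?thesis
    proof (rule ex1I[of _ "(F, Z, \<eta>)"])
      show "(F, Z, \<eta>) \<in> carrier (nt_group C F Z) \<and> (\<forall>n. nt_comp C (F, Z, \<eta>) (yo F (E n) (x n)) = m n)"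
        using \<eta>(1,2) nt_comp_yo[OF \<eta>(1) o ptw_sec[OF P]] z(2) by (simp add: nt_carrier ntr_def)
      fix h assume h: "h \<in> carrier (nt_group C F Z) \<and> (\<forall>n. nt_comp C h (yo F (E n) (x n)) = m n)"
      then obtain \<theta> where t: "h = (F, Z, \<theta>)" "\<theta> \<in> nat_trans C F Z" using nt_carrierE by blast
      then have n: "ntr \<theta> F Z" using F Z by (simp add: ntr_def)
      have "\<theta> (E n) (x n) = z n" for n
      proof (rule yo_inj[OF Z o[of n]])
        show "\<theta> (E n) (x n) \<in> sec Z (E n)" using ntr_act[OF n o ptw_sec[OF P]] .
        show "yo Z (E n) (\<theta> (E n) (x n)) = yo Z (E n) (z n)"
          using nt_comp_yo[OF n o ptw_sec[OF P]] h t(1) z(2) by metis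
      qed (rule z(1))
      then show "h = (F, Z, \<eta>)" using ptw_unique[OF P n \<eta>(1)] \<eta>(2) t(1) by simp
    qed
  qed
  then show ?thesis
    using F yo_carrier[OF F o ptw_sec[OF P]] nt_comp_Ymor[OF F ptw_sec[OF P] seq_in_mor[OF E]] ptw_compat[OF P]
    unfolding is_colim_def by simp
qed

text \<open>Compare \<open>F\<close> with a constructed pointwise colimit \<open>G\<close>. There
  are \<open>\<theta>\<close> from \<open>G\<close> to \<open>F\<close> and \<open>\<eta>\<close>
  from \<open>F\<close> to \<open>G\<close>, and uniqueness forces \<open>\<theta>\<close> after
  \<open>\<eta>\<close> to be the identity. This one composite suffices: a representative of the
  image of \<open>y\<close> under \<open>\<eta>\<close> is also one of \<open>y\<close>, and
  vanishing is detected after applying \<open>\<eta>\<close>.\<close>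

lemma ptw_of_colim:
  assumes E: "seq_in C E e" and inf: "infinite (UNIV :: 'g set)"
    and L: "is_colim (ModCat C) (\<lambda>n. Y (E n)) (\<lambda>n. Ymor \<iota> C (e n)) F l"
  obtains x where "ptw E e F x" "\<And>n. l n = yo F (E n) (x n)"
proof -
  have o: "E n \<in> Obj C" for n using seq_in_obj[OF E] .
  have F: "additive_psh C F" and l: "\<And>n. l n \<in> carrier (nt_group C (Y (E n)) F)"
      "\<And>n. nt_comp C (l (Suc n)) (Ymor \<iota> C (e n)) = l n"
    and univ: "\<And>Z m. additive_psh C Z \<Longrightarrow> (\<And>n. m n \<in> carrier (nt_group C (Y (E n)) Z)) \<Longrightarrow>
      (\<And>n. nt_comp C (m (Suc n)) (Ymor \<iota> C (e n)) = m n) \<Longrightarrow>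
      \<exists>!h. h \<in> carrier (nt_group C F Z) \<and> (\<forall>n. nt_comp C h (l n) = m n)"
    using L unfolding is_colim_def by simp_all
  have "\<forall>n. \<exists>z. z \<in> sec F (E n) \<and> l n = yo F (E n) z" using yo_surj[OF F o l(1)] by metis
  then obtain x where x: "\<And>n. x n \<in> sec F (E n)" "\<And>n. l n = yo F (E n) (x n)"
    unfolding choice_iff by blast
  have c: "Pmor F (e n) (x (Suc n)) = x n" for n
  proof (rule yo_inj[OF F o[of n]])
    show "Pmor F (e n) (x (Suc n)) \<in> sec F (E n)" using psh_act[OF F seq_in_mor[OF E] x(1)] .
    show "yo F (E n) (Pmor F (e n) (x (Suc n))) = yo F (E n) (x n)"
      using nt_comp_Ymor[OF F x(1) seq_in_mor[OF E]] l(2) x(2) by metis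
  qed (rule x(1))
  obtain \<kappa> :: "nat \<times> 'm \<Rightarrow> 'g" where \<kappa>: "inj \<kappa>" using inj_nat_times[OF inj_iota inf] .
  obtain G :: "('o, 'm, 'g) psh" and z where P: "ptw E e G z" using ptw_exists[OF \<kappa> E] .
  note G = ptw_psh[OF P]
  obtain \<theta> where \<theta>: "ntr \<theta> G F" "\<And>n. \<theta> (E n) (z n) = x n"
    using ptw_induced[OF P F x(1) c] by blast
  have "\<exists>!h. h \<in> carrier (nt_group C F G) \<and> (\<forall>n. nt_comp C h (l n) = yo G (E n) (z n))"
    using univ[OF G yo_carrier[OF G o ptw_sec[OF P]]]
      nt_comp_Ymor[OF G ptw_sec[OF P] seq_in_mor[OF E]] ptw_compat[OF P] by simp
  then obtain h where h: "h \<in> carrier (nt_group C F G)" "\<And>n. nt_comp C h (l n) = yo G (E n) (z n)"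
    by blast
  obtain \<eta> where "h = (F, G, \<eta>)" "\<eta> \<in> nat_trans C F G" using nt_carrierE[OF h(1)] .
  then have \<eta>: "ntr \<eta> F G" "\<And>n. nt_comp C (F, G, \<eta>) (l n) = yo G (E n) (z n)"
    using h(2) F G by (auto simp: ntr_def)
  have \<eta>x: "\<eta> (E n) (x n) = z n" for n
  proof (rule yo_inj[OF G o[of n]])
    show "yo G (E n) (\<eta> (E n) (x n)) = yo G (E n) (z n)"
      using nt_comp_yo[OF \<eta>(1) o x(1)] \<eta>(2) x(2) by metis
  qed (use ntr_act[OF \<eta>(1) o x(1)] ptw_sec[OF P] in auto)
  obtain \<zeta> where \<zeta>: "nt_comp C (G, F, \<theta>) (F, G, \<eta>) = (F, F, \<zeta>)" "ntr \<zeta> F F"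
    "\<And>s y. s \<in> Obj C \<Longrightarrow> y \<in> sec F s \<Longrightarrow> \<zeta> s y = \<theta> s (\<eta> s y)"
    using nt_comp_carrier[OF \<eta>(1) \<theta>(1)] by blast
  let ?id = "\<lambda>s\<in>Obj C. \<lambda>y\<in>sec F s. y"
  have "?id \<in> nat_trans C F F"
  proof (rule nat_transI)
    fix s y z assume s: "s \<in> Obj C" and y: "y \<in> sec F s" "z \<in> sec F s"
    have "y \<otimes>\<^bsub>Pob F s\<^esub> z \<in> sec F s"
      using group.is_monoid[OF psh_group(2)[OF F s]] y by (simp add: monoid.m_closed)
    then show "?id s (y \<otimes>\<^bsub>Pob F s\<^esub> z) = ?id s y \<otimes>\<^bsub>Pob F s\<^esub> ?id s z" using s y by simp
  next
    fix f s t y assume f: "mor f s t" "y \<in> sec F t"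
    then show "?id s (Pmor F f y) = Pmor F f (?id t y)" using psh_act[OF F f] mor_obj[OF f(1)] by simp
  qed simp_all
  then have id: "ntr ?id F F" using F by (simp add: ntr_def)
  \<comment> \<open>Both endomorphisms of \<open>F\<close> fix the colimit cocone, hence
    coincide.\<close>
  have "nt_comp C (F, F, \<zeta>) (l n) = l n" "nt_comp C (F, F, ?id) (l n) = l n" for n
    using nt_comp_yo[OF \<zeta>(2) o x(1)] nt_comp_yo[OF id o x(1)] x \<zeta>(3)[OF o x(1)] \<eta>x \<theta>(2) o by auto
  moreover have "(F, F, \<zeta>) \<in> carrier (nt_group C F F)" "(F, F, ?id) \<in> carrier (nt_group C F F)"
    using \<zeta>(2) id by (simp_all add: nt_carrier ntr_def)
  ultimately have "(F, F, \<zeta>) = (F, F, ?id)"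
    using univ[OF F l(1) l(2)] by blast
  then have \<theta>\<eta>: "\<theta> s (\<eta> s y) = y" if "s \<in> Obj C" "y \<in> sec F s" for s y
    using \<zeta>(3) that by simp
  have "ptw E e F x"
    unfolding ptw_def
  proof (intro conjI allI ballI impI E F x(1) c)
    fix s y assume s: "s \<in> Obj C" and y: "y \<in> sec F s"
    obtain n f where f: "mor f s (E n)" "\<eta> s y = Pmor G f (z n)"
      using ptw_repr[OF P s ntr_act[OF \<eta>(1) s y], of 0] by blast
    then have "y = Pmor F f (x n)"
      using \<theta>\<eta>[OF s y] ntr_natural[OF \<theta>(1) f(1) ptw_sec[OF P]] \<theta>(2) by simp
    then show "\<exists>n f. mor f s (E n) \<and> y = Pmor F f (x n)" using f(1) by blast
  next
    fix n s f assume "mor f s (E n) \<and> Pmor F f (x n) = \<one>\<^bsub>Pob F s\<^esub>"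
    then have f: "mor f s (E n)" "Pmor F f (x n) = \<one>\<^bsub>Pob F s\<^esub>" by auto
    then have "Pmor G f (z n) = \<one>\<^bsub>Pob G s\<^esub>"
      using ntr_natural[OF \<eta>(1) f(1) x(1)] \<eta>x ntr_one[OF \<eta>(1) mor_obj(1)[OF f(1)]] by simp
    then show "\<exists>m\<ge>n. tr E e n m \<cdot> f = zr s (E m)" using ptw_kernel[OF P f(1)] by blast
  qed
  then show ?thesis using that x(2) by blast
qed

end

section \<open>Shifting presheaves\<close>

context shift_category
begin

lemma Smor_inv_cmp: "mor f A B \<Longrightarrow> mor g B D \<Longrightarrow> Smor_inv C (g \<cdot> f) = Smor_inv C g \<cdot> Smor_inv C f"
  using Smor_inv_Smor[OF mor_cmp[OF mor_Smor_inv mor_Smor_inv]] Smor_cmp_mor[OF mor_Smor_inv mor_Smor_inv]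
    Smor_Smor_inv by metis

lemma Smor_inv_idn: "A \<in> Obj C \<Longrightarrow> Smor_inv C (Idn C A) = Idn C (Sob_inv C A)"
  using Smor_inv_Smor[OF mor_idn] Smor_idn Sob_Sob_inv Sob_inv_obj by metis

lemma Smor_inv_add:
  assumes "mor f A B" "mor g A B"
  shows "Smor_inv C (f \<otimes>\<^bsub>Hom C A B\<^esub> g) =
    Smor_inv C f \<otimes>\<^bsub>Hom C (Sob_inv C A) (Sob_inv C B)\<^esub> Smor_inv C g"
proof -
  note i = mor_Smor_inv[OF assms(1)] mor_Smor_inv[OF assms(2)]
  show ?thesis
    using Smor_inv_Smor[OF mor_add[OF i]] Smor_add[OF i] Smor_Smor_inv assms Sob_Sob_inv mor_obj[OF assms(1)]
    by simp
qed

lemma psh_shift_Pob: "s \<in> Obj C \<Longrightarrow> Pob (psh_shift C F) s = Pob F (Sob_inv C s)"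
  and psh_shift_Pmor: "mor f s t \<Longrightarrow> Pmor (psh_shift C F) f = Pmor F (Smor_inv C f)"
  by (auto simp: psh_shift_def mor_Arr)

lemma psh_shift_psh:
  assumes F: "additive_psh C F"
  shows "additive_psh C (psh_shift C F)"
proof (rule additive_pshI)
  show "Pob (psh_shift C F) \<in> extensional (Obj C)" "Pmor (psh_shift C F) \<in> extensional (Arr C)"
    by (simp_all add: psh_shift_def)
  show "comm_group (Pob (psh_shift C F) s)" if "s \<in> Obj C" for s
    using psh_group(1)[OF F] Sob_inv_obj that by (simp add: psh_shift_Pob)
  fix f s t assume f: "mor f s t"
  note i = mor_Smor_inv[OF f] and o = mor_obj[OF f]
  show "Pmor (psh_shift C F) f \<in> extensional (sec (psh_shift C F) t)"
    using psh_ext[OF F i] by (simp add: psh_shift_Pmor[OF f] psh_shift_Pob o)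
  fix x assume x: "x \<in> sec (psh_shift C F) t"
  then have x': "x \<in> sec F (Sob_inv C t)" by (simp add: psh_shift_Pob o)
  show "Pmor (psh_shift C F) f x \<in> sec (psh_shift C F) s"
    using psh_act[OF F i x'] by (simp add: psh_shift_Pmor[OF f] psh_shift_Pob o)
  show "Pmor (psh_shift C F) (f \<otimes>\<^bsub>Hom C s t\<^esub> g) x =
      Pmor (psh_shift C F) f x \<otimes>\<^bsub>Pob (psh_shift C F) s\<^esub> Pmor (psh_shift C F) g x" if g: "mor g s t" for g
    using psh_add[OF F i mor_Smor_inv[OF g] x'] Smor_inv_add[OF f g]
    by (simp add: psh_shift_Pmor[OF f] psh_shift_Pmor[OF g] psh_shift_Pmor[OF mor_add[OF f g]] psh_shift_Pob o)
  show "Pmor (psh_shift C F) (f \<cdot> g) x = Pmor (psh_shift C F) g (Pmor (psh_shift C F) f x)"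
    if g: "mor g r s" for g r
    using psh_cmp[OF F mor_Smor_inv[OF g] i x'] Smor_inv_cmp[OF g f]
    by (simp add: psh_shift_Pmor[OF f] psh_shift_Pmor[OF g] psh_shift_Pmor[OF mor_cmp[OF g f]])
  fix y assume y: "y \<in> sec (psh_shift C F) t"
  then have y': "y \<in> sec F (Sob_inv C t)" by (simp add: psh_shift_Pob o)
  show "Pmor (psh_shift C F) f (x \<otimes>\<^bsub>Pob (psh_shift C F) t\<^esub> y) =
      Pmor (psh_shift C F) f x \<otimes>\<^bsub>Pob (psh_shift C F) s\<^esub> Pmor (psh_shift C F) f y"
    using hom_mult[OF psh_hom[OF F i] x' y'] by (simp add: psh_shift_Pmor[OF f] psh_shift_Pob o)
next
  fix s x assume s: "s \<in> Obj C" and x: "x \<in> sec (psh_shift C F) s"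
  then show "Pmor (psh_shift C F) (Idn C s) x = x"
    using psh_idn[OF F, of x "Sob_inv C s"] Sob_inv_obj
    by (simp add: psh_shift_Pmor[OF mor_idn] Smor_inv_idn psh_shift_Pob)
qed

text \<open>An explicit inverse of \<open>psh_shift\<close> on additive functors, used to identify
  the desuspension of the completion, which \<open>Sob_inv\<close> defines by choice.\<close>

definition psh_unshift :: "('o, 'm, 'g) psh \<Rightarrow> ('o, 'm, 'g) psh" where
  "psh_unshift F = \<lparr>Pob = (\<lambda>s\<in>Obj C. Pob F (Sob C s)), Pmor = (\<lambda>f\<in>Arr C. Pmor F (Smor C f))\<rparr>"

lemma psh_unshift_Pob: "s \<in> Obj C \<Longrightarrow> Pob (psh_unshift F) s = Pob F (Sob C s)"
  and psh_unshift_Pmor: "mor f s t \<Longrightarrow> Pmor (psh_unshift F) f = Pmor F (Smor C f)"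
  by (auto simp: psh_unshift_def mor_Arr)

lemma psh_unshift_psh:
  assumes F: "additive_psh C F"
  shows "additive_psh C (psh_unshift F)"
proof (rule additive_pshI)
  show "Pob (psh_unshift F) \<in> extensional (Obj C)" "Pmor (psh_unshift F) \<in> extensional (Arr C)"
    by (simp_all add: psh_unshift_def)
  show "comm_group (Pob (psh_unshift F) s)" if "s \<in> Obj C" for s
    using psh_group(1)[OF F] Sob_obj that by (simp add: psh_unshift_Pob)
  fix f s t assume f: "mor f s t"
  note i = mor_Smor[OF f] and o = mor_obj[OF f]
  show "Pmor (psh_unshift F) f \<in> extensional (sec (psh_unshift F) t)"
    using psh_ext[OF F i] by (simp add: psh_unshift_Pmor[OF f] psh_unshift_Pob o)
  fix x assume x: "x \<in> sec (psh_unshift F) t"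
  then have x': "x \<in> sec F (Sob C t)" by (simp add: psh_unshift_Pob o)
  show "Pmor (psh_unshift F) f x \<in> sec (psh_unshift F) s"
    using psh_act[OF F i x'] by (simp add: psh_unshift_Pmor[OF f] psh_unshift_Pob o)
  show "Pmor (psh_unshift F) (f \<otimes>\<^bsub>Hom C s t\<^esub> g) x =
      Pmor (psh_unshift F) f x \<otimes>\<^bsub>Pob (psh_unshift F) s\<^esub> Pmor (psh_unshift F) g x" if g: "mor g s t" for g
    using psh_add[OF F i mor_Smor[OF g] x'] Smor_add[OF f g]
    by (simp add: psh_unshift_Pmor[OF f] psh_unshift_Pmor[OF g] psh_unshift_Pmor[OF mor_add[OF f g]] psh_unshift_Pob o)
  show "Pmor (psh_unshift F) (f \<cdot> g) x = Pmor (psh_unshift F) g (Pmor (psh_unshift F) f x)"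
    if g: "mor g r s" for g r
    using psh_cmp[OF F mor_Smor[OF g] i x'] Smor_cmp_mor[OF g f]
    by (simp add: psh_unshift_Pmor[OF f] psh_unshift_Pmor[OF g] psh_unshift_Pmor[OF mor_cmp[OF g f]])
  fix y assume y: "y \<in> sec (psh_unshift F) t"
  then have y': "y \<in> sec F (Sob C t)" by (simp add: psh_unshift_Pob o)
  show "Pmor (psh_unshift F) f (x \<otimes>\<^bsub>Pob (psh_unshift F) t\<^esub> y) =
      Pmor (psh_unshift F) f x \<otimes>\<^bsub>Pob (psh_unshift F) s\<^esub> Pmor (psh_unshift F) f y"
    using hom_mult[OF psh_hom[OF F i] x' y'] by (simp add: psh_unshift_Pmor[OF f] psh_unshift_Pob o)
next
  fix s x assume s: "s \<in> Obj C" and x: "x \<in> sec (psh_unshift F) s"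
  then show "Pmor (psh_unshift F) (Idn C s) x = x"
    using psh_idn[OF F, of x "Sob C s"] Sob_obj
    by (simp add: psh_unshift_Pmor[OF mor_idn] Smor_idn psh_unshift_Pob)
qed

lemma psh_shift_unshift: "additive_psh C F \<Longrightarrow> psh_shift C (psh_unshift F) = F"
  by (rule psh_eqI)
    (auto simp: psh_shift_psh psh_unshift_psh psh_shift_Pob psh_unshift_Pob Sob_inv_obj Sob_Sob_inv
      psh_shift_Pmor psh_unshift_Pmor[OF mor_Smor_inv] Smor_Smor_inv)

lemma psh_unshift_shift: "additive_psh C F \<Longrightarrow> psh_unshift (psh_shift C F) = F"
  by (rule psh_eqI)
    (auto simp: psh_shift_psh psh_unshift_psh psh_shift_Pob psh_unshift_Pob Sob_obj Sob_inv_Sob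
      psh_unshift_Pmor psh_shift_Pmor[OF mor_Smor] Smor_inv_Smor)

lemma seq_in_Sob: "seq_in C E e \<Longrightarrow> seq_in C (\<lambda>n. Sob C (E n)) (\<lambda>n. Smor C (e n))"
  by (rule seq_inI) (rule mor_Smor[OF seq_in_mor])

lemma seq_in_Sob_inv: "seq_in C E e \<Longrightarrow> seq_in C (\<lambda>n. Sob_inv C (E n)) (\<lambda>n. Smor_inv C (e n))"
  by (rule seq_inI) (rule mor_Smor_inv[OF seq_in_mor])

lemma seq_map_Sob:
  assumes "seq_in C E e"
  shows "seq_map C (\<lambda>n. Sob C (E n)) (\<lambda>n. Smor C (e n)) j d = Smor C (seq_map C E e j d)"
proof (induction d)
  case (Suc d)
  then show ?case using Smor_cmp_mor[OF seq_map_mor[OF assms] seq_in_mor[OF assms]] by simp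
qed (simp add: Smor_idn seq_in_obj[OF assms])

lemma tr_Sob: "seq_in C E e \<Longrightarrow>
    tr (\<lambda>n. Sob C (E n)) (\<lambda>n. Smor C (e n)) n m = Smor C (tr E e n m)"
  by (simp add: tr_def seq_map_Sob)

lemma tr_Sob_inv:
  assumes E: "seq_in C E e" and nm: "n \<le> m"
  shows "tr (\<lambda>n. Sob_inv C (E n)) (\<lambda>n. Smor_inv C (e n)) n m = Smor_inv C (tr E e n m)"
    and "Smor C (tr (\<lambda>n. Sob_inv C (E n)) (\<lambda>n. Smor_inv C (e n)) n m) = tr E e n m"
proof -
  note E' = seq_in_Sob_inv[OF E]
  show *: "Smor C (tr (\<lambda>n. Sob_inv C (E n)) (\<lambda>n. Smor_inv C (e n)) n m) = tr E e n m"
    using tr_Sob[OF E', of n m] Sob_Sob_inv[OF seq_in_obj[OF E]] Smor_Smor_inv[OF seq_in_mor[OF E]] by simp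
  show "tr (\<lambda>n. Sob_inv C (E n)) (\<lambda>n. Smor_inv C (e n)) n m = Smor_inv C (tr E e n m)"
    using Smor_inv_Smor[OF tr_mor[OF E' nm]] * by simp
qed

text \<open>The same family \<open>x\<close> works: the shift is strictly invertible, so the shifted
  functor at \<open>Sob C (E n)\<close> has literally the group of \<open>F\<close> at
  \<open>E n\<close>.\<close>

lemma ptw_shift:
  assumes P: "ptw E e F x"
  shows "ptw (\<lambda>n. Sob C (E n)) (\<lambda>n. Smor C (e n)) (psh_shift C F) x"
  unfolding ptw_def
proof (intro conjI allI ballI impI seq_in_Sob[OF ptw_seq[OF P]] psh_shift_psh[OF ptw_psh[OF P]])
  note E = ptw_seq[OF P]
  fix n
  show "x n \<in> sec (psh_shift C F) (Sob C (E n))"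
    using ptw_sec[OF P] seq_in_obj[OF E] by (simp add: psh_shift_Pob Sob_obj Sob_inv_Sob)
  show "Pmor (psh_shift C F) (Smor C (e n)) (x (Suc n)) = x n"
    using ptw_compat[OF P] by (simp add: psh_shift_Pmor[OF mor_Smor[OF seq_in_mor[OF E]]] Smor_inv_Smor[OF seq_in_mor[OF E]])
next
  note E = ptw_seq[OF P]
  fix s y assume s: "s \<in> Obj C" and y: "y \<in> sec (psh_shift C F) s"
  then have "y \<in> sec F (Sob_inv C s)" by (simp add: psh_shift_Pob)
  then obtain n f where f: "mor f (Sob_inv C s) (E n)" "y = Pmor F f (x n)"
    using ptw_repr[OF P Sob_inv_obj[OF s], of y 0] by blast
  then have "mor (Smor C f) s (Sob C (E n))" using mor_Smor[OF f(1)] s by (simp add: Sob_Sob_inv)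
  then show "\<exists>n f. mor f s (Sob C (E n)) \<and> y = Pmor (psh_shift C F) f (x n)"
    using f psh_shift_Pmor Smor_inv_Smor[OF f(1)] by metis
next
  note E = ptw_seq[OF P]
  fix n s f assume a: "mor f s (Sob C (E n)) \<and> Pmor (psh_shift C F) f (x n) = \<one>\<^bsub>Pob (psh_shift C F) s\<^esub>"
  then have f: "mor f s (Sob C (E n))" and s: "s \<in> Obj C" using mor_obj by auto
  have f': "mor (Smor_inv C f) (Sob_inv C s) (E n)"
    using mor_Smor_inv[OF f] by (simp add: Sob_inv_Sob seq_in_obj[OF E])
  have "Pmor F (Smor_inv C f) (x n) = \<one>\<^bsub>Pob F (Sob_inv C s)\<^esub>"
    using a by (simp add: psh_shift_Pmor[OF f] psh_shift_Pob s)
  then obtain m where m: "n \<le> m" "tr E e n m \<cdot> Smor_inv C f = zr (Sob_inv C s) (E m)"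
    using ptw_kernel[OF P f'] by blast
  have "Smor C (tr E e n m) \<cdot> f = zr s (Sob C (E m))"
    using Smor_cmp_mor[OF f' tr_mor[OF E m(1)]] Smor_Smor_inv[OF f] m(2) Smor_zr[of "Sob_inv C s" "E m"]
      Sob_inv_obj[OF s] Sob_Sob_inv[OF s] seq_in_obj[OF E] by simp
  then show "\<exists>m\<ge>n. tr (\<lambda>n. Sob C (E n)) (\<lambda>n. Smor C (e n)) n m \<cdot> f = zr s (Sob C (E m))"
    using m(1) tr_Sob[OF E] by metis
qed

lemma ptw_unshift:
  assumes P: "ptw E e F x"
  shows "ptw (\<lambda>n. Sob_inv C (E n)) (\<lambda>n. Smor_inv C (e n)) (psh_unshift F) x"
  unfolding ptw_def
proof (intro conjI allI ballI impI seq_in_Sob_inv[OF ptw_seq[OF P]] psh_unshift_psh[OF ptw_psh[OF P]])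
  note E = ptw_seq[OF P]
  fix n
  show "x n \<in> sec (psh_unshift F) (Sob_inv C (E n))"
    using ptw_sec[OF P] seq_in_obj[OF E] by (simp add: psh_unshift_Pob Sob_inv_obj Sob_Sob_inv)
  show "Pmor (psh_unshift F) (Smor_inv C (e n)) (x (Suc n)) = x n"
    using ptw_compat[OF P]
    by (simp add: psh_unshift_Pmor[OF mor_Smor_inv[OF seq_in_mor[OF E]]] Smor_Smor_inv[OF seq_in_mor[OF E]])
next
  note E = ptw_seq[OF P]
  fix s y assume s: "s \<in> Obj C" and y: "y \<in> sec (psh_unshift F) s"
  then have "y \<in> sec F (Sob C s)" by (simp add: psh_unshift_Pob)
  then obtain n f where f: "mor f (Sob C s) (E n)" "y = Pmor F f (x n)"
    using ptw_repr[OF P Sob_obj[OF s], of y 0] by blast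
  then have "mor (Smor_inv C f) s (Sob_inv C (E n))" using mor_Smor_inv[OF f(1)] s by (simp add: Sob_inv_Sob)
  then show "\<exists>n f. mor f s (Sob_inv C (E n)) \<and> y = Pmor (psh_unshift F) f (x n)"
    using f psh_unshift_Pmor Smor_Smor_inv[OF f(1)] by metis
next
  note E = ptw_seq[OF P] and E' = seq_in_Sob_inv[OF ptw_seq[OF P]]
  let ?E = "\<lambda>n. Sob_inv C (E n)" and ?e = "\<lambda>n. Smor_inv C (e n)"
  fix n s f assume a: "mor f s (?E n) \<and> Pmor (psh_unshift F) f (x n) = \<one>\<^bsub>Pob (psh_unshift F) s\<^esub>"
  then have f: "mor f s (?E n)" and s: "s \<in> Obj C" using mor_obj by auto
  have f': "mor (Smor C f) (Sob C s) (E n)"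
    using mor_Smor[OF f] by (simp add: Sob_Sob_inv seq_in_obj[OF E])
  have "Pmor F (Smor C f) (x n) = \<one>\<^bsub>Pob F (Sob C s)\<^esub>"
    using a by (simp add: psh_unshift_Pmor[OF f] psh_unshift_Pob s)
  then obtain m where m: "n \<le> m" "tr E e n m \<cdot> Smor C f = zr (Sob C s) (E m)"
    using ptw_kernel[OF P f'] by blast
  note t = tr_mor[OF E' m(1)] and o = seq_in_obj[OF E', of m]
  have "Smor C (tr ?E ?e n m \<cdot> f) = Smor C (zr s (?E m))"
    using Smor_cmp_mor[OF f t] tr_Sob_inv(2)[OF E m(1)] m(2) Smor_zr[OF s o] Sob_Sob_inv[OF seq_in_obj[OF E]]
    by simp
  then have "tr ?E ?e n m \<cdot> f = zr s (?E m)" using Smor_inj[OF mor_cmp[OF f t] mor_zr[OF s o]] by simp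
  then show "\<exists>m\<ge>n. tr ?E ?e n m \<cdot> f = zr s (?E m)" using m(1) by blast
qed

end

context yoneda
begin

text \<open>By Yoneda the hom group is the injective image of the sections over \<open>a\<close>,
  with zero corresponding to zero.\<close>

lemma right_orth_ModCat:
  assumes A: "\<A> \<subseteq> Obj C"
  shows "F \<in> right_orth (ModCat C) (Y ` \<A>) \<longleftrightarrow> additive_psh C F \<and> (\<forall>a\<in>\<A>. sec F a = {\<one>\<^bsub>Pob F a\<^esub>})"
proof -
  have "carrier (nt_group C (Y a) F) = {\<one>\<^bsub>nt_group C (Y a) F\<^esub>} \<longleftrightarrow> sec F a = {\<one>\<^bsub>Pob F a\<^esub>}"
    if F: "additive_psh C F" and a: "a \<in> Obj C" for a
  proof -
    have 1: "\<one>\<^bsub>Pob F a\<^esub> \<in> sec F a"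
      using group.is_monoid[OF psh_group(2)[OF F a]] by (simp add: monoid.one_closed)
    have "\<one>\<^bsub>nt_group C (Y a) F\<^esub> = yo F a \<one>\<^bsub>Pob F a\<^esub>"
      using psh_one[OF F, of _ _ a] a by (auto simp: nt_group_def yo_def fun_eq_iff sec_Y mor_def)
    moreover have "carrier (nt_group C (Y a) F) = yo F a ` sec F a"
      using yo_surj[OF F a] yo_carrier[OF F a] by blast
    ultimately have "carrier (nt_group C (Y a) F) = {\<one>\<^bsub>nt_group C (Y a) F\<^esub>} \<longleftrightarrow>
        yo F a ` sec F a = yo F a ` {\<one>\<^bsub>Pob F a\<^esub>}" by simp
    also have "\<dots> \<longleftrightarrow> sec F a = {\<one>\<^bsub>Pob F a\<^esub>}"
      by (rule inj_on_image_eq_iff[where C = "sec F a"]) (use 1 yo_inj[OF F a] in \<open>auto simp: inj_on_def\<close>)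
    finally show ?thesis .
  qed
  then show ?thesis using A by (auto simp: right_orth_def)
qed

end

section \<open>Cauchy sequences\<close>

context category
begin

definition sub :: "(nat \<Rightarrow> 'o) \<Rightarrow> (nat \<Rightarrow> 'm) \<Rightarrow> (nat \<Rightarrow> nat) \<Rightarrow> nat \<Rightarrow> 'm" where
  "sub E e \<phi> n = tr E e (\<phi> n) (\<phi> (Suc n))"

lemma seq_in_sub: "seq_in C E e \<Longrightarrow> strict_mono \<phi> \<Longrightarrow> seq_in C (E \<circ> \<phi>) (sub E e \<phi>)"
  by (rule seq_inI) (simp add: sub_def tr_mor strict_mono_less_eq)

lemma tr_sub:
  assumes E: "seq_in C E e" and \<phi>: "strict_mono \<phi>" and "n \<le> m"
  shows "tr (E \<circ> \<phi>) (sub E e \<phi>) n m = tr E e (\<phi> n) (\<phi> m)"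
  using assms(3)
proof (induction m rule: dec_induct)
  case (step m)
  note E' = seq_in_sub[OF E \<phi>]
  have "tr (E \<circ> \<phi>) (sub E e \<phi>) n (Suc m) = sub E e \<phi> m \<cdot> tr (E \<circ> \<phi>) (sub E e \<phi>) n m"
    using tr_tr[OF E', of n m "Suc m"] tr_Suc[OF E', of m] step.hyps(1) by simp
  moreover have "sub E e \<phi> m \<cdot> tr E e (\<phi> n) (\<phi> m) = tr E e (\<phi> n) (\<phi> (Suc m))"
    using step.hyps(1) tr_tr[OF E, of "\<phi> n" "\<phi> m" "\<phi> (Suc m)"] \<phi>
    by (simp add: sub_def strict_mono_less_eq)
  ultimately show ?case using step.IH by metis
qed simp

end

context additive_category
begin

text \<open>Cofinality: \<open>n \<le> \<phi> n\<close> lets every representative and every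
  vanishing be pushed to a stage of the subsequence.\<close>

lemma ptw_sub:
  assumes P: "ptw E e F x" and \<phi>: "strict_mono \<phi>"
  shows "ptw (E \<circ> \<phi>) (sub E e \<phi>) F (x \<circ> \<phi>)"
  unfolding ptw_def
proof (intro conjI allI ballI impI seq_in_sub[OF ptw_seq[OF P] \<phi>] ptw_psh[OF P])
  note E = ptw_seq[OF P]
  have ge: "n \<le> \<phi> n" for n using \<phi> by (rule strict_mono_imp_increasing)
  {
    fix n
    show "(x \<circ> \<phi>) n \<in> sec F ((E \<circ> \<phi>) n)" using ptw_sec[OF P] by simp
    show "Pmor F (sub E e \<phi> n) ((x \<circ> \<phi>) (Suc n)) = (x \<circ> \<phi>) n"
      using compat_tr[OF E ptw_psh[OF P] ptw_sec[OF P] ptw_compat[OF P]] \<phi> by (simp add: sub_def strict_mono_less_eq)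
  next
    fix s y assume s: "s \<in> Obj C" and y: "y \<in> sec F s"
    obtain n f where f: "mor f s (E n)" "y = Pmor F f (x n)" using ptw_repr[OF P s y, of 0] by blast
    show "\<exists>n f. mor f s ((E \<circ> \<phi>) n) \<and> y = Pmor F f ((x \<circ> \<phi>) n)"
      using mor_cmp[OF f(1) tr_mor[OF E ge]] ptw_push[OF P f(1) ge] f(2)
      by (intro exI[of _ n] exI[of _ "tr E e n (\<phi> n) \<cdot> f"]) simp
  next
    fix n s f assume f: "mor f s ((E \<circ> \<phi>) n) \<and> Pmor F f ((x \<circ> \<phi>) n) = \<one>\<^bsub>Pob F s\<^esub>"
    then obtain m where m: "\<phi> n \<le> m" "tr E e (\<phi> n) m \<cdot> f = zr s (E m)"
      using ptw_kernel[OF P, of f s "\<phi> n"] by auto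
    have "n \<le> m" using m(1) ge[of n] by simp
    \<comment> \<open>The vanishing stage \<open>m\<close> need not be in the range of
      \<open>\<phi>\<close>, so it is pushed on to \<open>\<phi> m\<close>.\<close>
    have "tr E e (\<phi> n) (\<phi> m) \<cdot> f = zr s (E (\<phi> m))"
      using tr_cmp[OF E m(1) ge[of m], of f s] m(2) cmp_zr[OF tr_mor[OF E ge[of m]], of s] f mor_obj by auto
    then show "\<exists>m\<ge>n. tr (E \<circ> \<phi>) (sub E e \<phi>) n m \<cdot> f = zr s ((E \<circ> \<phi>) m)"
      using \<open>n \<le> m\<close> tr_sub[OF E \<phi>] by auto
  }
qed

end

locale good_metric_category = triangulated_category C
  for C :: "('o, 'm, 'z) tcat_scheme" (structure) +
  fixes M :: "nat \<Rightarrow> 'o set"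
  assumes good: "good_metric C M"
begin

lemma M_obj: "a \<in> M i \<Longrightarrow> a \<in> Obj C"
  and M_Suc: "M (Suc i) \<subseteq> M i"
  and M_Sob: "a \<in> M (Suc i) \<Longrightarrow> Sob C a \<in> M i"
  and M_Sob_inv: "a \<in> M (Suc i) \<Longrightarrow> Sob_inv C a \<in> M i"
  using good unfolding good_metric_def by blast+

lemma M_zero: obtains Z where "Z \<in> M i" "zero_object C Z"
  using good unfolding good_metric_def by blast

lemma M_star: "a \<in> M i \<Longrightarrow> c \<in> M i \<Longrightarrow> b \<in> star C {a} {c} \<Longrightarrow> b \<in> M i"
  using good unfolding good_metric_def star_def by blast

lemma M_mono: "i \<le> j \<Longrightarrow> M j \<subseteq> M i"
  using lift_Suc_antimono_le[of M, OF M_Suc] .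

section \<open>Morphisms with small cones and Cauchy sequences\<close>

definition small :: "nat \<Rightarrow> 'm \<Rightarrow> bool" where
  "small i f \<longleftrightarrow> (\<exists>Z\<in>M i. is_cone C f Z)"

lemma small_mono: "i \<le> j \<Longrightarrow> small j f \<Longrightarrow> small i f"
  using M_mono unfolding small_def by blast

lemma small_cmp:
  assumes "mor f X Y" "mor g Y Z" "small i f" "small i g"
  shows "small i (g \<cdot> f)"
proof -
  obtain F G where FG: "F \<in> M i" "is_cone C f F" "G \<in> M i" "is_cone C g G"
    using assms(3,4) unfolding small_def by blast
  obtain H where "is_cone C (g \<cdot> f) H" "H \<in> star C {F} {G}"
    using is_cone_cmp[OF assms(1) FG(2) assms(2) FG(4)] .
  then show ?thesis using M_star[OF FG(1,3)] unfolding small_def by blast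
qed

lemma small_idn:
  assumes "X \<in> Obj C"
  shows "small i (Idn C X)"
proof -
  obtain Z where "Z \<in> M i" "zero_object C Z" using M_zero .
  then show ?thesis
    using dist_idn[OF assms] is_cone_iff[OF mor_idn[OF assms]] unfolding small_def by blast
qed

lemma small_Smor: "mor f X Y \<Longrightarrow> small (Suc i) f \<Longrightarrow> small i (Smor C f)"
  unfolding small_def using is_cone_shift(1) M_Sob by blast

lemma small_Smor_inv:
  assumes f: "mor f X Y" and s: "small (Suc i) f"
  shows "small i (Smor_inv C f)"
proof -
  obtain Z where "Z \<in> M (Suc i)" "is_cone C f Z" using s unfolding small_def by blast
  then have "Sob_inv C Z \<in> M i" "is_cone C (Smor_inv C f) (Sob_inv C Z)"
    using is_cone_shift(2)[OF mor_Smor_inv[OF f]] Smor_Smor_inv[OF f] M_Sob_inv by auto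
  then show ?thesis unfolding small_def by blast
qed

lemma small_tr:
  assumes E: "seq_in C E e" and s: "\<And>m. n \<le> m \<Longrightarrow> small i (e m)" and "n \<le> m"
  shows "small i (tr E e n m)"
  using assms(3)
proof (induction m rule: dec_induct)
  case base
  show ?case by (simp add: small_idn seq_in_obj[OF E])
next
  case (step m)
  have "tr E e n (Suc m) = e m \<cdot> tr E e n m"
    using tr_tr[OF E, of n m "Suc m"] tr_Suc[OF E] step by simp
  then show ?case
    using small_cmp[OF tr_mor[OF E] seq_in_mor[OF E]] step s by simp
qed

lemma cauchy_iff: "cauchy C M E e \<longleftrightarrow> seq_in C E e \<and>
    (\<forall>i. \<exists>N. \<forall>j k. N \<le> j \<and> j < k \<longrightarrow> small i (tr E e j k))"
  by (simp add: cauchy_def small_def tr_def)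

lemma cauchy_seq_in: "cauchy C M E e \<Longrightarrow> seq_in C E e"
  by (simp add: cauchy_iff)

text \<open>Shifting costs one index of the metric, which is harmless since the Cauchy condition
  holds at every index.\<close>

lemma cauchy_shift:
  assumes "cauchy C M E e"
  shows "cauchy C M (\<lambda>n. Sob C (E n)) (\<lambda>n. Smor C (e n))"
proof -
  note E = cauchy_seq_in[OF assms]
  have "\<exists>N. \<forall>j k. N \<le> j \<and> j < k \<longrightarrow> small i (tr (\<lambda>n. Sob C (E n)) (\<lambda>n. Smor C (e n)) j k)" for i
  proof -
    obtain N where "\<And>j k. N \<le> j \<and> j < k \<Longrightarrow> small (Suc i) (tr E e j k)"
      using assms unfolding cauchy_iff by blast
    then have "\<forall>j k. N \<le> j \<and> j < k \<longrightarrow> small i (Smor C (tr E e j k))"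
      using small_Smor[OF tr_mor[OF E]] by simp
    then show ?thesis using tr_Sob[OF E] by auto
  qed
  then show ?thesis using seq_in_Sob[OF E] by (simp add: cauchy_iff)
qed

lemma cauchy_unshift:
  assumes "cauchy C M E e"
  shows "cauchy C M (\<lambda>n. Sob_inv C (E n)) (\<lambda>n. Smor_inv C (e n))"
proof -
  note E = cauchy_seq_in[OF assms]
  have "\<exists>N. \<forall>j k. N \<le> j \<and> j < k \<longrightarrow> small i (tr (\<lambda>n. Sob_inv C (E n)) (\<lambda>n. Smor_inv C (e n)) j k)" for i
  proof -
    obtain N where "\<And>j k. N \<le> j \<and> j < k \<Longrightarrow> small (Suc i) (tr E e j k)"
      using assms unfolding cauchy_iff by blast
    then have "\<forall>j k. N \<le> j \<and> j < k \<longrightarrow> small i (Smor_inv C (tr E e j k))"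
      using small_Smor_inv[OF tr_mor[OF E]] by simp
    then show ?thesis using tr_Sob_inv(1)[OF E] by (metis less_imp_le)
  qed
  then show ?thesis using seq_in_Sob_inv[OF E] by (simp add: cauchy_iff)
qed

text \<open>
  Along a rapid sequence the \<open>n\<close>-th step has a single cone which is at once as small as required.
  This avoids comparing different cones of one morphism.
\<close>

definition rapid :: "nat \<Rightarrow> (nat \<Rightarrow> 'o) \<Rightarrow> (nat \<Rightarrow> 'm) \<Rightarrow> bool" where
  "rapid K E e \<longleftrightarrow> seq_in C E e \<and> (\<forall>n. small (K + n) (e n))"

lemma rapid_seq_in: "rapid K E e \<Longrightarrow> seq_in C E e"
  and rapid_small: "rapid K E e \<Longrightarrow> small (K + n) (e n)"
  by (auto simp: rapid_def)

lemma rapid_small_tr: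
  assumes "rapid K E e" "n \<le> m"
  shows "small (K + n) (tr E e n m)"
proof (rule small_tr[OF rapid_seq_in[OF assms(1)] _ assms(2)])
  show "small (K + n) (e m)" if "n \<le> m" for m
    using small_mono[of "K + n" "K + m"] rapid_small[OF assms(1), of m] that by simp
qed

lemma rapid_cauchy:
  assumes "rapid K E e"
  shows "cauchy C M E e"
proof -
  have "small i (tr E e j k)" if "i \<le> j" "j < k" for i j k
    using small_mono[of i "K + j"] rapid_small_tr[OF assms, of j k] that by simp
  then show ?thesis using rapid_seq_in[OF assms] by (auto simp: cauchy_iff)
qed

lemma rapid_sub:
  assumes "rapid K E e" and \<phi>: "strict_mono \<phi>"
  shows "rapid K (E \<circ> \<phi>) (sub E e \<phi>)"
proof -
  have "small (K + n) (sub E e \<phi> n)" for n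
    using rapid_small_tr[OF assms(1), of "\<phi> n" "\<phi> (Suc n)"] small_mono[of "K + n" "K + \<phi> n"] \<phi>
      strict_mono_imp_increasing[OF \<phi>, of n]
    by (simp add: sub_def strict_mono_less_eq)
  then show ?thesis using seq_in_sub[OF rapid_seq_in[OF assms(1)] \<phi>] by (simp add: rapid_def)
qed

lemma cauchy_rapid_sub:
  assumes "cauchy C M E e"
  obtains \<phi> where "strict_mono \<phi>" "rapid K (E \<circ> \<phi>) (sub E e \<phi>)"
proof -
  have "\<forall>i. \<exists>N. \<forall>j k. N \<le> j \<and> j < k \<longrightarrow> small i (tr E e j k)" using assms by (simp add: cauchy_iff)
  then obtain N where N: "\<And>i j k. N i \<le> j \<Longrightarrow> j < k \<Longrightarrow> small i (tr E e j k)" by metis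
  \<comment> \<open>The \<open>n\<close>-th chosen stage lies beyond the Cauchy threshold for index
    \<open>K + n\<close>, hence so does the whole step that starts there.\<close>
  have "\<exists>\<phi>. \<forall>n. N (K + n) \<le> \<phi> n \<and> \<phi> n < \<phi> (Suc n)"
  proof (rule dependent_nat_choice)
    show "\<exists>y. N (K + Suc n) \<le> y \<and> x < y" for x n
      by (rule exI[of _ "Suc (max x (N (K + Suc n)))"]) auto
  qed blast
  then obtain \<phi> where \<phi>: "\<And>n. N (K + n) \<le> \<phi> n" "\<And>n. \<phi> n < \<phi> (Suc n)" by blast
  have sm: "strict_mono \<phi>" using \<phi>(2) by (simp add: strict_mono_Suc_iff)
  have "rapid K (E \<circ> \<phi>) (sub E e \<phi>)"
    using seq_in_sub[OF cauchy_seq_in[OF assms] sm] N \<phi> by (simp add: rapid_def sub_def)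
  then show ?thesis using that sm by blast
qed

text \<open>By Yoneda this is orthogonality to the representables of \<open>M k\<close>, expressed
  on sections.\<close>

definition orth :: "nat \<Rightarrow> ('o, 'm, 'g) psh \<Rightarrow> bool" where
  "orth k F \<longleftrightarrow> additive_psh C F \<and> (\<forall>a\<in>M k. sec F a = {\<one>\<^bsub>Pob F a\<^esub>})"

lemma orth_mono: "k \<le> l \<Longrightarrow> orth k F \<Longrightarrow> orth l F"
  using M_mono unfolding orth_def by blast

lemma orth_shift: "orth k F \<Longrightarrow> orth (Suc k) (psh_shift C F)"
  using M_obj M_Sob_inv by (simp add: orth_def psh_shift_psh psh_shift_Pob)

lemma orth_unshift: "orth k F \<Longrightarrow> orth (Suc k) (psh_unshift F)"
  using M_obj M_Sob by (simp add: orth_def psh_unshift_psh psh_unshift_Pob)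

text \<open>As a filtered colimit of representables, \<open>F\<close> is cohomological: a section
  over \<open>b'\<close> that vanishes on \<open>b\<close> comes from the cone \<open>Z\<close>,
  where \<open>F\<close> is zero. The factorisation exists only after passing to a later stage
  \<open>l\<close>.\<close>

lemma orth_restrict_inj:
  assumes P: "ptw E e F x" and F: "orth k F" and p: "mor p b b'" "small (Suc k) p"
    and y: "y \<in> sec F b'" "y' \<in> sec F b'" and eq: "Pmor F p y = Pmor F p y'"
  shows "y = y'"
proof -
  have psh: "additive_psh C F" using F by (simp add: orth_def)
  note o = mor_obj[OF p(1)]
  obtain Z v w where Z: "Z \<in> M (Suc k)" "dist_triangle C b b' Z (p, v, w)"
    using p is_cone_iff[OF p(1)] unfolding small_def by blast
  note m = dist_mor[OF Z(2)]
  have kernel: "z = \<one>\<^bsub>Pob F b'\<^esub>" if z: "z \<in> sec F b'" "Pmor F p z = \<one>\<^bsub>Pob F b\<^esub>" for z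
  proof -
    obtain n f where f: "mor f b' (E n)" "z = Pmor F f (x n)" using ptw_repr[OF P o(2) z(1), of 0] by blast
    have "Pmor F (f \<cdot> p) (x n) = \<one>\<^bsub>Pob F b\<^esub>"
      using z(2) f psh_cmp[OF psh p(1) f(1) ptw_sec[OF P]] by simp
    then obtain l where l: "n \<le> l" "tr E e n l \<cdot> (f \<cdot> p) = zr b (E l)"
      using ptw_kernel[OF P mor_cmp[OF p(1) f(1)]] by blast
    note t = tr_mor[OF ptw_seq[OF P] l(1)]
    have "(tr E e n l \<cdot> f) \<cdot> p = zr b (E l)" using l(2) cmp_mor_assoc[OF p(1) f(1) t] by simp
    then obtain q where q: "mor q Z (E l)" "tr E e n l \<cdot> f = q \<cdot> v"
      using hom_coexact[OF Z(2) mor_cmp[OF f(1) t]] by blast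
    have "Pmor F q (x l) = \<one>\<^bsub>Pob F Z\<^esub>"
      using psh_act[OF psh q(1) ptw_sec[OF P]] F Z(1) M_Suc unfolding orth_def by blast
    then have "Pmor F (q \<cdot> v) (x l) = \<one>\<^bsub>Pob F b'\<^esub>"
      using psh_cmp[OF psh m(2) q(1) ptw_sec[OF P]] psh_one[OF psh m(2)] by simp
    then show ?thesis using ptw_push[OF P f(1) l(1)] f(2) q(2) by simp
  qed
  interpret h: group_hom "Pob F b'" "Pob F b" "Pmor F p" using psh_group_hom[OF psh p(1)] .
  have "y \<otimes>\<^bsub>Pob F b'\<^esub> m_inv (Pob F b') y' = \<one>\<^bsub>Pob F b'\<^esub>"
    by (rule kernel) (use y eq in \<open>simp_all add: h.H.r_inv\<close>)
  then show ?thesis using y h.G.inv_equality[of y "m_inv (Pob F b') y'"] by simp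
qed

text \<open>The obstruction to extending \<open>y\<close> is its restriction to the desuspended
  cone. That object lies in \<open>M k\<close> because the cone lies in \<open>M (Suc k)\<close>, so
  the obstruction vanishes.\<close>

lemma orth_extend:
  assumes P: "ptw E e F x" and F: "orth k F" and p: "mor p b b'" "small (Suc k) p"
    and y: "y \<in> sec F b"
  obtains y' where "y' \<in> sec F b'" "Pmor F p y' = y"
proof -
  have psh: "additive_psh C F" using F by (simp add: orth_def)
  note o = mor_obj[OF p(1)]
  obtain Z v w where Z: "Z \<in> M (Suc k)" "dist_triangle C b b' Z (p, v, w)"
    using p is_cone_iff[OF p(1)] unfolding small_def by blast
  obtain d where d: "dist_triangle C (Sob_inv C Z) b b' (d, p, v)" using dist_back[OF Z(2)] .
  note m = dist_mor[OF d]
  obtain n f where f: "mor f b (E n)" "y = Pmor F f (x n)" using ptw_repr[OF P o(1) y, of 0] by blast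
  have "Pmor F (f \<cdot> d) (x n) = \<one>\<^bsub>Pob F (Sob_inv C Z)\<^esub>"
    using psh_act[OF psh mor_cmp[OF m(1) f(1)] ptw_sec[OF P]] F M_Sob_inv[OF Z(1)] unfolding orth_def by blast
  then obtain l where l: "n \<le> l" "tr E e n l \<cdot> (f \<cdot> d) = zr (Sob_inv C Z) (E l)"
    using ptw_kernel[OF P mor_cmp[OF m(1) f(1)]] by blast
  note t = tr_mor[OF ptw_seq[OF P] l(1)]
  have "(tr E e n l \<cdot> f) \<cdot> d = zr (Sob_inv C Z) (E l)" using l(2) cmp_mor_assoc[OF m(1) f(1) t] by simp
  then obtain q where q: "mor q b' (E l)" "tr E e n l \<cdot> f = q \<cdot> p"
    using hom_coexact[OF d mor_cmp[OF f(1) t]] by blast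
  have "Pmor F p (Pmor F q (x l)) = y"
    using psh_cmp[OF psh p(1) q(1) ptw_sec[OF P]] ptw_push[OF P f(1) l(1)] q(2) f(2) by simp
  then show ?thesis using that psh_act[OF psh q(1) ptw_sec[OF P]] by blast
qed

end

section \<open>Extensions in the completion\<close>

context good_metric_category
begin

section \<open>Exactness of a strong triangle on sections\<close>

context
  fixes A B D :: "('o, 'm, 'g) psh"
    and a b c a' b' c' f g h \<alpha> \<beta> \<gamma> u v w
  assumes T: "\<And>n. dist_triangle C (a n) (b n) (c n) (f n, g n, h n)"
    and sq: "\<And>n. triangle_map C (f n, g n, h n) (f (Suc n), g (Suc n), h (Suc n)) (a' n) (b' n) (c' n)"
    and PA: "ptw a a' A \<alpha>" and PB: "ptw b b' B \<beta>" and PD: "ptw c c' D \<gamma>"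
    and u: "ntr u A B" and v: "ntr v B D" and w: "ntr w D (psh_shift C A)"
    and u\<alpha>: "\<And>n. u (a n) (\<alpha> n) = Pmor B (f n) (\<beta> n)"
    and v\<beta>: "\<And>n. v (b n) (\<beta> n) = Pmor D (g n) (\<gamma> n)"
    and w\<gamma>: "\<And>n. w (c n) (\<gamma> n) = Pmor (psh_shift C A) (h n) (\<alpha> n)"
begin

private lemmas seqs = ptw_seq[OF PA] ptw_seq[OF PB] ptw_seq[OF PD]
private lemmas pshs = ptw_psh[OF PA] ptw_psh[OF PB] ptw_psh[OF PD]
private lemmas PA1 = ptw_shift[OF PA]

private lemma fm: "mor (f n) (a n) (b n)"
  and gm: "mor (g n) (b n) (c n)"
  and hm: "mor (h n) (c n) (Sob C (a n))"
  using dist_mor[OF T] by blast+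

private lemma sqs:
  "f (Suc n) \<cdot> a' n = b' n \<cdot> f n" "g (Suc n) \<cdot> b' n = c' n \<cdot> g n" "h (Suc n) \<cdot> c' n = Smor C (a' n) \<cdot> h n"
  using sq[of n] by (auto simp: triangle_map_def)

private lemmas f_tr = tr_natural_cmp[OF seqs(1,2) fm sqs(1)]
private lemmas g_tr = tr_natural_cmp[OF seqs(2,3) gm sqs(2)]
private lemmas h_tr = tr_natural_cmp[OF seqs(3) seq_in_Sob[OF seqs(1)] hm sqs(3)]

lemma wv_one:
  assumes s: "s \<in> Obj C" and y: "y \<in> sec B s"
  shows "w s (v s y) = \<one>\<^bsub>Pob (psh_shift C A) s\<^esub>"
proof -
  obtain n q where q: "mor q s (b n)" "y = Pmor B q (\<beta> n)" using ptw_repr[OF PB s y, of 0] by blast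
  have "v s y = Pmor D (g n \<cdot> q) (\<gamma> n)"
    using q(2) ntr_natural[OF v q(1) ptw_sec[OF PB]] v\<beta> psh_cmp[OF pshs(3) q(1) gm ptw_sec[OF PD]] by simp
  then have "w s (v s y) = Pmor (psh_shift C A) (h n \<cdot> (g n \<cdot> q)) (\<alpha> n)"
    using ntr_natural[OF w mor_cmp[OF q(1) gm] ptw_sec[OF PD]] w\<gamma>
      psh_cmp[OF ptw_psh[OF PA1] mor_cmp[OF q(1) gm] hm ptw_sec[OF PA1]] by simp
  moreover have "h n \<cdot> (g n \<cdot> q) = zr s (Sob C (a n))"
    using cmp_mor_assoc[OF q(1) gm hm] dist_cmp_zero'[OF T] zr_cmp[OF q(1)] Sob_obj seq_in_obj[OF seqs(1)] by simp
  ultimately show ?thesis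
    using psh_zr[OF ptw_psh[OF PA1] s Sob_obj[OF seq_in_obj[OF seqs(1)]] ptw_sec[OF PA1]] by simp
qed

text \<open>Vanishing in the colimit becomes actual vanishing at a later stage, where the
  distinguished triangle is exact.\<close>

lemma exact_middle:
  assumes s: "s \<in> Obj C" and y: "y \<in> sec B s" and 0: "v s y = \<one>\<^bsub>Pob D s\<^esub>"
  obtains z where "z \<in> sec A s" "y = u s z"
proof -
  obtain n q where q: "mor q s (b n)" "y = Pmor B q (\<beta> n)" using ptw_repr[OF PB s y, of 0] by blast
  have "Pmor D (g n \<cdot> q) (\<gamma> n) = \<one>\<^bsub>Pob D s\<^esub>"
    using 0 q(2) ntr_natural[OF v q(1) ptw_sec[OF PB]] v\<beta> psh_cmp[OF pshs(3) q(1) gm ptw_sec[OF PD]] by simp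
  then obtain m where m: "n \<le> m" "tr c c' n m \<cdot> (g n \<cdot> q) = zr s (c m)"
    using ptw_kernel[OF PD mor_cmp[OF q(1) gm]] by blast
  note q' = mor_cmp[OF q(1) tr_mor[OF seqs(2) m(1)]]
  obtain r where r: "mor r s (a m)" "tr b b' n m \<cdot> q = f m \<cdot> r"
    using hom_exact[OF T q'] g_tr[OF m(1) q(1)] m(2) by auto
  have "y = Pmor B (f m \<cdot> r) (\<beta> m)" using ptw_push[OF PB q(1) m(1)] q(2) r(2) by simp
  also have "\<dots> = u s (Pmor A r (\<alpha> m))"
    using psh_cmp[OF pshs(2) r(1) fm ptw_sec[OF PB]] u\<alpha> ntr_natural[OF u r(1) ptw_sec[OF PA]] by simp
  finally show ?thesis using that psh_act[OF pshs(1) r(1) ptw_sec[OF PA]] by blast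
qed

text \<open>Exactness at \<open>A\<close>, one place before the start of the triangle. Sections of
  \<open>A\<close> over \<open>s\<close> are sections of the shifted functor over
  \<open>Sob C s\<close>, so the preimage in \<open>D\<close> lives there.\<close>

lemma exact_left:
  assumes s: "s \<in> Obj C" and z: "z \<in> sec A s" and 0: "u s z = \<one>\<^bsub>Pob B s\<^esub>"
  obtains t where "t \<in> sec D (Sob C s)" "z = w (Sob C s) t"
proof -
  obtain n r where r: "mor r s (a n)" "z = Pmor A r (\<alpha> n)" using ptw_repr[OF PA s z, of 0] by blast
  have "Pmor B (f n \<cdot> r) (\<beta> n) = \<one>\<^bsub>Pob B s\<^esub>"
    using 0 r(2) ntr_natural[OF u r(1) ptw_sec[OF PA]] u\<alpha> psh_cmp[OF pshs(2) r(1) fm ptw_sec[OF PB]] by simp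
  then obtain m where m: "n \<le> m" "tr b b' n m \<cdot> (f n \<cdot> r) = zr s (b m)"
    using ptw_kernel[OF PB mor_cmp[OF r(1) fm]] by blast
  let ?r = "tr a a' n m \<cdot> r"
  note r' = mor_cmp[OF r(1) tr_mor[OF seqs(1) m(1)]]
  have "f m \<cdot> ?r = zr s (b m)" using f_tr[OF m(1) r(1)] m(2) by simp
  then have "Smor C (f m) \<cdot> Smor C ?r = zr (Sob C s) (Sob C (b m))"
    using Smor_cmp_mor[OF r' fm] Smor_zr[OF s seq_in_obj[OF seqs(2)]] by simp
  then obtain t where t: "mor t (Sob C s) (c m)" "Smor C ?r = h m \<cdot> t"
    using hom_exact''[OF T mor_Smor[OF r']] by blast
  have "w (Sob C s) (Pmor D t (\<gamma> m)) = Pmor (psh_shift C A) (Smor C ?r) (\<alpha> m)"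
    using ntr_natural[OF w t(1) ptw_sec[OF PD]] w\<gamma> psh_cmp[OF ptw_psh[OF PA1] t(1) hm ptw_sec[OF PA1]] t(2) by simp
  also have "\<dots> = z"
    using psh_shift_Pmor[OF mor_Smor[OF r'], of A] Smor_inv_Smor[OF r'] ptw_push[OF PA r(1) m(1)] r(2) by simp
  finally show ?thesis using that psh_act[OF pshs(3) t(1) ptw_sec[OF PD]] by metis
qed

section \<open>Extending two rapid sequences along compatible connecting maps\<close>

context
  fixes x x' \<xi> z z' \<zeta> r k
  assumes rx: "rapid (Suc k) x x'" and rz: "rapid (Suc k) z z'"
    and PX: "ptw x x' A \<xi>" and PZ: "ptw z z' D \<zeta>"
    and rm: "\<And>n. mor (r n) (z n) (Sob C (x n))"
    and r\<zeta>: "\<And>n. w (z n) (\<zeta> n) = Pmor (psh_shift C A) (r n) (\<xi> n)"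
    and rsq: "\<And>n. r (Suc n) \<cdot> z' n = Smor C (x' n) \<cdot> r n"
    and B_orth: "orth k B" and D_orth: "orth k D"
begin

text \<open>The state of the recursion: a triangle over \<open>r n\<close> with a section
  \<open>\<eta>\<close> of \<open>B\<close> on its middle object that maps this triangle to
  \<open>A \<rightarrow> B \<rightarrow> D\<close>.\<close>

private definition filler :: "nat \<Rightarrow> 'o \<times> 'm \<times> 'm \<times> 'g \<Rightarrow> bool" where
  "filler n = (\<lambda>(y, p, q, \<eta>). dist_triangle C (x n) y (z n) (p, q, r n) \<and> \<eta> \<in> sec B y \<and>
     Pmor B p \<eta> = u (x n) (\<xi> n) \<and> v y \<eta> = Pmor D q (\<zeta> n))"

private definition filler_map :: "nat \<Rightarrow> 'o \<times> 'm \<times> 'm \<times> 'g \<Rightarrow> 'o \<times> 'm \<times> 'm \<times> 'g \<Rightarrow> 'm \<Rightarrow> bool" where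
  "filler_map n = (\<lambda>(y, p, q, \<eta>) (y', p', q', \<eta>') e. mor e y y' \<and> p' \<cdot> x' n = e \<cdot> p \<and> q' \<cdot> e = z' n \<cdot> q \<and>
     small (Suc k + n) e \<and> Pmor B e \<eta>' = \<eta>)"

text \<open>Only here is a section of \<open>B\<close> created rather than extended: the new
  triangle is mapped into a triangle of the given presentation, and the given section is pulled
  back.\<close>

private lemma filler_zero: "\<exists>t. filler 0 t"
proof -
  have o: "x 0 \<in> Obj C" "z 0 \<in> Obj C" using seq_in_obj ptw_seq PX PZ by blast+
  obtain y p q where t: "dist_triangle C (x 0) y (z 0) (p, q, r 0)"
    using dist_complete_third[OF rm o(1)] by blast
  note tm = dist_mor[OF t]
  obtain n i where i: "mor i (z 0) (c n)" "\<zeta> 0 = Pmor D i (\<gamma> n)"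
    using ptw_repr[OF PD o(2) ptw_sec[OF PZ], of 0] by blast
  obtain m j where j: "n \<le> m" "mor j (x 0) (a m)" "\<xi> 0 = Pmor A j (\<alpha> m)"
    using ptw_repr[OF PA o(1) ptw_sec[OF PX], of n] by blast
  let ?i = "tr c c' n m \<cdot> i"
  have i': "mor ?i (z 0) (c m)" "\<zeta> 0 = Pmor D ?i (\<gamma> m)"
    using mor_cmp[OF i(1) tr_mor[OF seqs(3) j(1)]] ptw_push[OF PD i(1) j(1)] i(2) by auto
  note j' = mor_Smor[OF j(2)]
  have "Pmor (psh_shift C A) (h m \<cdot> ?i) (\<alpha> m) = w (z 0) (\<zeta> 0)"
    using psh_cmp[OF ptw_psh[OF PA1] i'(1) hm ptw_sec[OF PA1]] w\<gamma> ntr_natural[OF w i'(1) ptw_sec[OF PD]] i'(2)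
    by simp
  also have "\<dots> = Pmor (psh_shift C A) (Smor C j \<cdot> r 0) (\<alpha> m)"
    using r\<zeta>[of 0] psh_cmp[OF ptw_psh[OF PA1] rm j' ptw_sec[OF PA1]]
      psh_shift_Pmor[OF j', of A] Smor_inv_Smor[OF j(2)] j(3) by simp
  \<comment> \<open>The two connecting maps agree only as sections of the shifted colimit. At a late
    enough stage \<open>l\<close> they agree as morphisms, as \<open>dist_fill_middle\<close>
    requires.\<close>
  finally obtain l where l: "m \<le> l"
     "Smor C (tr a a' m l) \<cdot> (h m \<cdot> ?i) = Smor C (tr a a' m l) \<cdot> (Smor C j \<cdot> r 0)"
    using ptw_eq[OF PA1 mor_cmp[OF i'(1) hm] mor_cmp[OF rm j']] tr_Sob[OF seqs(1)] by metis
  let ?i2 = "tr c c' m l \<cdot> ?i" and ?j2 = "tr a a' m l \<cdot> j"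
  note ta = tr_mor[OF seqs(1) l(1)]
  have i2: "mor ?i2 (z 0) (c l)" "\<zeta> 0 = Pmor D ?i2 (\<gamma> l)"
    using mor_cmp[OF i'(1) tr_mor[OF seqs(3) l(1)]] ptw_push[OF PD i'(1) l(1)] i'(2) by auto
  have j2: "mor ?j2 (x 0) (a l)" "\<xi> 0 = Pmor A ?j2 (\<alpha> l)"
    using mor_cmp[OF j(2) ta] ptw_push[OF PA j(2) l(1)] j(3) by auto
  have "Smor C ?j2 \<cdot> r 0 = h l \<cdot> ?i2"
    using l h_tr[OF l(1) i'(1)] tr_Sob[OF seqs(1)] Smor_cmp_mor[OF j(2) ta]
      cmp_mor_assoc[OF rm j' mor_Smor[OF ta]] by simp
  then obtain e where e: "mor e y (b l)" "e \<cdot> p = f l \<cdot> ?j2" "?i2 \<cdot> q = g l \<cdot> e"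
    using dist_fill_middle[OF t T j2(1) i2(1)] by blast
  let ?\<eta> = "Pmor B e (\<beta> l)"
  have "Pmor B p ?\<eta> = Pmor B (f l \<cdot> ?j2) (\<beta> l)"
    using psh_cmp[OF pshs(2) tm(1) e(1) ptw_sec[OF PB]] e(2) by simp
  also have "\<dots> = u (x 0) (\<xi> 0)"
    using psh_cmp[OF pshs(2) j2(1) fm ptw_sec[OF PB]] u\<alpha> ntr_natural[OF u j2(1) ptw_sec[OF PA]] j2(2) by simp
  finally have 1: "Pmor B p ?\<eta> = u (x 0) (\<xi> 0)" .
  have "v y ?\<eta> = Pmor D (g l \<cdot> e) (\<gamma> l)"
    using ntr_natural[OF v e(1) ptw_sec[OF PB]] v\<beta> psh_cmp[OF pshs(3) e(1) gm ptw_sec[OF PD]] by simp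
  also have "\<dots> = Pmor D q (\<zeta> 0)"
    using e(3) psh_cmp[OF pshs(3) tm(2) i2(1) ptw_sec[OF PD]] i2(2) by simp
  finally have "filler 0 (y, p, q, ?\<eta>)"
    using t 1 psh_act[OF pshs(2) e(1) ptw_sec[OF PB]] by (simp add: filler_def)
  then show ?thesis ..
qed

text \<open>The next middle object is produced together with the map into it, so the cone of that
  map is under control. The section then extends by \<open>orth_extend\<close>, and its two
  compatibilities are checked after restrictions that are injective on \<open>B\<close> and on
  \<open>D\<close>.\<close>

private lemma filler_Suc:
  assumes "filler n t"
  shows "\<exists>t'. filler (Suc n) t' \<and> (\<exists>e. filler_map n t t' e)"
proof -
  obtain y p q \<eta> where t: "t = (y, p, q, \<eta>)" by (cases t)
  have d: "dist_triangle C (x n) y (z n) (p, q, r n)" and \<eta>: "\<eta> \<in> sec B y"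
    "Pmor B p \<eta> = u (x n) (\<xi> n)" "v y \<eta> = Pmor D q (\<zeta> n)"
    using assms t by (auto simp: filler_def)
  note X = ptw_seq[OF PX] and Z = ptw_seq[OF PZ]
  note xm = seq_in_mor[OF X, of n] and zm = seq_in_mor[OF Z, of n]
  \<comment> \<open>Both cones are taken in the same \<open>M (Suc k + n)\<close>, so that their
    extension, the cone of \<open>e\<close>, lies there too.\<close>
  obtain F H where FH: "F \<in> M (Suc k + n)" "is_cone C (x' n) F" "H \<in> M (Suc k + n)" "is_cone C (z' n) H"
    using rapid_small[OF rx, of n] rapid_small[OF rz, of n] unfolding small_def by blast
  obtain y' p' q' e G where d': "dist_triangle C (x (Suc n)) y' (z (Suc n)) (p', q', r (Suc n))"
    and e: "mor e y y'" "e \<cdot> p = p' \<cdot> x' n" "z' n \<cdot> q = q' \<cdot> e" "is_cone C e G" "G \<in> star C {F} {H}"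
    using good_filler[OF d rm[of "Suc n"] seq_in_obj[OF X] xm FH(2) zm FH(4) rsq[symmetric]] .
  note m = dist_mor[OF d] and m' = dist_mor[OF d']
  have es: "small (Suc k + n) e" using e(4) M_star[OF FH(1,3) e(5)] unfolding small_def by blast
  have small: "small (Suc k) e" "small (Suc k) (x' n)"
    using small_mono[of "Suc k" "Suc k + n"] es rapid_small[OF rx, of n] by auto
  obtain \<eta>' where \<eta>': "\<eta>' \<in> sec B y'" "Pmor B e \<eta>' = \<eta>"
    using orth_extend[OF PB B_orth e(1) small(1) \<eta>(1)] .
  note u' = ntr_act[OF u seq_in_obj[OF X, of "Suc n"] ptw_sec[OF PX]]
  \<comment> \<open>Compare over \<open>x n\<close>, where the claim is the compatibility of the old
    section.\<close>
  have "Pmor B (x' n) (Pmor B p' \<eta>') = Pmor B (x' n) (u (x (Suc n)) (\<xi> (Suc n)))"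
    using psh_cmp[OF pshs(2) xm m'(1) \<eta>'(1)] psh_cmp[OF pshs(2) m(1) e(1) \<eta>'(1)] e(2) \<eta>(2) \<eta>'(2)
      ntr_natural[OF u xm ptw_sec[OF PX]] ptw_compat[OF PX, of n] by simp
  then have 1: "Pmor B p' \<eta>' = u (x (Suc n)) (\<xi> (Suc n))"
    using orth_restrict_inj[OF PB B_orth xm small(2) psh_act[OF pshs(2) m'(1) \<eta>'(1)] u'] by blast
  \<comment> \<open>The same comparison in \<open>D\<close>, restricting along \<open>e\<close> to
    the old middle object.\<close>
  have "Pmor D e (v y' \<eta>') = Pmor D e (Pmor D q' (\<zeta> (Suc n)))"
    using ntr_natural[OF v e(1) \<eta>'(1)] \<eta>'(2) \<eta>(3) psh_cmp[OF pshs(3) e(1) m'(2) ptw_sec[OF PZ]] e(3)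
      psh_cmp[OF pshs(3) m(2) zm ptw_sec[OF PZ]] ptw_compat[OF PZ, of n] by simp
  then have "v y' \<eta>' = Pmor D q' (\<zeta> (Suc n))"
    using orth_restrict_inj[OF PD D_orth e(1) small(1) ntr_act[OF v m'(5) \<eta>'(1)]
        psh_act[OF pshs(3) m'(2) ptw_sec[OF PZ]]] by blast
  then have "filler (Suc n) (y', p', q', \<eta>')" using d' \<eta>'(1) 1 by (simp add: filler_def)
  moreover have "filler_map n t (y', p', q', \<eta>') e"
    using t e es \<eta>'(2) by (simp add: filler_map_def)
  ultimately show ?thesis by blast
qed

text \<open>Dependent choice runs over objects, triangles and sections at once. That
  \<open>B\<close> is the colimit of the new sequence is then the five lemma, carried out on
  representatives.\<close>

lemma rapid_extension:
  obtains y y' \<eta> where "rapid (Suc k) y y'" "\<And>n. y n \<in> star C {x n} {z n}" "ptw y y' B \<eta>"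
proof -
  have "\<exists>t. \<forall>n. filler n (t n) \<and> (\<exists>e. filler_map n (t n) (t (Suc n)) e)"
    by (rule dependent_nat_choice) (use filler_zero filler_Suc in blast)+
  then obtain t e where te: "\<And>n. filler n (t n)" "\<And>n. filler_map n (t n) (t (Suc n)) (e n)" by metis
  define y p q \<eta> where "y n = fst (t n)" and "p n = fst (snd (t n))" and "q n = fst (snd (snd (t n)))"
    and "\<eta> n = snd (snd (snd (t n)))" for n
  have d: "dist_triangle C (x n) (y n) (z n) (p n, q n, r n)" and \<eta>: "\<eta> n \<in> sec B (y n)"
    and p\<eta>: "Pmor B (p n) (\<eta> n) = u (x n) (\<xi> n)" and v\<eta>: "v (y n) (\<eta> n) = Pmor D (q n) (\<zeta> n)" for n
    using te(1)[of n] by (auto simp: filler_def y_def p_def q_def \<eta>_def split_beta)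
  have em: "mor (e n) (y n) (y (Suc n))" and pe: "p (Suc n) \<cdot> x' n = e n \<cdot> p n" and qe: "q (Suc n) \<cdot> e n = z' n \<cdot> q n"
    and es: "small (Suc k + n) (e n)" and \<eta>e: "Pmor B (e n) (\<eta> (Suc n)) = \<eta> n" for n
    using te(2)[of n] by (auto simp: filler_map_def y_def p_def q_def \<eta>_def split_beta)
  have pm: "mor (p n) (x n) (y n)" and qm: "mor (q n) (y n) (z n)" for n
    using dist_mor[OF d] by blast+
  note X = ptw_seq[OF PX] and Z = ptw_seq[OF PZ] and PX1 = ptw_shift[OF PX]
  have Y: "seq_in C y e" using em by (rule seq_inI)
  note p_tr = tr_natural_cmp[OF X Y pm pe] and q_tr = tr_natural_cmp[OF Y Z qm qe]
    and r_tr = tr_natural_cmp[OF Z seq_in_Sob[OF X] rm rsq]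
  note push = compat_push[OF Y pshs(2) \<eta> \<eta>e]
  have "ptw y e B \<eta>"
    unfolding ptw_def
  proof (intro conjI allI ballI impI Y pshs(2) \<eta> \<eta>e)
    \<comment> \<open>Surjectivity: the image of \<open>\<theta>\<close> in \<open>D\<close> is
      killed by the connecting map, so it lifts through some \<open>q m\<close>. The lift differs
      from \<open>\<theta>\<close> by a section coming from \<open>A\<close>, which the sequence
      \<open>x\<close> represents.\<close>
    fix s \<theta> assume s: "s \<in> Obj C" and \<theta>: "\<theta> \<in> sec B s"
    obtain n i where i: "mor i s (z n)" "v s \<theta> = Pmor D i (\<zeta> n)"
      using ptw_repr[OF PZ s ntr_act[OF v s \<theta>], of 0] by blast
    have "Pmor (psh_shift C A) (r n \<cdot> i) (\<xi> n) = \<one>\<^bsub>Pob (psh_shift C A) s\<^esub>"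
      using psh_cmp[OF ptw_psh[OF PX1] i(1) rm ptw_sec[OF PX1]] r\<zeta> ntr_natural[OF w i(1) ptw_sec[OF PZ]]
        i(2) wv_one[OF s \<theta>] by simp
    then obtain m where m: "n \<le> m" "r m \<cdot> (tr z z' n m \<cdot> i) = zr s (Sob C (x m))"
      using ptw_kernel[OF PX1 mor_cmp[OF i(1) rm]] r_tr[OF _ i(1)] by metis
    obtain j where j: "mor j s (y m)" "tr z z' n m \<cdot> i = q m \<cdot> j"
      using hom_exact'[OF d mor_cmp[OF i(1) tr_mor[OF Z m(1)]] m(2)] .
    let ?\<theta> = "Pmor B j (\<eta> m)"
    have \<theta>': "?\<theta> \<in> sec B s" using psh_act[OF pshs(2) j(1) \<eta>] .
    have "v s ?\<theta> = v s \<theta>"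
      using ntr_natural[OF v j(1) \<eta>] v\<eta> psh_cmp[OF pshs(3) j(1) qm ptw_sec[OF PZ]] j(2)
        ptw_push[OF PZ i(1) m(1)] i(2) by simp
    interpret V: group_hom "Pob B s" "Pob D s" "v s" using ntr_group_hom[OF v s] .
    have "v s (\<theta> \<otimes>\<^bsub>Pob B s\<^esub> m_inv (Pob B s) ?\<theta>) = \<one>\<^bsub>Pob D s\<^esub>"
      using \<open>v s ?\<theta> = v s \<theta>\<close> \<theta> \<theta>' by simp
    then obtain \<psi> where \<psi>: "\<psi> \<in> sec A s" "\<theta> \<otimes>\<^bsub>Pob B s\<^esub> m_inv (Pob B s) ?\<theta> = u s \<psi>"
      using exact_middle[OF s] \<theta> \<theta>' by (metis V.G.inv_closed V.G.m_closed)
    obtain l k where l: "m \<le> l" "mor k s (x l)" "\<psi> = Pmor A k (\<xi> l)" using ptw_repr[OF PX s \<psi>(1), of m] by blast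
    let ?k = "p l \<cdot> k" and ?j = "tr y e m l \<cdot> j"
    have kj: "mor ?k s (y l)" "mor ?j s (y l)" using mor_cmp[OF l(2) pm] mor_cmp[OF j(1) tr_mor[OF Y l(1)]] .
    have "u s \<psi> = Pmor B ?k (\<eta> l)"
      using l(3) ntr_natural[OF u l(2) ptw_sec[OF PX]] p\<eta> psh_cmp[OF pshs(2) l(2) pm \<eta>] by simp
    moreover have "?\<theta> = Pmor B ?j (\<eta> l)" using push[OF j(1) l(1)] by simp
    moreover have "\<theta> = u s \<psi> \<otimes>\<^bsub>Pob B s\<^esub> ?\<theta>"
      using \<psi>(2)[symmetric] \<theta> \<theta>' by (simp add: V.G.m_assoc)
    ultimately have "\<theta> = Pmor B (?k \<otimes>\<^bsub>Hom C s (y l)\<^esub> ?j) (\<eta> l)"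
      using psh_add[OF pshs(2) kj \<eta>] by simp
    then show "\<exists>n i. mor i s (y n) \<and> \<theta> = Pmor B i (\<eta> n)" using mor_add[OF kj] by blast
  next
    \<comment> \<open>Injectivity: an element dying in \<open>B\<close> dies in \<open>D\<close>, so
      it eventually comes from some \<open>i\<close> into \<open>x m\<close>. The section of
      \<open>A\<close> given by \<open>i\<close> dies in \<open>B\<close>, so it comes from
      \<open>D\<close> over \<open>Sob C s\<close>.\<close>
    fix n s j assume "mor j s (y n) \<and> Pmor B j (\<eta> n) = \<one>\<^bsub>Pob B s\<^esub>"
    then have j: "mor j s (y n)" "Pmor B j (\<eta> n) = \<one>\<^bsub>Pob B s\<^esub>" by auto
    have s: "s \<in> Obj C" using mor_obj(1)[OF j(1)] .
    have "Pmor D (q n \<cdot> j) (\<zeta> n) = \<one>\<^bsub>Pob D s\<^esub>"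
      using psh_cmp[OF pshs(3) j(1) qm ptw_sec[OF PZ]] v\<eta> ntr_natural[OF v j(1) \<eta>] j(2) ntr_one[OF v s] by simp
    then obtain m where m: "n \<le> m" "q m \<cdot> (tr y e n m \<cdot> j) = zr s (z m)"
      using ptw_kernel[OF PZ mor_cmp[OF j(1) qm]] q_tr[OF _ j(1)] by metis
    obtain i where i: "mor i s (x m)" "tr y e n m \<cdot> j = p m \<cdot> i"
      using hom_exact[OF d mor_cmp[OF j(1) tr_mor[OF Y m(1)]] m(2)] .
    have "u s (Pmor A i (\<xi> m)) = \<one>\<^bsub>Pob B s\<^esub>"
      using ntr_natural[OF u i(1) ptw_sec[OF PX]] p\<eta> psh_cmp[OF pshs(2) i(1) pm \<eta>] i(2) push[OF j(1) m(1)] j(2)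
      by simp
    then obtain \<tau> where \<tau>: "\<tau> \<in> sec D (Sob C s)" "Pmor A i (\<xi> m) = w (Sob C s) \<tau>"
      using exact_left[OF s psh_act[OF pshs(1) i(1) ptw_sec[OF PX]]] by blast
    obtain l t where t: "m \<le> l" "mor t (Sob C s) (z l)" "\<tau> = Pmor D t (\<zeta> l)"
      using ptw_repr[OF PZ Sob_obj[OF s] \<tau>(1), of m] by blast
    note i' = mor_Smor[OF i(1)]
    have "Pmor (psh_shift C A) (Smor C i) (\<xi> m) = Pmor (psh_shift C A) (r l \<cdot> t) (\<xi> l)"
      using psh_shift_Pmor[OF i', of A] Smor_inv_Smor[OF i(1)] \<tau>(2) t(3) ntr_natural[OF w t(2) ptw_sec[OF PZ]] r\<zeta>
        psh_cmp[OF ptw_psh[OF PX1] t(2) rm ptw_sec[OF PX1]] by simp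
    then obtain \<omega> where \<omega>: "m \<le> \<omega>" "l \<le> \<omega>" "Smor C (tr x x' m \<omega>) \<cdot> Smor C i = r \<omega> \<cdot> (tr z z' l \<omega> \<cdot> t)"
      using ptw_eq[OF PX1 i' mor_cmp[OF t(2) rm]] tr_Sob[OF X] r_tr[OF _ t(2)] by metis
    note tx = tr_mor[OF X \<omega>(1)]
    let ?t = "tr z z' l \<omega> \<cdot> t" and ?i = "tr x x' m \<omega> \<cdot> i"
    have t': "mor ?t (Sob C s) (z \<omega>)" and i2: "mor ?i s (x \<omega>)"
      using mor_cmp[OF t(2) tr_mor[OF Z \<omega>(2)]] mor_cmp[OF i(1) tx] .
    \<comment> \<open>Once the shift of \<open>i\<close> factors through \<open>r \<omega>\<close>,
      it is killed by the shift of \<open>p \<omega>\<close>, these being consecutive maps of a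
      triangle.\<close>
    have "Smor C (p \<omega> \<cdot> ?i) = Smor C (p \<omega>) \<cdot> (r \<omega> \<cdot> ?t)"
      using Smor_cmp_mor[OF i2 pm] Smor_cmp_mor[OF i(1) tx] \<omega>(3) by simp
    also have "\<dots> = zr (Sob C s) (Sob C (y \<omega>))"
      using cmp_mor_assoc[OF t' rm mor_Smor[OF pm]] dist_cmp_zero''[OF d] zr_cmp[OF t'] Sob_obj[OF seq_in_obj[OF Y]]
      by simp
    finally have "p \<omega> \<cdot> ?i = zr s (y \<omega>)"
      using Smor_inj[OF mor_cmp[OF i2 pm] mor_zr[OF s seq_in_obj[OF Y]]] Smor_zr[OF s seq_in_obj[OF Y]] by simp
    then have "tr y e m \<omega> \<cdot> (tr y e n m \<cdot> j) = zr s (y \<omega>)"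
      using p_tr[OF \<omega>(1) i(1)] i(2) by simp
    then have "tr y e n \<omega> \<cdot> j = zr s (y \<omega>)" using tr_cmp[OF Y m(1) \<omega>(1) j(1)] by simp
    then show "\<exists>m\<ge>n. tr y e n m \<cdot> j = zr s (y m)" using m(1) \<omega>(1) le_trans by blast
  qed
  moreover have "rapid (Suc k) y e" using Y es by (simp add: rapid_def)
  moreover have "y n \<in> star C {x n} {z n}" for n using d unfolding star_def by blast
  ultimately show ?thesis using that by blast
qed

end

text \<open>It remains to straighten \<open>w\<close> into a strictly compatible family of maps
  between the two sequences. Representing its values on the universal sections gives maps that
  commute only eventually, and thinning \<open>X\<close> makes them commute.\<close>

lemma cauchy_extension:
  assumes x: "cauchy C M x x'" "ptw x x' A \<xi>" "\<And>n. x n \<in> M i"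
    and z: "cauchy C M z z'" "ptw z z' D \<zeta>" "\<And>n. z n \<in> M i"
    and B: "orth k B" and D: "orth k D"
  obtains y y' \<eta> where "cauchy C M y y'" "ptw y y' B \<eta>" "\<And>n. y n \<in> M i"
proof -
  obtain \<rho> where \<rho>: "strict_mono \<rho>" "rapid (Suc k) (x \<circ> \<rho>) (sub x x' \<rho>)" using cauchy_rapid_sub[OF x(1)] .
  obtain \<sigma> where \<sigma>: "strict_mono \<sigma>" "rapid (Suc k) (z \<circ> \<sigma>) (sub z z' \<sigma>)" using cauchy_rapid_sub[OF z(1)] .
  define X X' \<Xi> where "X = x \<circ> \<rho>" and "X' = sub x x' \<rho>" and "\<Xi> = \<xi> \<circ> \<rho>"
  define Z Z' H where "Z = z \<circ> \<sigma>" and "Z' = sub z z' \<sigma>" and "H = \<zeta> \<circ> \<sigma>"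
  have PX: "ptw X X' A \<Xi>" and rX: "rapid (Suc k) X X'"
    using ptw_sub[OF x(2) \<rho>(1)] \<rho>(2) by (simp_all add: X_def X'_def \<Xi>_def)
  have PZ: "ptw Z Z' D H" and rZ: "rapid (Suc k) Z Z'"
    using ptw_sub[OF z(2) \<sigma>(1)] \<sigma>(2) by (simp_all add: Z_def Z'_def H_def)
  note sX = ptw_seq[OF PX] and sZ = ptw_seq[OF PZ] and PX1 = ptw_shift[OF PX]
  \<comment> \<open>A pair \<open>(m, p)\<close> represents, at stage \<open>m\<close> of the
    shifted sequence \<open>X\<close>, the value of \<open>w\<close> on the \<open>n\<close>-th
    universal section of \<open>D\<close>.\<close>
  define lift where "lift n = (\<lambda>(m, p). mor p (Z n) (Sob C (X m)) \<and>
     w (Z n) (H n) = Pmor (psh_shift C A) p (\<Xi> m))" for n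
  have ex: "\<exists>m p. N \<le> m \<and> lift n (m, p)" for n N
  proof -
    obtain m p where "N \<le> m" "mor p (Z n) (Sob C (X m))" "w (Z n) (H n) = Pmor (psh_shift C A) p (\<Xi> m)"
      using ptw_repr[OF PX1 seq_in_obj[OF sZ] ntr_act[OF w seq_in_obj[OF sZ] ptw_sec[OF PZ]], of N] by blast
    then show ?thesis unfolding lift_def by blast
  qed
  have "\<exists>t. \<forall>n. lift n (t n) \<and> (fst (t n) < fst (t (Suc n)) \<and>
      snd (t (Suc n)) \<cdot> Z' n = Smor C (tr X X' (fst (t n)) (fst (t (Suc n)))) \<cdot> snd (t n))"
  proof (rule dependent_nat_choice)
    show "\<exists>t. lift 0 t" using ex by blast
    fix t n assume "lift n t"
    then obtain m p where t: "t = (m, p)" and p: "mor p (Z n) (Sob C (X m))"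
      "w (Z n) (H n) = Pmor (psh_shift C A) p (\<Xi> m)" by (auto simp: lift_def)
    \<comment> \<open>Starting from \<open>Suc m\<close> makes the chosen stages strictly
      increasing.\<close>
    obtain m1 p1 where p1: "Suc m \<le> m1" "mor p1 (Z (Suc n)) (Sob C (X m1))"
      "w (Z (Suc n)) (H (Suc n)) = Pmor (psh_shift C A) p1 (\<Xi> m1)"
      using ex[of "Suc m" "Suc n"] by (auto simp: lift_def)
    note zm = seq_in_mor[OF sZ, of n]
    have "Pmor (psh_shift C A) p (\<Xi> m) = Pmor (psh_shift C A) (p1 \<cdot> Z' n) (\<Xi> m1)"
      using p(2) p1(3) psh_cmp[OF ptw_psh[OF PX1] zm p1(2) ptw_sec[OF PX1]]
        ntr_natural[OF w zm ptw_sec[OF PZ]] ptw_compat[OF PZ, of n] by simp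
    \<comment> \<open>The old representative and the restriction of the new one define the same
      section, so they agree at some stage \<open>l\<close>. Pushing \<open>p1\<close> there makes
      the square commute exactly.\<close>
    then obtain l where l: "m \<le> l" "m1 \<le> l"
       "Smor C (tr X X' m l) \<cdot> p = Smor C (tr X X' m1 l) \<cdot> (p1 \<cdot> Z' n)"
      using ptw_eq[OF PX1 p(1) mor_cmp[OF zm p1(2)]] tr_Sob[OF sX] by metis
    note tm = mor_Smor[OF tr_mor[OF sX l(2)]]
    have "lift (Suc n) (l, Smor C (tr X X' m1 l) \<cdot> p1)"
      using mor_cmp[OF p1(2) tm] ptw_push[OF PX1 p1(2) l(2)] p1(3) tr_Sob[OF sX] by (simp add: lift_def)
    then show "\<exists>t'. lift (Suc n) t' \<and> (fst t < fst t' \<and>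
        snd t' \<cdot> Z' n = Smor C (tr X X' (fst t) (fst t')) \<cdot> snd t)"
      using l p1(1) t cmp_mor_assoc[OF zm p1(2) tm]
      by (intro exI[of _ "(l, Smor C (tr X X' m1 l) \<cdot> p1)"]) simp
  qed
  then obtain t where t: "\<And>n. lift n (t n)" "\<And>n. fst (t n) < fst (t (Suc n))"
     "\<And>n. snd (t (Suc n)) \<cdot> Z' n = Smor C (tr X X' (fst (t n)) (fst (t (Suc n)))) \<cdot> snd (t n)" by blast
  \<comment> \<open>Only \<open>X\<close> is reindexed; \<open>Z\<close> keeps its own
    stages.\<close>
  define \<phi> r where "\<phi> n = fst (t n)" and "r n = snd (t n)" for n
  have \<phi>: "strict_mono \<phi>" using t(2) by (simp add: strict_mono_Suc_iff \<phi>_def)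
  have r: "mor (r n) (Z n) (Sob C ((X \<circ> \<phi>) n))" "w (Z n) (H n) = Pmor (psh_shift C A) (r n) ((\<Xi> \<circ> \<phi>) n)"
    "r (Suc n) \<cdot> Z' n = Smor C (sub X X' \<phi> n) \<cdot> r n" for n
    using t(1)[of n] t(3)[of n] by (auto simp: lift_def r_def \<phi>_def sub_def split_beta)
  obtain y y' \<eta> where y: "rapid (Suc k) y y'" "\<And>n. y n \<in> star C {(X \<circ> \<phi>) n} {Z n}" "ptw y y' B \<eta>"
    using rapid_extension[OF rapid_sub[OF rX \<phi>] rZ ptw_sub[OF PX \<phi>] PZ r B D] by blast
  have "y n \<in> M i" for n
    using M_star[OF _ _ y(2)] x(3) z(3) by (simp add: X_def Z_def)
  then show ?thesis using that rapid_cauchy[OF y(1)] y(3) by blast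
qed

end

end

section \<open>The good metric on the completion\<close>

context yoneda
begin

text \<open>The canonical isomorphism corresponds under Yoneda to the identity of \<open>a\<close>,
  viewed as a section of the shifted representable over \<open>Sob C a\<close>.\<close>

lemma Yshift_yo:
  assumes a: "a \<in> Obj C"
  shows "Yshift \<iota> C a = yo (psh_shift C (Y a)) (Sob C a) (\<iota> (Idn C a))"
proof -
  have "Pmor (psh_shift C (Y a)) f (\<iota> (Idn C a)) = \<iota> (Smor_inv C f)" if f: "mor f s (Sob C a)" for f s
  proof -
    have f': "mor (Smor_inv C f) (Sob_inv C s) a" using mor_Smor_inv[OF f] by (simp add: Sob_inv_Sob a)
    show ?thesis
      using psh_shift_Pmor[OF f, of "Y a"] Y_act[OF f' mor_idn[OF a]] idn_cmp[OF f'] by simp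
  qed
  then show ?thesis
    using Sob_obj[OF a] by (auto simp: Yshift_def yo_def fun_eq_iff mor_def)
qed

lemma ntr_shift:
  assumes "ntr \<eta> F G"
  shows "ntr (\<lambda>s\<in>Obj C. \<eta> (Sob_inv C s)) (psh_shift C F) (psh_shift C G)"
proof -
  have "(\<lambda>s\<in>Obj C. \<eta> (Sob_inv C s)) \<in> nat_trans C (psh_shift C F) (psh_shift C G)"
  proof (rule nat_transI)
    fix s assume s: "s \<in> Obj C"
    show "(\<lambda>s\<in>Obj C. \<eta> (Sob_inv C s)) s \<in> extensional (sec (psh_shift C F) s)"
      using assms Sob_inv_obj[OF s] by (simp add: s psh_shift_Pob ntr_def nat_trans_def)
    fix x assume x: "x \<in> sec (psh_shift C F) s"
    show "(\<lambda>s\<in>Obj C. \<eta> (Sob_inv C s)) s x \<in> sec (psh_shift C G) s"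
      using ntr_act[OF assms Sob_inv_obj[OF s]] x by (simp add: s psh_shift_Pob)
    fix y assume y: "y \<in> sec (psh_shift C F) s"
    show "(\<lambda>s\<in>Obj C. \<eta> (Sob_inv C s)) s (x \<otimes>\<^bsub>Pob (psh_shift C F) s\<^esub> y) =
       (\<lambda>s\<in>Obj C. \<eta> (Sob_inv C s)) s x \<otimes>\<^bsub>Pob (psh_shift C G) s\<^esub> (\<lambda>s\<in>Obj C. \<eta> (Sob_inv C s)) s y"
      using ntr_mult[OF assms Sob_inv_obj[OF s]] x y by (simp add: s psh_shift_Pob)
  next
    fix f s t x assume f: "mor f s t" and x: "x \<in> sec (psh_shift C F) t"
    show "(\<lambda>s\<in>Obj C. \<eta> (Sob_inv C s)) s (Pmor (psh_shift C F) f x) =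
        Pmor (psh_shift C G) f ((\<lambda>s\<in>Obj C. \<eta> (Sob_inv C s)) t x)"
      using ntr_natural[OF assms mor_Smor_inv[OF f]] x mor_obj[OF f]
      by (simp add: psh_shift_Pmor[OF f] psh_shift_Pob)
  qed simp
  then show ?thesis using assms by (simp add: ntr_def psh_shift_psh)
qed

text \<open>Translates the third square of a strong triangle into sections: the composite through
  the shifted cocone classifies the restriction of \<open>x\<close> along \<open>h\<close>.\<close>

lemma nt_shift_Yshift:
  assumes F: "additive_psh C F" and a: "a \<in> Obj C" and x: "x \<in> sec F a" and h: "mor h c (Sob C a)"
  shows "nt_comp C (nt_shift C (yo F a x)) (nt_comp C (Yshift \<iota> C a) (Ymor \<iota> C h)) =
    yo (psh_shift C F) c (Pmor (psh_shift C F) h x)"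
proof -
  have h': "mor (Smor_inv C h) (Sob_inv C c) a" using mor_Smor_inv[OF h] by (simp add: Sob_inv_Sob a)
  have c: "c \<in> Obj C" using mor_obj(1)[OF h] .
  have "\<iota> (Idn C a) \<in> sec (psh_shift C (Y a)) (Sob C a)"
    using mor_idn[OF a] sec_Y_iff[OF a a] by (auto simp: psh_shift_Pob Sob_obj Sob_inv_Sob a)
  then have "nt_comp C (Yshift \<iota> C a) (Ymor \<iota> C h) =
      yo (psh_shift C (Y a)) c (Pmor (psh_shift C (Y a)) h (\<iota> (Idn C a)))"
    using nt_comp_Ymor[OF psh_shift_psh[OF Y_psh[OF a]] _ h] Yshift_yo[OF a] by simp
  also have "Pmor (psh_shift C (Y a)) h (\<iota> (Idn C a)) = \<iota> (Smor_inv C h)"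
    using psh_shift_Pmor[OF h, of "Y a"] Y_act[OF h' mor_idn[OF a]] idn_cmp[OF h'] by simp
  finally have 1: "nt_comp C (Yshift \<iota> C a) (Ymor \<iota> C h) = yo (psh_shift C (Y a)) c (\<iota> (Smor_inv C h))" .
  obtain \<eta> where \<eta>: "yo F a x = (Y a, F, \<eta>)" "\<eta> \<in> nat_trans C (Y a) F"
    using nt_carrierE[OF yo_carrier[OF F a x]] .
  then have n: "ntr \<eta> (Y a) F" using F Y_psh[OF a] by (simp add: ntr_def)
  have s: "\<iota> (Smor_inv C h) \<in> sec (psh_shift C (Y a)) c"
    using h' sec_Y_iff[OF a Sob_inv_obj[OF c]] by (auto simp: psh_shift_Pob c)
  have "\<eta> (Sob_inv C c) (\<iota> (Smor_inv C h)) = Pmor (psh_shift C F) h x"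
    using yo_eval[OF h', of F x] \<eta>(1) psh_shift_Pmor[OF h, of F] by simp
  then show ?thesis
    using nt_comp_yo[OF ntr_shift[OF n] c s] \<eta>(1) 1 c by (simp add: nt_shift_def)
qed

end

locale completion = good_metric_category C M + yoneda C \<iota>
  for C :: "('o, 'm, 'z) tcat_scheme" (structure) and M :: "nat \<Rightarrow> 'o set" and \<iota> :: "'m \<Rightarrow> 'g" +
  assumes infinite_universe: "infinite (UNIV :: 'g set)"
begin

lemma colim_iff_ptw:
  assumes "cauchy C M E e"
  shows "(\<exists>l. is_colim (ModCat C) (\<lambda>n. Y (E n)) (\<lambda>n. Ymor \<iota> C (e n)) F l) \<longleftrightarrow> (\<exists>x. ptw E e F x)"
proof
  assume "\<exists>l. is_colim (ModCat C) (\<lambda>n. Y (E n)) (\<lambda>n. Ymor \<iota> C (e n)) F l"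
  then obtain l where "is_colim (ModCat C) (\<lambda>n. Y (E n)) (\<lambda>n. Ymor \<iota> C (e n)) F l" ..
  then show "\<exists>x. ptw E e F x"
    using ptw_of_colim[OF cauchy_seq_in[OF assms] infinite_universe] by blast
qed (blast dest: colim_of_ptw)

lemma N_metric_iff: "F \<in> N_metric \<iota> C M i \<longleftrightarrow> F \<in> S_objs \<iota> C M \<and>
    (\<exists>E e. cauchy C M E e \<and> (\<forall>n. E n \<in> M i) \<and> (\<exists>x. ptw E e F x))"
  by (auto simp: N_metric_def L_metric_def colim_iff_ptw cong: conj_cong)

lemma L_objs_iff: "F \<in> L_objs \<iota> C M \<longleftrightarrow> (\<exists>E e. cauchy C M E e \<and> (\<exists>x. ptw E e F x))"
  by (simp add: L_objs_def colim_iff_ptw cong: conj_cong)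

lemma S_objs_iff: "F \<in> S_objs \<iota> C M \<longleftrightarrow> F \<in> L_objs \<iota> C M \<and> (\<exists>k. orth k F)"
  using right_orth_ModCat[of "M _" F] M_obj by (auto simp: S_objs_def orth_def subset_iff)

lemma S_objs_psh: "F \<in> S_objs \<iota> C M \<Longrightarrow> additive_psh C F"
  by (auto simp: S_objs_iff orth_def)

lemma S_objs_shift:
  assumes "F \<in> S_objs \<iota> C M"
  shows "psh_shift C F \<in> S_objs \<iota> C M" "psh_unshift F \<in> S_objs \<iota> C M"
proof -
  obtain E e x k where "cauchy C M E e" "ptw E e F x" "orth k F"
    using assms unfolding S_objs_iff L_objs_iff by blast
  note shifts = cauchy_shift[OF this(1)] cauchy_unshift[OF this(1)] ptw_shift[OF this(2)] ptw_unshift[OF this(2)]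
    orth_shift[OF this(3)] orth_unshift[OF this(3)]
  show "psh_shift C F \<in> S_objs \<iota> C M" using shifts(1,3,5) unfolding S_objs_iff L_objs_iff by blast
  show "psh_unshift F \<in> S_objs \<iota> C M" using shifts(2,4,6) unfolding S_objs_iff L_objs_iff by blast
qed

lemma N_metric_shift:
  assumes "F \<in> N_metric \<iota> C M (Suc i)"
  shows "psh_shift C F \<in> N_metric \<iota> C M i" "psh_unshift F \<in> N_metric \<iota> C M i"
proof -
  have S: "F \<in> S_objs \<iota> C M" using assms by (simp add: N_metric_def)
  obtain E e x where E: "cauchy C M E e" "\<And>n. E n \<in> M (Suc i)" "ptw E e F x"
    using assms by (auto simp: N_metric_iff)
  show "psh_shift C F \<in> N_metric \<iota> C M i"
    using cauchy_shift[OF E(1)] ptw_shift[OF E(3)] M_Sob[OF E(2)] S_objs_shift(1)[OF S]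
    unfolding N_metric_iff by blast
  show "psh_unshift F \<in> N_metric \<iota> C M i"
    using cauchy_unshift[OF E(1)] ptw_unshift[OF E(3)] M_Sob_inv[OF E(2)] S_objs_shift(2)[OF S]
    unfolding N_metric_iff by blast
qed

lemma N_metric_Suc: "N_metric \<iota> C M (Suc i) \<subseteq> N_metric \<iota> C M i"
  using M_Suc unfolding subset_iff N_metric_iff by blast

lemma S_cat_simps [simp]:
  "Obj (S_cat \<iota> C M) = S_objs \<iota> C M" "Hom (S_cat \<iota> C M) = nt_group C"
  "Sob (S_cat \<iota> C M) = psh_shift C"
  by (simp_all add: S_cat_def)

text \<open>The choice inverse is determined because \<open>psh_unshift\<close> preserves the
  objects of the completion and inverts the shift on them.\<close>

lemma Sob_inv_S_cat:
  assumes "F \<in> S_objs \<iota> C M"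
  shows "Sob_inv (S_cat \<iota> C M) F = psh_unshift F"
proof -
  have "inj_on (psh_shift C) (S_objs \<iota> C M)"
    by (rule inj_on_inverseI[of _ psh_unshift]) (simp add: psh_unshift_shift S_objs_psh)
  then show ?thesis
    unfolding Sob_inv_def
    using S_objs_shift(2)[OF assms] psh_shift_unshift[OF S_objs_psh[OF assms]]
    by (simp add: inv_into_f_eq)
qed

text \<open>The witness is the representable functor of a zero object of \<open>M i\<close>, the
  colimit of a constant sequence; all its groups of sections are trivial.\<close>

lemma N_metric_zero: "\<exists>Z\<in>N_metric \<iota> C M i. zero_object (S_cat \<iota> C M) Z"
proof -
  obtain Z where Z: "Z \<in> M i" "zero_object C Z" using M_zero .
  have o: "Z \<in> Obj C" using M_obj[OF Z(1)] .
  have E: "seq_in C (\<lambda>n. Z) (\<lambda>n. Idn C Z)" using mor_idn[OF o] by (rule seq_inI)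
  have "small i (tr (\<lambda>n. Z) (\<lambda>n. Idn C Z) n m)" if "n \<le> m" for i n m
    using small_tr[OF E small_idn[OF o] that] .
  then have c: "cauchy C M (\<lambda>n. Z) (\<lambda>n. Idn C Z)" using E by (auto simp: cauchy_iff)
  have sec: "sec (Y Z) s = {\<one>\<^bsub>Pob (Y Z) s\<^esub>}" if "s \<in> Obj C" for s
    using Z(2) that by (simp add: sec_Y Y_one zero_object_def)
  have P: "ptw (\<lambda>n. Z) (\<lambda>n. Idn C Z) (Y Z) (\<lambda>n. \<iota> (Idn C Z))"
    unfolding ptw_def
  proof (intro conjI allI ballI impI E Y_psh[OF o])
    show "\<iota> (Idn C Z) \<in> sec (Y Z) Z" using sec_Y_iff[OF o o] mor_idn[OF o] by blast
    show "Pmor (Y Z) (Idn C Z) (\<iota> (Idn C Z)) = \<iota> (Idn C Z)"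
      using Y_act[OF mor_idn[OF o] mor_idn[OF o]] idn_cmp[OF mor_idn[OF o]] by simp
    show "\<exists>n f. mor f s Z \<and> y = Pmor (Y Z) f (\<iota> (Idn C Z))" if s: "s \<in> Obj C" "y \<in> sec (Y Z) s" for s y
    proof -
      obtain f where "mor f s Z" "y = \<iota> f" using sec_YE[OF s(2) o s(1)] .
      then show ?thesis using Y_act[OF _ mor_idn[OF o]] idn_cmp by metis
    qed
    show "\<exists>m\<ge>n. tr (\<lambda>n. Z) (\<lambda>n. Idn C Z) n m \<cdot> f = zr s Z"
      if "mor f s Z \<and> Pmor (Y Z) f (\<iota> (Idn C Z)) = \<one>\<^bsub>Pob (Y Z) s\<^esub>" for n s f
      using that mor_into_zero[OF Z(2)] idn_cmp[of f s Z] by (intro exI[of _ n]) auto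
  qed
  have "orth k (Y Z)" for k using sec M_obj Y_psh[OF o] by (simp add: orth_def)
  then have S: "Y Z \<in> S_objs \<iota> C M" using c P unfolding S_objs_iff L_objs_iff by blast
  then have N: "Y Z \<in> N_metric \<iota> C M i" using c P Z(1) unfolding N_metric_iff by blast
  have "zero_object (S_cat \<iota> C M) (Y Z)"
    unfolding zero_object_def S_cat_simps
  proof (intro conjI ballI S)
    fix F assume "F \<in> S_objs \<iota> C M"
    then have F: "additive_psh C F" by (rule S_objs_psh)
    have 1: "\<one>\<^bsub>Pob F s\<^esub> \<in> sec F s" if "s \<in> Obj C" for s
      using psh_group(2)[OF F that] group.is_monoid monoid.one_closed by blast
    let ?z = "\<lambda>s\<in>Obj C. \<lambda>x\<in>sec F s. \<one>\<^bsub>Pob (Y Z) s\<^esub>"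
    have z: "?z \<in> nat_trans C F (Y Z)"
    proof (rule nat_transI)
      fix s x y assume "s \<in> Obj C" "x \<in> sec F s" "y \<in> sec F s"
      then show "?z s (x \<otimes>\<^bsub>Pob F s\<^esub> y) = ?z s x \<otimes>\<^bsub>Pob (Y Z) s\<^esub> ?z s y"
        using psh_group(2)[OF F] psh_group(2)[OF Y_psh[OF o]]
        by (simp add: group.is_monoid monoid.m_closed monoid.r_one monoid.one_closed)
    next
      fix f s t x assume f: "mor f s t" "x \<in> sec F t"
      then show "?z s (Pmor F f x) = Pmor (Y Z) f (?z t x)"
        using psh_act[OF F f] psh_one[OF Y_psh[OF o] f(1)] mor_obj[OF f(1)] by simp
    qed (use sec in auto)
    have "\<eta> = ?z" if "\<eta> \<in> nat_trans C F (Y Z)" for \<eta>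
    proof (rule nat_trans_eqI[OF that z])
      have n: "ntr \<eta> F (Y Z)" using that F Y_psh[OF o] by (simp add: ntr_def)
      show "\<eta> s x = ?z s x" if "s \<in> Obj C" "x \<in> sec F s" for s x
        using ntr_act[OF n that] sec[OF that(1)] that by simp
    qed
    then have "nat_trans C F (Y Z) = {?z}" using z by blast
    then show "carrier (nt_group C F (Y Z)) = {\<one>\<^bsub>nt_group C F (Y Z)\<^esub>}"
      by (simp add: nt_group_def)
    have FZ: "sec F Z = {\<one>\<^bsub>Pob F Z\<^esub>}" using psh_zero_object[OF F Z(2)] 1[OF o] by blast
    \<comment> \<open>Maps out of the representable are sections of \<open>F\<close> over
      \<open>Z\<close>, which vanish since additive functors kill zero objects.\<close>
    have "F \<in> right_orth (ModCat C) (Y ` {Z})"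
      using right_orth_ModCat[of "{Z}" F] F o FZ by simp
    then show "carrier (nt_group C (Y Z) F) = {\<one>\<^bsub>nt_group C (Y Z) F\<^esub>}"
      by (simp add: right_orth_def)
  qed
  then show ?thesis using N by blast
qed

text \<open>All data of the strong triangle are translated by Yoneda into sections, after which
  \<open>cauchy_extension\<close> yields a Cauchy sequence in \<open>M i\<close> with colimit
  \<open>B\<close>.\<close>

lemma N_metric_star: "star (S_cat \<iota> C M) (N_metric \<iota> C M i) (N_metric \<iota> C M i) \<subseteq> N_metric \<iota> C M i"
proof
  fix B assume "B \<in> star (S_cat \<iota> C M) (N_metric \<iota> C M i) (N_metric \<iota> C M i)"
  then obtain A D t where A: "A \<in> N_metric \<iota> C M i" and D: "D \<in> N_metric \<iota> C M i"
    and t: "dist_triangle (S_cat \<iota> C M) A B D t" unfolding star_def by blast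
  obtain U V W where tt: "t = (U, V, W)" by (cases t)
  have S: "A \<in> S_objs \<iota> C M" "B \<in> S_objs \<iota> C M" "D \<in> S_objs \<iota> C M"
    and U: "U \<in> carrier (nt_group C A B)" and V: "V \<in> carrier (nt_group C B D)"
    and W: "W \<in> carrier (nt_group C D (psh_shift C A))"
    using t by (auto simp: dist_triangle_def triangle_def tt)
  note psh = S_objs_psh[OF S(1)] S_objs_psh[OF S(2)] S_objs_psh[OF S(3)]
  obtain u where u: "U = (A, B, u)" "u \<in> nat_trans C A B" using nt_carrierE[OF U] .
  obtain v where v: "V = (B, D, v)" "v \<in> nat_trans C B D" using nt_carrierE[OF V] .
  obtain w where w: "W = (D, psh_shift C A, w)" "w \<in> nat_trans C D (psh_shift C A)" using nt_carrierE[OF W] .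
  have ntr: "ntr u A B" "ntr v B D" "ntr w D (psh_shift C A)"
    using u v w psh psh_shift_psh[OF psh(1)] by (auto simp: ntr_def)
  obtain A' B' D' where "strong_triangle \<iota> C M A' B' D' (U, V, W)"
    using t by (auto simp: dist_triangle_def tt S_cat_def)
  \<comment> \<open>Membership in \<open>Tri\<close> only asserts some objects, but morphisms are
    triples recording source and target, so they are the given ones.\<close>
  moreover from this have "A' = A" "B' = B" "D' = D"
    using u(1) v(1) by (auto simp: strong_triangle_def triangle_def nt_carrier)
  ultimately obtain a a' b b' c c' f g h l m n
    where T: "cauchy_triangles C M a a' b b' c c' (\<lambda>k. (f k, g k, h k))"
      and colim: "is_colim (ModCat C) (\<lambda>k. Y (a k)) (\<lambda>k. Ymor \<iota> C (a' k)) A l"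
        "is_colim (ModCat C) (\<lambda>k. Y (b k)) (\<lambda>k. Ymor \<iota> C (b' k)) B m"
        "is_colim (ModCat C) (\<lambda>k. Y (c k)) (\<lambda>k. Ymor \<iota> C (c' k)) D n"
      and comp: "\<And>k. nt_comp C U (l k) = nt_comp C (m k) (Ymor \<iota> C (f k))"
        "\<And>k. nt_comp C V (m k) = nt_comp C (n k) (Ymor \<iota> C (g k))"
        "\<And>k. nt_comp C W (n k) = nt_comp C (nt_shift C (l k)) (nt_comp C (Yshift \<iota> C (a k)) (Ymor \<iota> C (h k)))"
    unfolding strong_triangle_def by auto
  have dist: "dist_triangle C (a k) (b k) (c k) (f k, g k, h k)"
    and maps: "triangle_map C (f k, g k, h k) (f (Suc k), g (Suc k), h (Suc k)) (a' k) (b' k) (c' k)" for k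
    using T by (auto simp: cauchy_triangles_def)
  have seqs: "seq_in C a a'" "seq_in C b b'" "seq_in C c c'"
    using T cauchy_seq_in by (auto simp: cauchy_triangles_def)
  obtain \<alpha> where \<alpha>: "ptw a a' A \<alpha>" "\<And>k. l k = yo A (a k) (\<alpha> k)"
    using ptw_of_colim[OF seqs(1) infinite_universe colim(1)] by blast
  obtain \<beta> where \<beta>: "ptw b b' B \<beta>" "\<And>k. m k = yo B (b k) (\<beta> k)"
    using ptw_of_colim[OF seqs(2) infinite_universe colim(2)] by blast
  obtain \<gamma> where \<gamma>: "ptw c c' D \<gamma>" "\<And>k. n k = yo D (c k) (\<gamma> k)"
    using ptw_of_colim[OF seqs(3) infinite_universe colim(3)] by blast
  note mor = dist_mor(1)[OF dist] dist_mor(2)[OF dist] dist_mor(3)[OF dist]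
  note o = dist_mor(4)[OF dist] dist_mor(5)[OF dist] dist_mor(6)[OF dist]
  note sec = ptw_sec[OF \<alpha>(1)] ptw_sec[OF \<beta>(1)] ptw_sec[OF \<gamma>(1)]
  note A1 = psh_shift_psh[OF psh(1)]
  have u\<alpha>: "u (a k) (\<alpha> k) = Pmor B (f k) (\<beta> k)" for k
  proof (rule yo_inj[OF psh(2) o(1)[of k]])
    show "yo B (a k) (u (a k) (\<alpha> k)) = yo B (a k) (Pmor B (f k) (\<beta> k))"
      using comp(1)[of k] nt_comp_yo[OF ntr(1) o(1) sec(1), of k] nt_comp_Ymor[OF psh(2) sec(2) mor(1), of k]
        \<alpha>(2) \<beta>(2) u(1) by simp
  qed (use ntr_act[OF ntr(1) o(1) sec(1)] psh_act[OF psh(2) mor(1) sec(2)] in auto)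
  have v\<beta>: "v (b k) (\<beta> k) = Pmor D (g k) (\<gamma> k)" for k
  proof (rule yo_inj[OF psh(3) o(2)[of k]])
    show "yo D (b k) (v (b k) (\<beta> k)) = yo D (b k) (Pmor D (g k) (\<gamma> k))"
      using comp(2)[of k] nt_comp_yo[OF ntr(2) o(2) sec(2), of k] nt_comp_Ymor[OF psh(3) sec(3) mor(2), of k]
        \<beta>(2) \<gamma>(2) v(1) by simp
  qed (use ntr_act[OF ntr(2) o(2) sec(2)] psh_act[OF psh(3) mor(2) sec(3)] in auto)
  have w\<gamma>: "w (c k) (\<gamma> k) = Pmor (psh_shift C A) (h k) (\<alpha> k)" for k
  proof (rule yo_inj[OF A1 o(3)[of k]])
    show "yo (psh_shift C A) (c k) (w (c k) (\<gamma> k)) =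
        yo (psh_shift C A) (c k) (Pmor (psh_shift C A) (h k) (\<alpha> k))"
      using comp(3)[of k] nt_comp_yo[OF ntr(3) o(3) sec(3), of k]
        nt_shift_Yshift[OF psh(1) o(1) sec(1) mor(3), of k] \<alpha>(2) \<gamma>(2) w(1) by simp
  qed (use ntr_act[OF ntr(3) o(3) sec(3)] psh_act[OF A1 mor(3) ptw_sec[OF ptw_shift[OF \<alpha>(1)]]] in auto)
  obtain x x' \<xi> where x: "cauchy C M x x'" "ptw x x' A \<xi>" "\<And>k. x k \<in> M i"
    using A unfolding N_metric_iff by blast
  obtain z z' \<zeta> where z: "cauchy C M z z'" "ptw z z' D \<zeta>" "\<And>k. z k \<in> M i"
    using D unfolding N_metric_iff by blast
  obtain k1 k2 where "orth k1 B" "orth k2 D" using S unfolding S_objs_iff by blast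
  \<comment> \<open>One index must serve both \<open>B\<close>, to extend sections, and
    \<open>D\<close>, to check compatibility with \<open>v\<close>.\<close>
  then have orth: "orth (max k1 k2) B" "orth (max k1 k2) D"
    using orth_mono[of k1 "max k1 k2" B] orth_mono[of k2 "max k1 k2" D] by auto
  obtain y y' \<eta> where "cauchy C M y y'" "ptw y y' B \<eta>" "\<And>k. y k \<in> M i"
    using cauchy_extension[OF dist maps \<alpha>(1) \<beta>(1) \<gamma>(1) ntr u\<alpha> v\<beta> w\<gamma> x z orth] by blast
  then show "B \<in> N_metric \<iota> C M i" using S(2) unfolding N_metric_iff by blast
qed

end

theorem proposition0p7:
  fixes S :: "('o, 'm) tcat"
    and \<M> :: "nat \<Rightarrow> 'o set"
    and \<iota> :: "'m \<Rightarrow> 'g"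
  assumes "triangulated_category S"
    and "good_metric S \<M>"
    and "inj \<iota>" and "infinite (UNIV :: 'g set)"
  shows "good_metric (S_cat \<iota> S \<M>) (N_metric \<iota> S \<M>)"
proof -
  interpret triangulated_category S by fact
  interpret completion S \<M> \<iota> by unfold_locales fact+
  have "Sob_inv (S_cat \<iota> S \<M>) ` N_metric \<iota> S \<M> (Suc i) \<subseteq> N_metric \<iota> S \<M> i" for i
    using N_metric_shift(2)[of _ i] Sob_inv_S_cat by (auto simp: N_metric_def)
  moreover have "Sob (S_cat \<iota> S \<M>) ` N_metric \<iota> S \<M> (Suc i) \<subseteq> N_metric \<iota> S \<M> i" for i
    using N_metric_shift(1) by auto
  moreover have "N_metric \<iota> S \<M> i \<subseteq> Obj (S_cat \<iota> S \<M>)" for i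
    by (auto simp: N_metric_def)
  ultimately show ?thesis
    using N_metric_zero N_metric_Suc N_metric_star unfolding good_metric_def by auto
qed

end
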